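(* Let $A$ and $B$ be (non-degenerate) open projective planes with $A\subseteq B$ (i.e. $A$ is a substructure of $B$). Then $A$ is an elementary substructure of $B$ if and only if $B$ is HF-constructible over $A$.
   Context: Projective planes are viewed as structures in a two-sorted language with sorts for points and lines and a point–line incidence relation; "elementary substructure" refers to this language. A partial plane is a system of points and lines such that two distinct points lie on at most one common line and two distinct lines meet in at most one common point; a projective plane requires exactly one in both cases, and is non-degenerate if it contains four points no three collinear. A partial plane $P$ is open if there is no finite subconfiguration (subset with induced incidence) $A$ of $P$ in which every element is incident with at least three elements of $A$. For partial planes $A\subseteq B$, $B$ is HF-constructible over $A$ if there is a linear ordering $<$ of $B-A$ (not necessarily a well-ordering) such that every $b\in B-A$ is incident with at most two elements of $B$ that either lie in $A$ or lie in $B-A$ and are $<$-smaller than $b$. *)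

theory Defs
  imports Main
begin

text \<open>
  Only the values of \<open>inc\<close> on \<open>points \<times> lines\<close> are meaningful; every notion below
  consults \<open>inc\<close> on this set only.
\<close>

record ('p, 'l) plane =
  points :: "'p set"
  lines :: "'l set"
  inc :: "'p \<Rightarrow> 'l \<Rightarrow> bool"

definition partial_plane :: "('p, 'l) plane \<Rightarrow> bool" where
  "partial_plane P \<longleftrightarrow>
     (\<forall>p\<in>points P. \<forall>q\<in>points P. p \<noteq> q \<longrightarrow>
        (\<forall>k\<in>lines P. \<forall>l\<in>lines P.
           inc P p k \<and> inc P q k \<and> inc P p l \<and> inc P q l \<longrightarrow> k = l)) \<and>
     (\<forall>k\<in>lines P. \<forall>l\<in>lines P. k \<noteq> l \<longrightarrow>
        (\<forall>p\<in>points P. \<forall>q\<in>points P.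
           inc P p k \<and> inc P p l \<and> inc P q k \<and> inc P q l \<longrightarrow> p = q))"

definition projective_plane :: "('p, 'l) plane \<Rightarrow> bool" where
  "projective_plane P \<longleftrightarrow>
     (\<forall>p\<in>points P. \<forall>q\<in>points P. p \<noteq> q \<longrightarrow> (\<exists>!l. l \<in> lines P \<and> inc P p l \<and> inc P q l)) \<and>
     (\<forall>k\<in>lines P. \<forall>l\<in>lines P. k \<noteq> l \<longrightarrow> (\<exists>!p. p \<in> points P \<and> inc P p k \<and> inc P p l))"

definition collinear :: "('p, 'l) plane \<Rightarrow> 'p set \<Rightarrow> bool" where
  "collinear P S \<longleftrightarrow> (\<exists>l\<in>lines P. \<forall>p\<in>S. inc P p l)"

definition nondegenerate :: "('p, 'l) plane \<Rightarrow> bool" where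
  "nondegenerate P \<longleftrightarrow>
     (\<exists>Q. Q \<subseteq> points P \<and> card Q = 4 \<and> (\<forall>T. T \<subseteq> Q \<and> card T = 3 \<longrightarrow> \<not> collinear P T))"

text \<open>Points and lines together, as tagged elements of a disjoint sum.\<close>

definition elements :: "('p, 'l) plane \<Rightarrow> ('p + 'l) set" where
  "elements P = points P <+> lines P"

fun incident :: "('p, 'l) plane \<Rightarrow> 'p + 'l \<Rightarrow> 'p + 'l \<Rightarrow> bool" where
  "incident P (Inl p) (Inr l) = inc P p l"
| "incident P (Inr l) (Inl p) = inc P p l"
| "incident P (Inl p) (Inl q) = False"
| "incident P (Inr k) (Inr l) = False"

text \<open>The empty configuration is excluded, since it satisfies the degree condition vacuously.\<close>

definition open_plane :: "('p, 'l) plane \<Rightarrow> bool" where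
  "open_plane P \<longleftrightarrow> partial_plane P \<and>
     \<not> (\<exists>C. C \<subseteq> elements P \<and> finite C \<and> C \<noteq> {} \<and>
          (\<forall>x\<in>C. 3 \<le> card {y \<in> C. incident P x y}))"

definition substructure :: "('p, 'l) plane \<Rightarrow> ('p, 'l) plane \<Rightarrow> bool" where
  "substructure A B \<longleftrightarrow> points A \<subseteq> points B \<and> lines A \<subseteq> lines B \<and>
     (\<forall>p\<in>points A. \<forall>l\<in>lines A. inc A p l \<longleftrightarrow> inc B p l)"

text \<open>
  The order is not assumed to be well-founded.  The explicit \<open>finite\<close> is needed
  because \<open>card\<close> is 0 on infinite sets.
\<close>

definition hf_constructible :: "('p, 'l) plane \<Rightarrow> ('p, 'l) plane \<Rightarrow> bool" where
  "hf_constructible A B \<longleftrightarrow>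
     (\<exists>r. strict_linear_order_on (elements B - elements A) r \<and>
        (\<forall>b \<in> elements B - elements A.
           let N = {x \<in> elements B.
                      incident B b x \<and> (x \<in> elements A \<or> (x \<notin> elements A \<and> (x, b) \<in> r))}
           in finite N \<and> card N \<le> 2))"

text \<open>
  First-order formulas of the two-sorted language of incidence.  Point variables and line
  variables are separate copies of \<open>nat\<close>; \<open>Inc i j\<close> says that the point named by point
  variable \<open>i\<close> lies on the line named by line variable \<open>j\<close>.
\<close>

datatype form =
    EqPoint nat nat
  | EqLine nat nat
  | Inc nat nat
  | Neg form
  | Conj form form
  | ExPoint nat form
  | ExLine nat form

primrec sat :: "('p, 'l) plane \<Rightarrow> (nat \<Rightarrow> 'p) \<Rightarrow> (nat \<Rightarrow> 'l) \<Rightarrow> form \<Rightarrow> bool" where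
  "sat M e f (EqPoint i j) \<longleftrightarrow> e i = e j"
| "sat M e f (EqLine i j) \<longleftrightarrow> f i = f j"
| "sat M e f (Inc i j) \<longleftrightarrow> inc M (e i) (f j)"
| "sat M e f (Neg \<phi>) \<longleftrightarrow> \<not> sat M e f \<phi>"
| "sat M e f (Conj \<phi> \<psi>) \<longleftrightarrow> sat M e f \<phi> \<and> sat M e f \<psi>"
| "sat M e f (ExPoint i \<phi>) \<longleftrightarrow> (\<exists>p\<in>points M. sat M (e(i := p)) f \<phi>)"
| "sat M e f (ExLine j \<phi>) \<longleftrightarrow> (\<exists>l\<in>lines M. sat M e (f(j := l)) \<phi>)"

definition elementary_substructure :: "('p, 'l) plane \<Rightarrow> ('p, 'l) plane \<Rightarrow> bool" where
  "elementary_substructure A B \<longleftrightarrow> substructure A B \<and>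
     (\<forall>\<phi> e f. range e \<subseteq> points A \<and> range f \<subseteq> lines A \<longrightarrow> (sat A e f \<phi> \<longleftrightarrow> sat B e f \<phi>))"

end

theory Submission
  imports Defs "HOL-Library.Countable_Set"
begin

text \<open>
  By compactness, \<open>B\<close> is HF-constructible over \<open>A\<close> iff \<open>A\<close> is strong in \<open>B\<close>: there is no obstruction, i.e.
  no nonempty finite \<open>X \<subseteq> B - A\<close> all of whose elements have at least three neighbours in \<open>X \<union> A\<close>.

  If \<open>A\<close> is elementary in \<open>B\<close> and \<open>X\<close> is an obstruction over \<open>A\<close>, let \<open>T\<close> be a finite set of elements of
  \<open>A\<close> that \<open>X\<close> is attached to. Elementarity yields three disjoint copies of \<open>X\<close> over \<open>T\<close> inside \<open>A\<close>; every
  element of \<open>T\<close> then has a neighbour in each copy, so \<open>T\<close> and the copies contradict openness of \<open>A\<close>.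

  Conversely, if \<open>A\<close> is strong in \<open>B\<close>, pass to ultrapowers of \<open>A\<close> and \<open>B\<close> with respect to a nonprincipal
  ultrafilter on the natural numbers. These are countably saturated, and isomorphisms between countable strong
  subsets form a back-and-forth system. Two facts make the extension steps possible. A finite set has only
  finitely many obstructions of a given size, so that countable sets have countable strong hulls and
  strongness is expressed by a countable type. And every element \<open>l\<close> has generic neighbours: if almost all
  neighbours of \<open>l\<close> had obstructions of bounded size, then joining them by long paths would produce
  infinitely many obstructions of bounded size over a finite set.
\<close>

section \<open>Obstructions\<close>

text \<open>An element may have two earlier neighbours in an HF-order, so what blocks such an order
  is degree three, and three disjoint copies are what turns an obstruction over \<open>T\<close>
  into one over the empty set. The same count controls obstructions inside an open graph: over a
  finite base, three pairwise disjoint ones cannot share their attachment set. For each finite base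
  and each size there are only finitely many obstructions, but no bound on the sizes is available.
  Hence the back-and-forth moves countable sets instead of finite ones, and one step has to realise
  a countable type; \<open>A\<close> and \<open>B\<close> may fail to do so, their ultrapowers do
  not. The delicate extension is by an element with at most one neighbour in the domain: nothing
  determines its image, and generic neighbours supply it. Points and lines are vertices of one
  bipartite graph, which treats a statement and its dual together. The graph is always that of
  \<open>B\<close>, with \<open>A\<close> a set of vertices. The ultrapower is again such a graph,
  so every lemma on obstructions applies there, and the identity on a strong subset of the
  ultrapower of \<open>A\<close> can start the back-and-forth.\<close>

locale bipartite_graph =
  fixes adj :: "'v \<Rightarrow> 'v \<Rightarrow> bool" and s :: "'v \<Rightarrow> bool"
  assumes adj_sym: "adj x y \<Longrightarrow> adj y x"
    and adj_sort: "adj x y \<Longrightarrow> s x \<noteq> s y"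
begin

definition deg_ge2 :: "'v set \<Rightarrow> 'v \<Rightarrow> bool" where
  "deg_ge2 S x \<longleftrightarrow> (\<exists>a\<in>S. \<exists>b\<in>S. a \<noteq> b \<and> adj x a \<and> adj x b)"

text \<open>Three witnesses instead of a cardinality: infinitely many neighbours then count without
  a finiteness proviso, and over a finite index set the condition passes coordinatewise to
  ultrapowers.\<close>

definition deg_ge3 :: "'v set \<Rightarrow> 'v \<Rightarrow> bool" where
  "deg_ge3 S x \<longleftrightarrow> (\<exists>a\<in>S. \<exists>b\<in>S. \<exists>c\<in>S. a \<noteq> b \<and> a \<noteq> c \<and> b \<noteq> c \<and> adj x a \<and> adj x b \<and> adj x c)"

definition obstruction :: "'v set \<Rightarrow> 'v set \<Rightarrow> bool" where
  "obstruction F X \<longleftrightarrow> finite X \<and> X \<noteq> {} \<and> X \<inter> F = {} \<and> (\<forall>x\<in>X. deg_ge3 (X \<union> F) x)"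

text \<open>
  The finitary form of \<open>V\<close> being HF-constructible over \<open>D\<close>; thus \<open>strong {} V\<close> says that \<open>V\<close> is open.
\<close>

definition strong :: "'v set \<Rightarrow> 'v set \<Rightarrow> bool" where
  "strong D V \<longleftrightarrow> D \<subseteq> V \<and> (\<forall>X\<subseteq>V. \<not> obstruction D X)"

lemma adj_irrefl: "\<not> adj x x"
  using adj_sort by blast

lemma deg_ge3E:
  assumes "deg_ge3 S x"
  obtains a b c where "a \<in> S" "b \<in> S" "c \<in> S" "a \<noteq> b" "a \<noteq> c" "b \<noteq> c" "adj x a" "adj x b" "adj x c"
  using assms unfolding deg_ge3_def by blast

lemma deg_ge2_mono: "deg_ge2 S x \<Longrightarrow> S \<subseteq> T \<Longrightarrow> deg_ge2 T x"
  unfolding deg_ge2_def by blast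

lemma deg_ge3_mono: "deg_ge3 S x \<Longrightarrow> S \<subseteq> T \<Longrightarrow> deg_ge3 T x"
  unfolding deg_ge3_def by blast

lemma deg_ge3I: "a \<in> S \<Longrightarrow> b \<in> S \<Longrightarrow> c \<in> S \<Longrightarrow> a \<noteq> b \<Longrightarrow> a \<noteq> c \<Longrightarrow> b \<noteq> c \<Longrightarrow>
    adj x a \<Longrightarrow> adj x b \<Longrightarrow> adj x c \<Longrightarrow> deg_ge3 S x"
  unfolding deg_ge3_def by blast

lemma deg_ge3_imp_deg_ge2_remove:
  assumes "deg_ge3 S x"
  shows "deg_ge2 (S - {a}) x"
proof -
  obtain b c d where "b \<in> S" "c \<in> S" "d \<in> S" "b \<noteq> c" "b \<noteq> d" "c \<noteq> d" "adj x b" "adj x c" "adj x d"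
    using assms by (rule deg_ge3E)
  then show ?thesis unfolding deg_ge2_def by (cases "b = a"; cases "c = a") auto
qed

lemma deg_ge2_insert: "deg_ge2 S x \<Longrightarrow> y \<notin> S \<Longrightarrow> adj x y \<Longrightarrow> deg_ge3 (insert y S) x"
  unfolding deg_ge2_def by (auto intro: deg_ge3I[of _ _ _ y])

lemma deg_ge3_iff_card: "deg_ge3 S x \<longleftrightarrow> \<not> (finite {y\<in>S. adj x y} \<and> card {y\<in>S. adj x y} \<le> 2)"
proof
  assume "deg_ge3 S x"
  then obtain a b c where "{a,b,c} \<subseteq> {y\<in>S. adj x y}" "card {a,b,c} = 3"
    unfolding deg_ge3_def by (auto simp: card_insert_if)
  then show "\<not> (finite {y\<in>S. adj x y} \<and> card {y\<in>S. adj x y} \<le> 2)"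
    using card_mono[of "{y\<in>S. adj x y}" "{a,b,c}"] by linarith
next
  assume *: "\<not> (finite {y\<in>S. adj x y} \<and> card {y\<in>S. adj x y} \<le> 2)"
  have "\<exists>B\<subseteq>{y\<in>S. adj x y}. card B = 3"
  proof (cases "finite {y\<in>S. adj x y}")
    case True
    then have "3 \<le> card {y\<in>S. adj x y}" using * by simp
    then show ?thesis by (meson obtain_subset_with_card_n)
  next
    case False
    then show ?thesis using infinite_arbitrarily_large by blast
  qed
  then obtain a b c where "{a,b,c} \<subseteq> {y\<in>S. adj x y}" "a \<noteq> b" "b \<noteq> c" "a \<noteq> c"
    by (auto simp: card_3_iff)
  then show "deg_ge3 S x" by (intro deg_ge3I[of a S b c]) auto
qed

text \<open>Neighbours lost from \<open>X\<close> reappear in the larger base \<open>D\<close>, so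
  no degree drops.\<close>

lemma obstruction_remove:
  assumes "obstruction F X" "F \<subseteq> D" "X - D \<noteq> {}"
  shows "obstruction D (X - D)"
proof -
  have "X \<union> F \<subseteq> X - D \<union> D" using assms(2) by auto
  then have "\<forall>x\<in>X. deg_ge3 (X - D \<union> D) x" using assms(1) deg_ge3_mono unfolding obstruction_def by meson
  then show ?thesis using assms unfolding obstruction_def by auto
qed

text \<open>Otherwise the part of \<open>X\<close> outside \<open>D\<close> would be an obstruction
  over \<open>D\<close>. So strong sets are closed under obstructions over their subsets.\<close>

lemma strong_obstruction_subset: "strong D V \<Longrightarrow> F \<subseteq> D \<Longrightarrow> obstruction F X \<Longrightarrow> X \<subseteq> V \<Longrightarrow> X \<subseteq> D"
  using obstruction_remove[of F X D] unfolding strong_def by (metis Diff_eq_empty_iff Diff_subset subset_trans)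

lemma strong_trans:
  assumes "strong D E" "strong E V"
  shows "strong D V"
  unfolding strong_def
proof (intro conjI allI impI notI)
  show "D \<subseteq> V" using assms unfolding strong_def by blast
  fix X assume "X \<subseteq> V" "obstruction D X"
  then show False
    using strong_obstruction_subset[OF assms(2), of D X] assms(1) unfolding strong_def by simp
qed

text \<open>Three witnesses for each of finitely many elements involve only finitely many members of
  \<open>D\<close>. Strongness is therefore a condition on finite bases, as hulls and types
  require.\<close>

lemma obstruction_finite_base:
  assumes "obstruction D X"
  obtains F where "finite F" "F \<subseteq> D" "obstruction F X"
proof -
  have "\<forall>x\<in>X. \<exists>K. finite K \<and> K \<subseteq> X \<union> D \<and> deg_ge3 K x"
  proof
    fix x assume "x \<in> X"
    then have "deg_ge3 (X \<union> D) x" using assms unfolding obstruction_def by auto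
    then obtain a b c where abc: "a \<in> X \<union> D" "b \<in> X \<union> D" "c \<in> X \<union> D" "a \<noteq> b" "a \<noteq> c" "b \<noteq> c"
      "adj x a" "adj x b" "adj x c" by (rule deg_ge3E)
    then have "deg_ge3 {a,b,c} x" by (intro deg_ge3I[of a _ b c]) auto
    then show "\<exists>K. finite K \<and> K \<subseteq> X \<union> D \<and> deg_ge3 K x"
      using abc by (intro exI[of _ "{a,b,c}"]) auto
  qed
  then obtain K where K: "\<forall>x\<in>X. finite (K x) \<and> K x \<subseteq> X \<union> D \<and> deg_ge3 (K x) x" by metis
  let ?F = "(\<Union>x\<in>X. K x) \<inter> D"
  have "deg_ge3 (X \<union> ?F) x" if "x \<in> X" for x
  proof (rule deg_ge3_mono)
    show "deg_ge3 (K x) x" using K that by blast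
    show "K x \<subseteq> X \<union> ?F" using bspec[OF K that] that by blast
  qed
  then have "obstruction ?F X" using assms unfolding obstruction_def by (simp, blast)
  moreover have "finite ?F" using K assms unfolding obstruction_def by auto
  ultimately show thesis using that by blast
qed

section \<open>Finiteness of obstructions of bounded size, and countable strong hulls\<close>

text \<open>Elements of the copies have degree three by themselves; an element of \<open>T\<close>
  gets one neighbour from each copy. It serves twice: for disjoint obstructions with a common
  attachment set, and for copies obtained by elementarity.\<close>

lemma three_copies:
  assumes "finite T" "obstruction T X" "obstruction T Y" "obstruction T Z"
    and "X \<inter> Y = {}" "X \<inter> Z = {}" "Y \<inter> Z = {}"
    and "\<And>t. t \<in> T \<Longrightarrow> \<exists>x\<in>X. adj t x" "\<And>t. t \<in> T \<Longrightarrow> \<exists>x\<in>Y. adj t x" "\<And>t. t \<in> T \<Longrightarrow> \<exists>x\<in>Z. adj t x"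
  shows "obstruction {} (T \<union> X \<union> Y \<union> Z)"
proof -
  have "deg_ge3 (T \<union> X \<union> Y \<union> Z) t" if "t \<in> T" for t
  proof -
    obtain x y z where "x \<in> X" "y \<in> Y" "z \<in> Z" "adj t x" "adj t y" "adj t z"
      using assms(8,9,10)[OF \<open>t \<in> T\<close>] by blast
    then show ?thesis using assms(5-7) by (intro deg_ge3I[of x _ y z]) auto
  qed
  moreover have "deg_ge3 (T \<union> X \<union> Y \<union> Z) x" if "x \<in> X \<union> Y \<union> Z" for x
  proof -
    obtain W where W: "obstruction T W" "x \<in> W" "W \<subseteq> X \<union> Y \<union> Z"
      using \<open>x \<in> X \<union> Y \<union> Z\<close> assms(2-4) by blast
    then have "deg_ge3 (W \<union> T) x" unfolding obstruction_def by blast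
    moreover have "W \<union> T \<subseteq> T \<union> X \<union> Y \<union> Z" using W by blast
    ultimately show ?thesis by (rule deg_ge3_mono)
  qed
  ultimately show ?thesis using assms(1-4) unfolding obstruction_def by auto
qed

text \<open>Base elements adjacent to nothing in \<open>X\<close> contribute to no degree. After
  discarding them every base element has a neighbour in \<open>X\<close>, which is what
  \<open>three_copies\<close> asks for.\<close>

lemma obstruction_attachment:
  assumes "obstruction F X"
  shows "obstruction {t\<in>F. \<exists>x\<in>X. adj t x} X"
proof -
  have "deg_ge3 (X \<union> {t\<in>F. \<exists>x\<in>X. adj t x}) x" if "x \<in> X" for x
  proof -
    have "deg_ge3 (X \<union> F) x" using assms that unfolding obstruction_def by blast
    then obtain a b c where "a \<in> X \<union> F" "b \<in> X \<union> F" "c \<in> X \<union> F" "a \<noteq> b" "a \<noteq> c" "b \<noteq> c"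
      "adj x a" "adj x b" "adj x c" by (rule deg_ge3E)
    moreover then have "adj a x" "adj b x" "adj c x" using adj_sym by blast+
    ultimately show ?thesis using that by (intro deg_ge3I[of a _ b c]) auto
  qed
  then show ?thesis using assms unfolding obstruction_def by auto
qed

text \<open>Obstructions are sorted by their attachment set \<open>T\<close>, a subset of the finite
  set \<open>F\<close>. If no finite set met all those with a given \<open>T\<close>, three pairwise
  disjoint ones could be chosen greedily and would contradict openness.\<close>

lemma obstruction_hitting_set:
  assumes "strong {} V" "finite F" "F \<subseteq> V"
  obtains H where "finite H" "\<And>X. X \<subseteq> V \<Longrightarrow> obstruction F X \<Longrightarrow> X \<inter> H \<noteq> {}"
proof -
  define att where "att X = {t\<in>F. \<exists>x\<in>X. adj t x}" for X
  have "\<exists>H. finite H \<and> (\<forall>X. X \<subseteq> V \<and> obstruction F X \<and> att X = T \<longrightarrow> X \<inter> H \<noteq> {})" if "T \<subseteq> F" for T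
  proof (rule ccontr)
    assume "\<not> ?thesis"
    then have av: "\<And>H. finite H \<Longrightarrow> \<exists>X. X \<subseteq> V \<and> obstruction F X \<and> att X = T \<and> X \<inter> H = {}" by blast
    obtain X where X: "X \<subseteq> V" "obstruction F X" "att X = T" using av[of "{}"] by auto
    obtain Y where Y: "Y \<subseteq> V" "obstruction F Y" "att Y = T" "Y \<inter> X = {}"
      using av[of X] X unfolding obstruction_def by auto
    obtain Z where Z: "Z \<subseteq> V" "obstruction F Z" "att Z = T" "Z \<inter> (X \<union> Y) = {}"
      using av[of "X \<union> Y"] X Y unfolding obstruction_def by auto
    have "obstruction {} (T \<union> X \<union> Y \<union> Z)"
    proof (rule three_copies)
      show "finite T" using \<open>T \<subseteq> F\<close> \<open>finite F\<close> finite_subset by blast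
      show "obstruction T X" "obstruction T Y" "obstruction T Z"
        using obstruction_attachment[OF X(2)] obstruction_attachment[OF Y(2)] obstruction_attachment[OF Z(2)] X(3) Y(3) Z(3)
        unfolding att_def by simp_all
    qed (use X Y Z in \<open>auto simp: att_def\<close>)
    moreover have "T \<union> X \<union> Y \<union> Z \<subseteq> V" using X Y Z \<open>T \<subseteq> F\<close> \<open>F \<subseteq> V\<close> by auto
    ultimately show False using assms(1) unfolding strong_def by blast
  qed
  then obtain h where h: "\<And>T. T \<subseteq> F \<Longrightarrow> finite (h T) \<and>
      (\<forall>X. X \<subseteq> V \<and> obstruction F X \<and> att X = T \<longrightarrow> X \<inter> h T \<noteq> {})" by metis
  have "finite (\<Union>T\<in>Pow F. h T)" using h \<open>finite F\<close> by auto
  moreover have "X \<inter> (\<Union>T\<in>Pow F. h T) \<noteq> {}" if "X \<subseteq> V" "obstruction F X" for X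
  proof -
    have "att X \<subseteq> F" unfolding att_def by auto
    then have "X \<inter> h (att X) \<noteq> {}" using h[of "att X"] that by simp
    then show ?thesis using \<open>att X \<subseteq> F\<close> by blast
  qed
  ultimately show thesis using that by blast
qed

text \<open>An obstruction contains one of finitely many elements \<open>h\<close> of a hitting set.
  Moving \<open>h\<close> into the base leaves nothing or a smaller obstruction, so the induction on
  the size has to generalise over the base.\<close>

lemma finite_obstruction:
  assumes "strong {} V" "finite F" "F \<subseteq> V"
  shows "finite {X. X \<subseteq> V \<and> obstruction F X \<and> card X \<le> k}"
  using assms(2,3)
proof (induction k arbitrary: F)
  case 0
  have "{X. X \<subseteq> V \<and> obstruction F X \<and> card X \<le> 0} = {}" unfolding obstruction_def by (auto simp: card_eq_0_iff)
  then show ?case using finite.emptyI by (metis (no_types, lifting))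
next
  case (Suc k)
  obtain H where H: "finite H" "\<And>X. X \<subseteq> V \<Longrightarrow> obstruction F X \<Longrightarrow> X \<inter> H \<noteq> {}"
    using obstruction_hitting_set[OF assms(1)] Suc.prems by metis
  \<comment> \<open>The extra \<open>{}\<close> accounts for \<open>X = {h}\<close>, because the
    empty set is not an obstruction.\<close>
  let ?R = "\<lambda>h. insert h ` insert {} {Y. Y \<subseteq> V \<and> obstruction (insert h F) Y \<and> card Y \<le> k}"
  have "{X. X \<subseteq> V \<and> obstruction F X \<and> card X \<le> Suc k} \<subseteq> (\<Union>h\<in>H \<inter> V. ?R h)"
  proof
    fix X assume "X \<in> {X. X \<subseteq> V \<and> obstruction F X \<and> card X \<le> Suc k}"
    then have X: "X \<subseteq> V" "obstruction F X" "card X \<le> Suc k" by auto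
    then obtain h where h: "h \<in> X" "h \<in> H" using H by blast
    let ?Y = "X - {h}"
    have "X - insert h F = X - {h}" using X unfolding obstruction_def by blast
    then have "?Y = {} \<or> obstruction (insert h F) ?Y" using obstruction_remove[OF X(2), of "insert h F"] by auto
    moreover have "card ?Y \<le> k" using X h unfolding obstruction_def by simp
    ultimately have "?Y \<in> insert {} {Y. Y \<subseteq> V \<and> obstruction (insert h F) Y \<and> card Y \<le> k}" using X by auto
    moreover have "X = insert h ?Y" using h by auto
    ultimately show "X \<in> (\<Union>h\<in>H \<inter> V. ?R h)" using h X by blast
  qed
  moreover have "finite (\<Union>h\<in>H \<inter> V. ?R h)" using H Suc by auto
  ultimately show ?case using finite_subset by blast
qed

text \<open>All obstructions over finite subsets are adjoined, infinitely often; each stage stays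
  countable by \<open>finite_obstruction\<close>. An obstruction over the union has its finite base
  in one stage and is absorbed by the next.\<close>

lemma countable_strong_hull:
  assumes "strong {} V" "countable D" "D \<subseteq> V"
  obtains D' where "D \<subseteq> D'" "countable D'" "strong D' V"
proof -
  define st where "st D = D \<union> (\<Union>F\<in>{F. finite F \<and> F \<subseteq> D}. \<Union>k. \<Union>{X. X \<subseteq> V \<and> obstruction F X \<and> card X \<le> k})"
    for D
  have st: "countable (st E) \<and> st E \<subseteq> V" if "countable E \<and> E \<subseteq> V" for E
  proof
    have "countable (\<Union>{X. X \<subseteq> V \<and> obstruction F X \<and> card X \<le> k})" if "finite F" "F \<subseteq> E" for F k
      using finite_obstruction[OF assms(1), of F k] that \<open>countable E \<and> E \<subseteq> V\<close>
      by (intro countable_finite finite_Union) (auto simp: obstruction_def)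
    then show "countable (st E)" unfolding st_def using that
      by (intro countable_Un countable_UN countable_Collect_finite_subset) auto
  qed (use that in \<open>auto simp: st_def\<close>)
  define K where "K n = (st ^^ n) D" for n
  have K: "countable (K n) \<and> K n \<subseteq> V" for n
    by (induction n) (use assms st in \<open>auto simp: K_def\<close>)
  have "mono K" unfolding K_def by (intro mono_iff_le_Suc[THEN iffD2]) (auto simp: st_def)
  have "strong (\<Union>n. K n) V"
    unfolding strong_def
  proof (intro conjI allI impI notI)
    show "(\<Union>n. K n) \<subseteq> V" using K by auto
    fix X assume X: "X \<subseteq> V" "obstruction (\<Union>n. K n) X"
    obtain F where F: "finite F" "F \<subseteq> (\<Union>n. K n)" "obstruction F X" using obstruction_finite_base[OF X(2)] .
    have "\<exists>n. F \<subseteq> K n" using F(1,2)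
    proof (induction F)
      case (insert x F)
      then obtain n m where "F \<subseteq> K n" "x \<in> K m" by auto
      then have "insert x F \<subseteq> K (max n m)"
        using monoD[OF \<open>mono K\<close>, of n "max n m"] monoD[OF \<open>mono K\<close>, of m "max n m"] by auto
      then show ?case by blast
    qed auto
    then obtain n where "F \<subseteq> K n" by blast
    then have "X \<subseteq> st (K n)" using F X unfolding st_def
      by (intro le_supI2 subsetI UN_I[of F] UN_I[of "card X"] UnionI[of X]) auto
    then have "X \<subseteq> K (Suc n)" unfolding K_def by simp
    then show False using X unfolding obstruction_def by blast
  qed
  moreover have "D \<subseteq> (\<Union>n. K n)" using UN_upper[of 0 UNIV K] by (simp add: K_def)
  moreover have "countable (\<Union>n. K n)" using K by auto
  ultimately show thesis using that by blast
qed

text \<open>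
  For a neighbour \<open>c\<close> of \<open>F\<close>, the element \<open>c\<close> is bad if adjoining it to \<open>F\<close> creates a new obstruction \<open>W - {c}\<close>.
\<close>

definition bad :: "'v set \<Rightarrow> 'v set \<Rightarrow> nat \<Rightarrow> 'v \<Rightarrow> bool" where
  "bad V F k c \<longleftrightarrow> (\<exists>W\<subseteq>V. finite W \<and> card W \<le> k \<and> W \<inter> F = {} \<and> c \<in> W \<and>
      (\<forall>y\<in>W - {c}. deg_ge3 (W \<union> F) y) \<and> deg_ge2 (W \<union> F) c)"

text \<open>The witness shrinks to \<open>W - F'\<close>; what leaves it is still counted as part of
  the base, and \<open>c\<close> itself stays.\<close>

lemma bad_mono:
  assumes "bad V F k c" "F \<subseteq> F'" "k \<le> k'" "c \<notin> F'"
  shows "bad V F' k' c"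
proof -
  obtain W where W: "W \<subseteq> V" "finite W" "card W \<le> k" "W \<inter> F = {}" "c \<in> W"
     "\<forall>y\<in>W - {c}. deg_ge3 (W \<union> F) y" "deg_ge2 (W \<union> F) c" using assms(1) unfolding bad_def by blast
  have "W \<union> F \<subseteq> W - F' \<union> F'" using assms by auto
  moreover have "card (W - F') \<le> k'" using W assms(3) by (meson Diff_subset card_mono le_trans)
  ultimately show ?thesis unfolding bad_def using W assms(2,4) deg_ge3_mono[OF _ \<open>W \<union> F \<subseteq> _\<close>]
      deg_ge2_mono[OF _ \<open>W \<union> F \<subseteq> _\<close>]
    by (intro exI[of _ "W - F'"] conjI) auto
qed

text \<open>
  The path \<open>x\<close> leaves \<open>W\<close> at some point \<open>x j\<close>, whose successor supplies a missing third neighbour;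
  the initial part of the path, which only has two neighbours each, is peeled off.
\<close>

lemma trim:
  assumes "finite W" "W \<inter> F = {}" "x 0 \<in> W" "\<forall>y\<in>W - {x 0}. deg_ge3 (W \<union> F) y" "deg_ge2 (W \<union> F) (x 0)"
    and "\<And>t. t \<le> card W \<Longrightarrow> x t \<notin> F \<and> e t \<in> F \<and> adj (x t) (e t) \<and> adj (x t) (x (Suc t))"
  shows "\<exists>j<card W. \<exists>W'\<subseteq>W. x j \<in> W' \<and> (\<forall>y\<in>W' - {x j}. deg_ge3 (W' \<union> F) y) \<and>
     deg_ge3 (insert (x (Suc j)) (W' \<union> F)) (x j)"
  using assms
proof (induction "card W" arbitrary: W x e)
  case 0
  then show ?case by auto
next
  case (Suc n)
  have x0: "x 0 \<notin> F" "e 0 \<in> F" "adj (x 0) (e 0)" "adj (x 0) (x 1)" "x 1 \<notin> F"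
    using Suc.prems(6)[of 0] Suc.prems(6)[of 1] Suc.hyps(2) by auto
  show ?case
  proof (cases "deg_ge3 (insert (x 1) (W \<union> F)) (x 0) \<and> (x 1 \<notin> W \<or> deg_ge3 (W \<union> F) (x 0))")
    case True
    have "0 < card W" using Suc.hyps(2) by simp
    moreover have "deg_ge3 (insert (x (Suc 0)) (W \<union> F)) (x 0)" using True by simp
    ultimately show ?thesis using Suc.prems(3,4) by blast
  next
    case False
    have "x 1 \<in> W"
    proof (rule ccontr)
      assume "x 1 \<notin> W"
      then have "deg_ge3 (insert (x 1) (W \<union> F)) (x 0)" using deg_ge2_insert[OF Suc.prems(5)] x0 by simp
      then show False using False \<open>x 1 \<notin> W\<close> by blast
    qed
    then have nd: "\<not> deg_ge3 (W \<union> F) (x 0)" using False deg_ge3_mono[of "W \<union> F" "x 0"] by blast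
    \<comment> \<open>As \<open>e 0\<close> lies in \<open>F\<close>, the only member of
      \<open>W\<close> adjacent to \<open>x 0\<close> is \<open>x 1\<close>. Deleting
      \<open>x 0\<close> thus lowers the degree of \<open>x 1\<close> alone, to at least two, and
      \<open>x 1\<close> becomes the root of the next round.\<close>
    have nbrs: "y \<in> {e 0, x 1}" if "y \<in> W \<union> F" "adj (x 0) y" for y
    proof (rule ccontr)
      assume "y \<notin> {e 0, x 1}"
      then have "deg_ge3 (W \<union> F) (x 0)" using that x0 \<open>x 1 \<in> W\<close>
        by (intro deg_ge3I[of y "W \<union> F" "e 0" "x 1" "x 0"]) auto
      then show False using nd by simp
    qed
    let ?W = "W - {x 0}"
    have "x 1 \<noteq> x 0" using x0 adj_irrefl by auto
    have card: "n = card ?W" using Suc by simp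
    have "\<exists>j<card ?W. \<exists>W'\<subseteq>?W. x (Suc j) \<in> W' \<and> (\<forall>y\<in>W' - {x (Suc j)}. deg_ge3 (W' \<union> F) y) \<and>
     deg_ge3 (insert (x (Suc (Suc j))) (W' \<union> F)) (x (Suc j))"
    proof (rule Suc.hyps(1)[OF card, of "\<lambda>t. x (Suc t)" "\<lambda>t. e (Suc t)"])
      show "\<forall>y\<in>?W - {x (Suc 0)}. deg_ge3 (?W \<union> F) y"
      proof
        fix y assume y: "y \<in> ?W - {x (Suc 0)}"
        then have "deg_ge3 (W \<union> F) y" using Suc.prems by auto
        moreover have "\<not> adj y (x 0)" using nbrs[of y] adj_sym y Suc.prems(2) x0 by auto
        ultimately show "deg_ge3 (?W \<union> F) y"
        proof (elim deg_ge3E)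
          fix a b c assume "a \<in> W \<union> F" "b \<in> W \<union> F" "c \<in> W \<union> F" "a \<noteq> b" "a \<noteq> c" "b \<noteq> c"
            "adj y a" "adj y b" "adj y c" "\<not> adj y (x 0)"
          then show ?thesis by (intro deg_ge3I[of a _ b c]) auto
        qed
      qed
      have "deg_ge3 (W \<union> F) (x 1)" using \<open>x 1 \<in> W\<close> \<open>x 1 \<noteq> x 0\<close> Suc.prems by auto
      then have "deg_ge2 (W \<union> F - {x 0}) (x 1)" by (rule deg_ge3_imp_deg_ge2_remove)
      then have "deg_ge2 (?W \<union> F) (x 1)" by (rule deg_ge2_mono) blast
      then show "deg_ge2 (?W \<union> F) (x (Suc 0))" by simp
    qed (use Suc.prems Suc.hyps card \<open>x 1 \<in> W\<close> \<open>x 1 \<noteq> x 0\<close> in auto)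
    then obtain j W' where "j < card ?W" "W' \<subseteq> ?W" "x (Suc j) \<in> W'"
      "\<forall>y\<in>W' - {x (Suc j)}. deg_ge3 (W' \<union> F) y" "deg_ge3 (insert (x (Suc (Suc j))) (W' \<union> F)) (x (Suc j))"
      by blast
    then show ?thesis using card Suc.hyps(2) by (intro exI[of _ "Suc j"] conjI exI[of _ W']) auto
  qed
qed

section \<open>Open projective planes and generic neighbours\<close>

text \<open>Both axioms of a projective plane at once: elements of equal sort are two points or two
  lines.\<close>

definition pplane :: "'v set \<Rightarrow> bool" where
  "pplane V \<longleftrightarrow> (\<forall>x\<in>V. \<forall>y\<in>V. x \<noteq> y \<and> s x = s y \<longrightarrow> (\<exists>!z. z \<in> V \<and> adj z x \<and> adj z y))"

text \<open>The graph form in which non-degeneracy is used; \<open>quadrangle_imp_thick\<close>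
  derives it from four points in general position.\<close>

definition thick :: "'v set \<Rightarrow> bool" where
  "thick V \<longleftrightarrow> V \<noteq> {} \<and> (\<forall>x\<in>V. deg_ge3 V x)"

definition open_pplane :: "'v set \<Rightarrow> bool" where
  "open_pplane V \<longleftrightarrow> pplane V \<and> thick V \<and> strong {} V"

definition nbrs :: "'v set \<Rightarrow> 'v \<Rightarrow> 'v set" where
  "nbrs V x = {y\<in>V. adj x y}"

text \<open>The line through two points or, dually, the intersection point of two lines.\<close>

definition join :: "'v set \<Rightarrow> 'v \<Rightarrow> 'v \<Rightarrow> 'v" where
  "join V x y = (THE z. z \<in> V \<and> adj z x \<and> adj z y)"

lemma join:
  assumes "pplane V" "x \<in> V" "y \<in> V" "x \<noteq> y" "s x = s y"
  shows "join V x y \<in> V" "adj (join V x y) x" "adj (join V x y) y"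
proof -
  have "\<exists>!z. z \<in> V \<and> adj z x \<and> adj z y" using assms unfolding pplane_def by blast
  from theI'[OF this] show "join V x y \<in> V" "adj (join V x y) x" "adj (join V x y) y"
    unfolding join_def by auto
qed

lemma adj_unique:
  assumes "pplane V" "x \<in> V" "y \<in> V" "x \<noteq> y" "z \<in> V" "adj z x" "adj z y" "w \<in> V" "adj w x" "adj w y"
  shows "z = w"
proof -
  have "s x = s y" using adj_sort[OF assms(6)] adj_sort[OF assms(7)] by auto
  then show ?thesis using assms unfolding pplane_def by blast
qed

lemma join_unique:
  assumes "pplane V" "x \<in> V" "y \<in> V" "x \<noteq> y" "z \<in> V" "adj z x" "adj z y"
  shows "z = join V x y"
proof -
  have "s x = s y" using adj_sort[OF assms(6)] adj_sort[OF assms(7)] by auto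
  then show ?thesis using join[OF assms(1-4)] adj_unique[OF assms] by blast
qed

lemma nbrs_iff: "y \<in> nbrs V x \<longleftrightarrow> y \<in> V \<and> adj x y"
  unfolding nbrs_def by simp

section \<open>Perspectivities and infinite pencils\<close>

text \<open>The perspectivity from \<open>p\<close> to \<open>l\<close>: a line \<open>m\<close>
  through the point \<open>p\<close> goes to its intersection with \<open>l\<close>, or dually. Two
  lines with the same image share this image and \<open>p\<close>, which differ because
  \<open>p\<close> is not on \<open>l\<close>.\<close>

lemma nbrs_injection:
  assumes "pplane V" "l \<in> V" "p \<in> V" "s l \<noteq> s p" "\<not> adj l p"
  shows "\<exists>f. inj_on f (nbrs V p) \<and> f ` nbrs V p \<subseteq> nbrs V l"
proof -
  let ?f = "\<lambda>m. join V m l"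
  have f: "m \<in> V \<and> ?f m \<in> V \<and> adj (?f m) m \<and> adj (?f m) l \<and> adj p m" if "m \<in> nbrs V p" for m
  proof -
    have "m \<in> V" "adj p m" using that by (auto simp: nbrs_iff)
    moreover have "s m = s l" using adj_sort[OF \<open>adj p m\<close>] assms(4) by auto
    moreover have "m \<noteq> l" using \<open>adj p m\<close> assms(5) adj_sym by blast
    ultimately show ?thesis using join[OF assms(1), of m l] assms(2) by auto
  qed
  have "inj_on ?f (nbrs V p)"
  proof (rule inj_onI)
    fix m m' assume m: "m \<in> nbrs V p" "m' \<in> nbrs V p" and eq: "?f m = ?f m'"
    have "?f m \<noteq> p" using f[OF m(1)] assms(5) adj_sym by metis
    moreover have "adj m (?f m)" "adj m' (?f m)" "adj m p" "adj m' p"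
      using f[OF m(1)] f[OF m(2)] eq adj_sym by metis+
    ultimately show "m = m'"
      using adj_unique[OF assms(1), of "?f m" p m m'] f[OF m(1)] f[OF m(2)] assms(3) by blast
  qed
  moreover have "?f ` nbrs V p \<subseteq> nbrs V l" using f adj_sym unfolding nbrs_def by blast
  ultimately show ?thesis by blast
qed

lemma finite_nbrs_transfer:
  assumes "pplane V" "l \<in> V" "p \<in> V" "s l \<noteq> s p" "\<not> adj l p" "finite (nbrs V l)"
  shows "finite (nbrs V p)"
  using nbrs_injection[OF assms(1-5)] assms(6) inj_on_finite by blast

text \<open>For two lines: take \<open>q\<close> on \<open>l\<close> and \<open>r\<close> on
  \<open>m\<close>, both off the intersection, and a third point on the line joining
  \<open>q\<close> and \<open>r\<close>. The dual case is the same argument.\<close>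

lemma obtain_non_adjacent:
  assumes "pplane V" "thick V" "l \<in> V" "m \<in> V" "s l = s m"
  obtains p where "p \<in> V" "s p \<noteq> s l" "\<not> adj p l" "\<not> adj p m"
proof -
  have th: "\<exists>z\<in>V. adj x z \<and> z \<noteq> a \<and> z \<noteq> b" if "x \<in> V" for x a b
  proof -
    have "deg_ge3 V x" using \<open>x \<in> V\<close> assms(2) unfolding thick_def by blast
    then show ?thesis by (elim deg_ge3E) metis
  qed
  have *: "\<exists>p\<in>V. s p \<noteq> s l \<and> \<not> adj p l \<and> \<not> adj p m"
    if "m \<noteq> l" "m \<in> V" "s l = s m" for m
  proof -
    note J = join[OF assms(1,3) \<open>m \<in> V\<close> \<open>m \<noteq> l\<close>[symmetric] \<open>s l = s m\<close>]
    obtain q where q: "q \<in> V" "adj l q" "q \<noteq> join V l m" using th[OF assms(3)] by blast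
    obtain r where r: "r \<in> V" "adj m r" "r \<noteq> join V l m" using th[OF \<open>m \<in> V\<close>] by blast
    have nq: "\<not> adj q m"
      using q join_unique[OF assms(1,3) \<open>m \<in> V\<close> \<open>m \<noteq> l\<close>[symmetric], of q] adj_sym by blast
    have nr: "\<not> adj r l"
      using r join_unique[OF assms(1,3) \<open>m \<in> V\<close> \<open>m \<noteq> l\<close>[symmetric], of r] adj_sym by blast
    have "q \<noteq> r" using nq r adj_sym by blast
    have sqr: "s q = s r" "s q \<noteq> s l" using adj_sort[OF q(2)] adj_sort[OF r(2)] \<open>s l = s m\<close> by auto
    note K = join[OF assms(1) q(1) r(1) \<open>q \<noteq> r\<close> sqr(1)]
    obtain p where p: "p \<in> V" "adj (join V q r) p" "p \<noteq> q" "p \<noteq> r" using th[OF K(1)] by blast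
    have "\<not> adj p l"
    proof
      assume "adj p l"
      then have "l = join V q r" using adj_unique[OF assms(1) p(1) q(1) p(3) assms(3) _ q(2) K(1) p(2) K(2)] adj_sym by blast
      then show False using nr K(3) adj_sym by metis
    qed
    moreover have "\<not> adj p m"
    proof
      assume "adj p m"
      then have "m = join V q r" using adj_unique[OF assms(1) p(1) r(1) p(4) \<open>m \<in> V\<close> _ r(2) K(1) p(2) K(3)] adj_sym by blast
      then show False using nq K(2) adj_sym by metis
    qed
    moreover have "s p \<noteq> s l" using adj_sort[OF p(2)] adj_sort[OF K(2)] sqr by auto
    ultimately show ?thesis using p by blast
  qed
  show thesis
  proof (cases "m = l")
    \<comment> \<open>Reduced to distinct elements: \<open>m'\<close> is a second neighbour of some
      \<open>q\<close> on \<open>l\<close>.\<close>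
    case True
    obtain q where q: "q \<in> V" "adj l q" using th[OF assms(3)] by blast
    obtain m' where m': "m' \<in> V" "adj q m'" "m' \<noteq> l" using th[OF q(1)] by blast
    have "s l = s m'" using adj_sort[OF q(2)] adj_sort[OF m'(2)] by auto
    then obtain p where "p \<in> V" "s p \<noteq> s l" "\<not> adj p l" using *[OF m'(3,1)] by blast
    then show thesis using that True by blast
  next
    case False
    then obtain p where "p \<in> V" "s p \<noteq> s l" "\<not> adj p l" "\<not> adj p m"
      using *[OF False assms(4,5)] by blast
    then show thesis using that by blast
  qed
qed

text \<open>One finite pencil makes all pencils finite by perspectivities, and then \<open>V\<close>
  itself is finite. A finite thick set is an obstruction over the empty set, against
  openness.\<close>

lemma infinite_nbrs:
  assumes "open_pplane V" "x \<in> V"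
  shows "infinite (nbrs V x)"
proof
  assume fx: "finite (nbrs V x)"
  have pp: "pplane V" and th: "thick V" using assms unfolding open_pplane_def by auto
  have same: "finite (nbrs V y)" if "y \<in> V" "s y = s x" for y
  proof -
    obtain p where p: "p \<in> V" "s p \<noteq> s x" "\<not> adj p x" "\<not> adj p y"
      using obtain_non_adjacent[OF pp th \<open>x \<in> V\<close> \<open>y \<in> V\<close> \<open>s y = s x\<close>[symmetric]] .
    have "finite (nbrs V p)"
      using finite_nbrs_transfer[OF pp \<open>x \<in> V\<close> p(1) _ _ fx] p adj_sym by metis
    then show ?thesis using finite_nbrs_transfer[OF pp p(1) \<open>y \<in> V\<close> _ p(4)] p(2) that(2) by simp
  qed
  have all: "finite (nbrs V y)" if "y \<in> V" for y
  proof (cases "s y = s x")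
    case False
    obtain p where p: "p \<in> V" "s p \<noteq> s y" "\<not> adj p y"
      using obtain_non_adjacent[OF pp th \<open>y \<in> V\<close> \<open>y \<in> V\<close> refl] by metis
    then have "s p = s x" using False by auto
    then show ?thesis using finite_nbrs_transfer[OF pp p(1) \<open>y \<in> V\<close> p(2,3)] same[OF p(1)] by simp
  qed (use that same in auto)
  have half: "finite {z\<in>V. s z = s y}" if "y \<in> V" for y
  proof -
    have "{z\<in>V. s z = s y} \<subseteq> insert y (\<Union>m\<in>nbrs V y. nbrs V m)"
    proof
      fix z assume z: "z \<in> {z\<in>V. s z = s y}"
      show "z \<in> insert y (\<Union>m\<in>nbrs V y. nbrs V m)"
      proof (cases "z = y")
        case False
        have "join V z y \<in> nbrs V y" "z \<in> nbrs V (join V z y)"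
          using join[OF pp _ \<open>y \<in> V\<close> False] z adj_sym unfolding nbrs_iff by auto
        then show ?thesis by blast
      qed auto
    qed
    moreover have "finite (insert y (\<Union>m\<in>nbrs V y. nbrs V m))" using all that by (auto simp: nbrs_iff)
    ultimately show ?thesis using finite_subset by blast
  qed
  obtain y where y: "y \<in> V" "adj x y"
    using assms(2) th unfolding thick_def deg_ge3_def by blast
  have "V = {z\<in>V. s z = s x} \<union> {z\<in>V. s z = s y}" using adj_sort[OF y(2)] by auto
  then have "finite V" using half[OF assms(2)] half[OF y(1)] by (metis finite_Un)
  then have "obstruction {} V" using th unfolding obstruction_def thick_def by simp
  then show False using assms(1) unfolding open_pplane_def strong_def by blast
qed

lemma obtain_nbrs:
  assumes "open_pplane V" "x \<in> V" "finite H"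
  obtains y where "y \<in> V" "adj x y" "y \<notin> H"
proof -
  have "infinite (nbrs V x - H)" using infinite_nbrs[OF assms(1,2)] assms(3) by simp
  then obtain y where "y \<in> nbrs V x - H" by (metis infinite_imp_nonempty ex_in_conv)
  then show thesis using that[of y] by (simp add: nbrs_iff)
qed

text \<open>Cyclically consecutive members of \<open>l, p, l', p'\<close> are non-incident, so
  perspectivities lead around the cycle and back to \<open>l\<close>. Members two apart are
  distinct, which prevents the resulting paths from turning back.\<close>

lemma obtain_quadrilateral:
  assumes "open_pplane V" "l \<in> V"
  obtains p l' p' where "p \<in> V" "l' \<in> V" "p' \<in> V" "s l' = s l" "s p \<noteq> s l" "s p' = s p" "l \<noteq> l'" "p \<noteq> p'"
    "\<not> adj l p" "\<not> adj p l'" "\<not> adj l' p'" "\<not> adj p' l"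
proof -
  have pp: "pplane V" and th: "thick V" using assms unfolding open_pplane_def by auto
  obtain p where p: "p \<in> V" "s p \<noteq> s l" "\<not> adj p l"
    using obtain_non_adjacent[OF pp th assms(2) assms(2) refl] by metis
  obtain p2 where p2: "p2 \<in> V" "adj l p2" using obtain_nbrs[OF assms, of "{}"] by auto
  have "p2 \<noteq> p" using p2 p adj_sym by blast
  have sp2: "s p2 = s p" using adj_sort[OF p2(2)] p by auto
  obtain l' where l': "l' \<in> V" "adj p2 l'" "l' \<notin> {l, join V p p2}"
    using obtain_nbrs[OF assms(1) p2(1), of "{l, join V p p2}"] by auto
  have "\<not> adj p l'"
    using join_unique[OF pp p(1) p2(1) \<open>p2 \<noteq> p\<close>[symmetric] l'(1)] l' adj_sym by blast
  have sl': "s l' = s l" using adj_sort[OF p2(2)] adj_sort[OF l'(2)] by auto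
  obtain p' where p': "p' \<in> V" "s p' \<noteq> s l" "\<not> adj p' l" "\<not> adj p' l'" "p' \<noteq> p"
  proof -
    obtain l3 where l3: "l3 \<in> V" "adj p2 l3" "l3 \<notin> {l, l'}"
      using obtain_nbrs[OF assms(1) p2(1), of "{l, l'}"] by auto
    obtain q where q: "q \<in> V" "adj l3 q" "q \<notin> {p, join V l l3, join V l' l3}"
      using obtain_nbrs[OF assms(1) l3(1), of "{p, join V l l3, join V l' l3}"] by auto
    have "\<not> adj q l" using join_unique[OF pp assms(2) l3(1) _ q(1)] q l3 adj_sym by blast
    moreover have "\<not> adj q l'" using join_unique[OF pp l'(1) l3(1) _ q(1)] q l3 adj_sym by blast
    moreover have "s q \<noteq> s l" using adj_sort[OF q(2)] adj_sort[OF l3(2)] adj_sort[OF p2(2)] by auto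
    ultimately show thesis using that q by blast
  qed
  show thesis
  proof (rule that[OF p(1) l'(1) p'(1)])
    show "s p' = s p" using p p' by auto
    show "p \<noteq> p'" "l \<noteq> l'" using p' l' by auto
    show "\<not> adj l p" "\<not> adj l' p'" using p p' adj_sym by blast+
  qed fact+
qed

section \<open>Paths between bad neighbours\<close>

text \<open>Each end of the path is trimmed by \<open>trim\<close>, losing fewer than
  \<open>k\<close> steps, and the remaining segment is added to the two trimmed witnesses. An
  interior vertex has as its three neighbours its predecessor, its successor and the base element
  \<open>e t\<close>. The bound counts at most \<open>k\<close> for each witness and
  \<open>n + 1\<close> for the segment.\<close>

lemma obstruction_between_bad_ends:
  assumes "bad V F k (x 0)" "bad V F k (x n)" "2 * k < n"
    and xe: "\<And>t. t \<le> n \<Longrightarrow> x t \<in> V \<and> x t \<notin> F \<and> e t \<in> F \<and> adj (x t) (e t)"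
    and xx: "\<And>t. t < n \<Longrightarrow> adj (x t) (x (Suc t))"
    and x2: "\<And>t. Suc (Suc t) \<le> n \<Longrightarrow> x t \<noteq> x (Suc (Suc t))"
  shows "\<exists>U\<subseteq>V. obstruction F U \<and> card U \<le> 2 * k + n + 1 \<and> (\<forall>t. k \<le> t \<and> t + k \<le> n \<longrightarrow> x t \<in> U)"
proof -
  have tr: "\<exists>j<k. \<exists>W'\<subseteq>V. finite W' \<and> card W' \<le> k \<and> W' \<inter> F = {} \<and> y j \<in> W' \<and>
      (\<forall>z\<in>W' - {y j}. deg_ge3 (W' \<union> F) z) \<and> deg_ge3 (insert (y (Suc j)) (W' \<union> F)) (y j)"
    if "bad V F k (y 0)" and y: "\<And>t. t \<le> k \<Longrightarrow> y t \<notin> F \<and> d t \<in> F \<and> adj (y t) (d t) \<and> adj (y t) (y (Suc t))"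
    for y d
  proof -
    obtain W where W: "W \<subseteq> V" "finite W" "card W \<le> k" "W \<inter> F = {}" "y 0 \<in> W"
      "\<forall>z\<in>W - {y 0}. deg_ge3 (W \<union> F) z" "deg_ge2 (W \<union> F) (y 0)"
      using \<open>bad V F k (y 0)\<close> unfolding bad_def by blast
    have "\<exists>j<card W. \<exists>W'\<subseteq>W. y j \<in> W' \<and> (\<forall>z\<in>W' - {y j}. deg_ge3 (W' \<union> F) z) \<and>
       deg_ge3 (insert (y (Suc j)) (W' \<union> F)) (y j)"
      using trim[where x = y and e = d, OF W(2,4-7)] y W(3) by simp
    then obtain j W' where j: "j < card W" "W' \<subseteq> W" "y j \<in> W'" "\<forall>z\<in>W' - {y j}. deg_ge3 (W' \<union> F) z"
      "deg_ge3 (insert (y (Suc j)) (W' \<union> F)) (y j)" by blast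
    moreover have "finite W'" "card W' \<le> card W" "W' \<subseteq> V" "W' \<inter> F = {}"
      using j(2) W finite_subset card_mono by blast+
    ultimately show ?thesis using W(3) by (intro exI[of _ j] conjI exI[of _ W']) auto
  qed
  \<comment> \<open>Prepares the second use of \<open>tr\<close>, for the reversed path. As
    \<open>2 * k < n\<close>, the truncated subtraction is genuine here, and the two trimmed parts
    do not overlap.\<close>
  have "adj (x (n - t)) (x (n - Suc t))" if "t \<le> k" for t
  proof -
    have "n - t = Suc (n - Suc t)" using assms(3) that by simp
    then show ?thesis using xx[of "n - Suc t"] adj_sym assms(3) by simp
  qed
  then obtain i B where B: "i < k" "B \<subseteq> V" "finite B" "card B \<le> k" "B \<inter> F = {}" "x (n - i) \<in> B"
      "\<forall>z\<in>B - {x (n - i)}. deg_ge3 (B \<union> F) z" "deg_ge3 (insert (x (n - Suc i)) (B \<union> F)) (x (n - i))"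
    using tr[of "\<lambda>t. x (n - t)" "\<lambda>t. e (n - t)"] assms(2) xe by auto
  obtain j A where A: "j < k" "A \<subseteq> V" "finite A" "card A \<le> k" "A \<inter> F = {}" "x j \<in> A"
      "\<forall>z\<in>A - {x j}. deg_ge3 (A \<union> F) z" "deg_ge3 (insert (x (Suc j)) (A \<union> F)) (x j)"
    using tr[of x e] assms(1,3) xe xx by auto
  let ?P = "x ` {j..n - i}"
  let ?U = "A \<union> B \<union> ?P"
  have "obstruction F ?U"
    unfolding obstruction_def
  proof (intro conjI ballI)
    show "finite ?U" "?U \<noteq> {}" using A B by auto
    show "?U \<inter> F = {}" using A(5) B(5) xe by fastforce
    fix z assume z: "z \<in> ?U"
    have "z \<in> ?P \<Longrightarrow> \<exists>t. z = x t \<and> j \<le> t \<and> t \<le> n - i" by auto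
    then consider "z = x j" | "z = x (n - i)" | "z \<in> A - {x j}" | "z \<in> B - {x (n - i)}"
      | t where "z = x t" "j < t" "t < n - i"
      using z by (metis DiffI UnE le_neq_implies_less singletonD)
    then show "deg_ge3 (?U \<union> F) z"
    proof cases
      case 1
      have "Suc j \<le> n - i" using A(1) B(1) assms(3) by linarith
      then have "x (Suc j) \<in> ?P" by (intro imageI) simp
      then have "insert (x (Suc j)) (A \<union> F) \<subseteq> ?U \<union> F" by blast
      then show ?thesis using deg_ge3_mono[OF A(8)] 1 by blast
    next
      case 2
      have "j \<le> n - Suc i" "n - Suc i \<le> n - i" using A(1) B(1) assms(3) by linarith+
      then have "x (n - Suc i) \<in> ?P" by (intro imageI) simp
      then have "insert (x (n - Suc i)) (B \<union> F) \<subseteq> ?U \<union> F" by blast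
      then show ?thesis using deg_ge3_mono[OF B(8)] 2 by blast
    next
      case 3
      then have "deg_ge3 (A \<union> F) z" using A by blast
      then show ?thesis by (rule deg_ge3_mono) auto
    next
      case 4
      then have "deg_ge3 (B \<union> F) z" using B by blast
      then show ?thesis by (rule deg_ge3_mono) auto
    next
      case (5 t)
      then obtain u where u: "t = Suc u" "j \<le> u" by (cases t) auto
      have le: "u \<le> n" "t \<le> n" "Suc t \<le> n" "u < n" "t < n" using u 5 by linarith+
      have "adj (x t) (x u)" using xx[OF le(4)] adj_sym u(1) by simp
      moreover have "adj (x t) (x (Suc t))" using xx[OF le(5)] .
      moreover have "x u \<noteq> x (Suc t)" using x2[of u] u(1) le(3) by simp
      moreover have "x u \<noteq> e t" "x (Suc t) \<noteq> e t" using xe[OF le(1)] xe[OF le(3)] xe[OF le(2)] by auto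
      moreover have "x u \<in> ?P" "x (Suc t) \<in> ?P" using u 5 by auto
      moreover have "e t \<in> F" "adj (x t) (e t)" using xe[OF le(2)] by auto
      ultimately show ?thesis using 5(1) by (intro deg_ge3I[of "x u" _ "x (Suc t)" "e t"]) auto
    qed
  qed
  moreover have "?U \<subseteq> V" using A B xe by auto
  moreover have "card ?U \<le> 2 * k + n + 1"
  proof -
    have "card ?P \<le> card {j..n-i}" by (rule card_image_le) simp
    then have "card ?P \<le> n + 1" by simp
    then show ?thesis using card_Un_le[of "A \<union> B" ?P] card_Un_le[of A B] A(4) B(4) by linarith
  qed
  moreover have "\<forall>t. k \<le> t \<and> t + k \<le> n \<longrightarrow> x t \<in> ?U" using A(1) B(1) by auto
  ultimately show ?thesis by blast
qed

text \<open>
  Each neighbour \<open>c\<close> of \<open>l\<close> starts a path \<open>x c\<close> that runs through the pencils of \<open>l, p, l', p'\<close> cyclically.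
  It returns to \<open>l\<close> after every four steps, hence both of its ends are bad if all neighbours of \<open>l\<close> are.
\<close>

lemma generic_neighbour:
  assumes "open_pplane V" "finite F" "F \<subseteq> V" "l \<in> F"
  shows "\<exists>c\<in>V. adj c l \<and> c \<notin> F \<and> \<not> bad V F k c"
proof (rule ccontr)
  assume "\<not> ?thesis"
  then have allbad: "\<And>c. c \<in> V \<Longrightarrow> adj c l \<Longrightarrow> c \<notin> F \<Longrightarrow> bad V F k c" by blast
  have pp: "pplane V" and op: "strong {} V" and lV: "l \<in> V" using assms unfolding open_pplane_def by auto
  obtain p l' p' where q: "p \<in> V" "l' \<in> V" "p' \<in> V" "s l' = s l" "s p \<noteq> s l" "s p' = s p" "l \<noteq> l'" "p \<noteq> p'"
    "\<not> adj l p" "\<not> adj p l'" "\<not> adj l' p'" "\<not> adj p' l"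
    using obtain_quadrilateral[OF assms(1) lV] .
  define e where "e t = [l, p, l', p'] ! (t mod 4)" for t :: nat
  have md: "t mod 4 = 0 \<or> t mod 4 = 1 \<or> t mod 4 = 2 \<or> t mod 4 = 3" for t :: nat by presburger
  have e1: "s (e t) \<noteq> s (e (Suc t)) \<and> \<not> adj (e t) (e (Suc t)) \<and> e t \<noteq> e (Suc (Suc t))" for t
    using md[of t] q unfolding e_def by (auto simp: mod_Suc)
  have e0: "e (4 * m) = l" for m unfolding e_def by simp
  \<comment> \<open>The base must contain the four pencils' carriers, so that every path vertex has
    a base neighbour \<open>e t\<close>.\<close>
  define F' where "F' = F \<union> {l, p, l', p'}"
  have eF: "e t \<in> F'" for t using md[of t] unfolding e_def F'_def by auto
  have F': "finite F'" "F' \<subseteq> V" "F \<subseteq> F'" using assms q lV unfolding F'_def by auto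
  \<comment> \<open>Avoiding \<open>H\<close> keeps a path outside \<open>F'\<close> and prevents
    \<open>x c t = x c (Suc (Suc t))\<close>, since such a vertex would be the join of
    \<open>e t\<close> and \<open>e (Suc (Suc t))\<close>.\<close>
  define H where "H = F' \<union> (\<lambda>(a, b). join V a b) ` (F' \<times> F')"
  have "finite H" using F' unfolding H_def by auto
  define x where "x c t = rec_nat c (\<lambda>t y. join V y (e (Suc t))) t" for c t
  have x0: "x c 0 = c" and xS: "x c (Suc t) = join V (x c t) (e (Suc t))" for c t
    unfolding x_def by auto
  have A: "x c n \<in> V \<and> adj (x c n) (e n)" if "c \<in> nbrs V l" "\<forall>t<n. x c t \<notin> H" for c n
    using that(2)
  proof (induction n)
    case 0
    then show ?case using that(1) adj_sym by (auto simp: x0 nbrs_iff e_def)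
  next
    case (Suc n)
    then have IH: "x c n \<in> V" "adj (x c n) (e n)" by auto
    have "x c n \<noteq> e (Suc n)" using Suc.prems eF unfolding H_def by (metis UnI1 lessI)
    moreover have "s (x c n) = s (e (Suc n))" using adj_sort[OF IH(2)] e1[of n] by auto
    ultimately show ?case using join[OF pp IH(1), of "e (Suc n)"] eF F' unfolding xS by blast
  qed
  have A': "adj (x c n) (x c (Suc n))" if "c \<in> nbrs V l" "\<forall>t\<le>n. x c t \<notin> H" for c n
  proof -
    have IH: "x c n \<in> V" "adj (x c n) (e n)" using A[OF that(1), of n] that(2) by auto
    have "x c n \<noteq> e (Suc n)" using that(2) eF unfolding H_def by (metis UnI1 le_refl)
    moreover have "s (x c n) = s (e (Suc n))" using adj_sort[OF IH(2)] e1[of n] by auto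
    ultimately show ?thesis using join[OF pp IH(1), of "e (Suc n)"] eF F' adj_sym unfolding xS by blast
  qed
  \<comment> \<open>A path can be traced backwards: \<open>x c n\<close> is the unique common
    neighbour of \<open>x c (Suc n)\<close> and \<open>e n\<close>.\<close>
  have B: "inj_on (\<lambda>c. x c n) {c\<in>nbrs V l. \<forall>t<n. x c t \<notin> H}" for n
  proof (induction n)
    case 0
    then show ?case by (auto simp: x0 inj_on_def)
  next
    case (Suc n)
    show ?case
    proof (rule inj_onI)
      fix c d assume c: "c \<in> {c\<in>nbrs V l. \<forall>t<Suc n. x c t \<notin> H}" and d: "d \<in> {c\<in>nbrs V l. \<forall>t<Suc n. x c t \<notin> H}"
        and eq: "x c (Suc n) = x d (Suc n)"
      let ?z = "x c (Suc n)"
      have z: "?z \<in> V" "adj ?z (e (Suc n))" using A[of c "Suc n"] c by auto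
      then have "?z \<noteq> e n" using e1[of n] by auto
      moreover have "x c n \<in> V" "adj (x c n) (e n)" "x d n \<in> V" "adj (x d n) (e n)"
        using A[of c n] A[of d n] c d by auto
      moreover have "adj (x c n) ?z" "adj (x d n) ?z" using A'[of c n] A'[of d n] c d eq by auto
      ultimately have "x c n = x d n" using adj_unique[OF pp z(1), of "e n" "x c n" "x d n"] eF F' by blast
      then show "c = d" using Suc.IH c d unfolding inj_on_def by auto
    qed
  qed
  \<comment> \<open>Sort the exceptional \<open>c\<close> by the first time their path meets
    \<open>H\<close>; for a fixed time, \<open>B\<close> embeds them into the finite set
    \<open>H\<close>.\<close>
  have C: "finite {c\<in>nbrs V l. \<not> (\<forall>t\<le>n. x c t \<notin> H)}" for n
  proof -
    let ?S = "\<lambda>t. {c\<in>nbrs V l. (\<forall>u<t. x c u \<notin> H) \<and> x c t \<in> H}"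
    have "finite (?S t)" for t
    proof (rule inj_on_finite)
      show "inj_on (\<lambda>c. x c t) (?S t)" by (rule inj_on_subset[OF B[of t]]) auto
    qed (use \<open>finite H\<close> in auto)
    moreover have "{c\<in>nbrs V l. \<not> (\<forall>t\<le>n. x c t \<notin> H)} \<subseteq> (\<Union>t\<le>n. ?S t)"
    proof
      fix c assume c: "c \<in> {c\<in>nbrs V l. \<not> (\<forall>t\<le>n. x c t \<notin> H)}"
      then obtain t where t: "t \<le> n" "x c t \<in> H" by auto
      obtain u where u: "x c u \<in> H" "\<forall>v<u. x c v \<notin> H"
        using exists_least_iff[of "\<lambda>t. x c t \<in> H"] t(2) by blast
      then have "u \<le> t" using t(2) not_le by blast
      have "u \<in> {..n}" using \<open>u \<le> t\<close> t(1) by simp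
      moreover have "c \<in> ?S u" using c u by blast
      ultimately show "c \<in> (\<Union>t\<le>n. ?S t)" by blast
    qed
    ultimately show ?thesis by (rule finite_subset[rotated, OF finite_UN_I[OF finite_atMost]])
  qed
  \<comment> \<open>The length \<open>n\<close> is a multiple of four, so that the path ends in the
    pencil of \<open>l\<close> again, and exceeds \<open>2 * k\<close>. Its midpoint
    \<open>m\<close> is at distance at least \<open>k\<close> from both ends, hence survives
    trimming. By \<open>B\<close>, distinct \<open>c\<close> have distinct midpoints.\<close>
  define m where "m = 2 * (k + 1)"
  define n where "n = 4 * (k + 1)"
  define G where "G = {c\<in>nbrs V l. \<forall>t\<le>n. x c t \<notin> H}"
  have "infinite G"
  proof
    assume "finite G"
    then have "finite (G \<union> {c\<in>nbrs V l. \<not> (\<forall>t\<le>n. x c t \<notin> H)})" using C[of n] by (rule finite_UnI)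
    moreover have "nbrs V l \<subseteq> G \<union> {c\<in>nbrs V l. \<not> (\<forall>t\<le>n. x c t \<notin> H)}" unfolding G_def by blast
    ultimately have "finite (nbrs V l)" by (rule finite_subset[rotated])
    then show False using infinite_nbrs[OF assms(1) lV] by simp
  qed
  have U: "\<exists>U\<subseteq>V. obstruction F' U \<and> card U \<le> 2 * k + n + 1 \<and> x c m \<in> U" if "c \<in> G" for c
  proof -
    have cG: "c \<in> nbrs V l" "\<forall>t\<le>n. x c t \<notin> H" using that unfolding G_def by auto
    have xe: "x c t \<in> V \<and> x c t \<notin> F' \<and> e t \<in> F' \<and> adj (x c t) (e t)" if "t \<le> n" for t
      using A[OF cG(1), of t] cG(2) that eF unfolding H_def by auto
    have "\<exists>U\<subseteq>V. obstruction F' U \<and> card U \<le> 2 * k + n + 1 \<and> (\<forall>t. k \<le> t \<and> t + k \<le> n \<longrightarrow> x c t \<in> U)"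
    proof (rule obstruction_between_bad_ends)
      have b: "bad V F' k (x c t)" if "t \<le> n" "e t = l" for t
      proof (rule bad_mono[OF allbad F'(3) le_refl])
        show "x c t \<in> V" "adj (x c t) l" "x c t \<notin> F'" using xe[OF that(1)] that(2) by simp_all
        then show "x c t \<notin> F" using F'(3) by blast
      qed
      show "bad V F' k (x c 0)" using b[of 0] e0[of 0] by simp
      show "bad V F' k (x c n)" using b[of n] e0[of "k + 1"] unfolding n_def by simp
      show "2 * k < n" unfolding n_def by simp
      show "adj (x c t) (x c (Suc t))" if "t < n" for t using A'[OF cG(1), of t] cG(2) that by simp
      show "x c t \<noteq> x c (Suc (Suc t))" if "Suc (Suc t) \<le> n" for t
      proof
        assume eq: "x c t = x c (Suc (Suc t))"
        have "x c t = join V (e t) (e (Suc (Suc t)))"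
        proof (rule join_unique[OF pp])
          show "e t \<in> V" "e (Suc (Suc t)) \<in> V" using eF F'(2) by blast+
          show "e t \<noteq> e (Suc (Suc t))" using e1[of t] by simp
          show "x c t \<in> V" "adj (x c t) (e t)" using xe[of t] that by simp_all
          show "adj (x c t) (e (Suc (Suc t)))" using xe[of "Suc (Suc t)"] that eq by simp
        qed
        then have "x c t \<in> (\<lambda>(a, b). join V a b) ` (F' \<times> F')"
          using eF[of t] eF[of "Suc (Suc t)"] by (intro image_eqI[of _ _ "(e t, e (Suc (Suc t)))"]) simp_all
        then have "x c t \<in> H" unfolding H_def by simp
        then show False using cG(2) that by simp
      qed
      show "x c t \<in> V \<and> x c t \<notin> F' \<and> e t \<in> F' \<and> adj (x c t) (e t)" if "t \<le> n" for t
        by (rule xe[OF that])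
    qed
    then obtain U where "U \<subseteq> V" "obstruction F' U" "card U \<le> 2 * k + n + 1" "\<forall>t. k \<le> t \<and> t + k \<le> n \<longrightarrow> x c t \<in> U"
      by blast
    moreover have "k \<le> m \<and> m + k \<le> n" unfolding m_def n_def by simp
    ultimately show ?thesis by blast
  qed
  have "inj_on (\<lambda>c. x c m) G"
    by (rule inj_on_subset[OF B[of m]]) (auto simp: G_def m_def n_def)
  then have "infinite ((\<lambda>c. x c m) ` G)" using \<open>infinite G\<close> finite_imageD by blast
  moreover have "(\<lambda>c. x c m) ` G \<subseteq> \<Union>{U. U \<subseteq> V \<and> obstruction F' U \<and> card U \<le> 2 * k + n + 1}"
    using U by blast
  moreover have "finite (\<Union>{U. U \<subseteq> V \<and> obstruction F' U \<and> card U \<le> 2 * k + n + 1})"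
    using finite_obstruction[OF op F'(1,2)] by (intro finite_Union) (auto simp: obstruction_def)
  ultimately show False using finite_subset by blast
qed

end

section \<open>Ultrafilters and ultrapowers\<close>

definition ultra :: "'a filter \<Rightarrow> bool" where
  "ultra U \<longleftrightarrow> U \<noteq> bot \<and> (\<forall>P. eventually P U \<or> eventually (\<lambda>x. \<not> P x) U)"

text \<open>Zorn's lemma in the reversed order, as finer filters are smaller. A minimal proper
  filter is ultra: if \<open>\<not> P\<close> does not hold eventually, intersecting with the
  principal filter of \<open>P\<close> keeps it proper and so changes nothing.\<close>

lemma ultra_exists:
  assumes "F \<noteq> bot"
  obtains U where "U \<le> F" "ultra U"
proof -
  let ?A = "{G. G \<le> F \<and> G \<noteq> bot}"
  have "\<exists>m\<in>?A. \<forall>a\<in>?A. a \<le> m \<longrightarrow> a = m"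
  proof (rule predicate_Zorn)
    show "partial_order_on ?A (relation_of (\<lambda>a b. b \<le> a) ?A)"
      unfolding partial_order_on_def preorder_on_def refl_on_def trans_def antisym_def relation_of_def
      by auto
    fix C assume C: "C \<in> Chains (relation_of (\<lambda>a b. b \<le> a) ?A)"
    have CA: "C \<subseteq> ?A" and Ch: "\<And>a b. a \<in> C \<Longrightarrow> b \<in> C \<Longrightarrow> a \<le> b \<or> b \<le> a"
      using C unfolding Chains_def relation_of_def by auto
    show "\<exists>u\<in>?A. \<forall>a\<in>C. u \<le> a"
    proof (cases "C = {}")
      case True
      then show ?thesis using assms by auto
    next
      case False
      \<comment> \<open>Finite meets in a chain are members of it, hence proper; properness of the
        full meet depends on finite meets only.\<close>
      have mem: "Inf X \<in> C" if "finite X" "X \<noteq> {}" "X \<subseteq> C" for X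
        using that
      proof (induction X rule: finite_ne_induct)
        case (insert x X)
        then have "Inf X \<in> C" "x \<in> C" by auto
        then have "inf x (Inf X) \<in> {x, Inf X}" using Ch[of x "Inf X"] by (auto simp: inf_absorb1 inf_absorb2)
        then show ?case using \<open>Inf X \<in> C\<close> \<open>x \<in> C\<close> by auto
      qed auto
      have "Inf C \<noteq> bot"
      proof (rule Inf_filter_not_bot)
        fix X assume "finite X" "X \<subseteq> C"
        show "Inf X \<noteq> bot"
        proof (cases "X = {}")
          case True
          have "top \<noteq> (bot :: 'a filter)" using assms by (metis bot_unique top_greatest)
          then show ?thesis using True by simp
        next
          case False
          then show ?thesis using mem[of X] CA \<open>X \<subseteq> C\<close> \<open>finite X\<close> by blast
        qed
      qed
      moreover have "Inf C \<le> F"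
      proof -
        obtain c where "c \<in> C" using False by blast
        then have "c \<le> F" using CA by blast
        then show ?thesis using Inf_lower[OF \<open>c \<in> C\<close>] by (rule order_trans[rotated])
      qed
      ultimately have "Inf C \<in> ?A" by simp
      then show ?thesis using Inf_lower by blast
    qed
  qed
  then obtain U where U: "U \<le> F" "U \<noteq> bot" and max: "\<And>G. G \<le> F \<Longrightarrow> G \<noteq> bot \<Longrightarrow> G \<le> U \<Longrightarrow> G = U"
    by blast
  have "eventually P U" if "\<not> eventually (\<lambda>x. \<not> P x) U" for P
  proof -
    have "inf U (principal {x. P x}) \<noteq> bot"
      using that unfolding trivial_limit_def eventually_inf_principal by simp
    moreover have "inf U (principal {x. P x}) \<le> F" using U(1) by (rule le_infI1)
    ultimately have "inf U (principal {x. P x}) = U" using max by simp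
    moreover have "eventually P (inf U (principal {x. P x}))" by (simp add: eventually_inf_principal)
    ultimately show ?thesis by simp
  qed
  then have "ultra U" using U unfolding ultra_def by blast
  then show thesis using that U by blast
qed

lemma ultra_not: "ultra U \<Longrightarrow> eventually (\<lambda>x. \<not> P x) U \<longleftrightarrow> \<not> eventually P U"
proof -
  assume U: "ultra U"
  have "\<not> (eventually P U \<and> eventually (\<lambda>x. \<not> P x) U)"
  proof
    assume "eventually P U \<and> eventually (\<lambda>x. \<not> P x) U"
    then have "eventually (\<lambda>x. P x \<and> \<not> P x) U" by (simp only: eventually_conj_iff)
    then show False using U unfolding ultra_def trivial_limit_def by simp
  qed
  then show ?thesis using U unfolding ultra_def by blast
qed

lemma ultra_disj: "ultra U \<Longrightarrow> eventually (\<lambda>x. P x \<or> Q x) U \<longleftrightarrow> eventually P U \<or> eventually Q U"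
  using ultra_not[of U "\<lambda>x. \<not> P x \<and> \<not> Q x"] ultra_not[of U P] ultra_not[of U Q]
  by (simp add: eventually_conj_iff)

lemma ultra_const: "ultra U \<Longrightarrow> eventually (\<lambda>x. P) U \<longleftrightarrow> P"
  unfolding ultra_def by (cases P) (simp_all add: eventually_False)

lemma ultra_imp:
  assumes "ultra U"
  shows "eventually (\<lambda>x. P x \<longrightarrow> Q x) U \<longleftrightarrow> (eventually P U \<longrightarrow> eventually Q U)"
  unfolding imp_conv_disj ultra_disj[OF assms] ultra_not[OF assms] ..

lemma ultra_iff:
  assumes "ultra U"
  shows "eventually (\<lambda>x. P x \<longleftrightarrow> Q x) U \<longleftrightarrow> (eventually P U \<longleftrightarrow> eventually Q U)"
  unfolding iff_conv_conj_imp eventually_conj_iff ultra_imp[OF assms] by blast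

lemma ultra_bex_finite:
  assumes "ultra U" "finite S"
  shows "eventually (\<lambda>x. \<exists>a\<in>S. P a x) U \<longleftrightarrow> (\<exists>a\<in>S. eventually (P a) U)"
  using assms(2) by (induction S) (use assms(1) in \<open>auto simp: ultra_disj ultra_const\<close>)

lemma eventually_choice: "eventually (\<lambda>i. \<exists>v. P i v) U \<longleftrightarrow> (\<exists>f. eventually (\<lambda>i. P i (f i)) U)"
proof
  assume "eventually (\<lambda>i. \<exists>v. P i v) U"
  then have "eventually (\<lambda>i. P i (SOME v. P i v)) U" by eventually_elim (rule someI_ex)
  then show "\<exists>f. eventually (\<lambda>i. P i (f i)) U" by (intro exI)
next
  assume "\<exists>f. eventually (\<lambda>i. P i (f i)) U"
  then obtain f where "eventually (\<lambda>i. P i (f i)) U" by blast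
  then show "eventually (\<lambda>i. \<exists>v. P i v) U" by eventually_elim blast
qed

section \<open>Countable saturation\<close>

text \<open>A diagonal choice: coordinate \<open>i\<close> follows the solution of the first
  conditions up to the largest \<open>n\<close> for which this solution works at \<open>i\<close>.
  The \<open>\<phi> n\<close> are arbitrary conditions on coordinates, so they may mention badness
  or obstructions; the index \<open>d\<close> allows many unknowns at once.\<close>

lemma countable_saturation:
  fixes \<phi> :: "nat \<Rightarrow> nat \<Rightarrow> ('d \<Rightarrow> 'v) \<Rightarrow> bool"
  assumes "U \<le> sequentially"
    and "\<And>n. \<exists>g. \<forall>m\<le>n. eventually (\<lambda>i. \<phi> m i (\<lambda>d. g d i)) U"
  shows "\<exists>g. \<forall>n. eventually (\<lambda>i. \<phi> n i (\<lambda>d. g d i)) U"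
proof -
  obtain h :: "nat \<Rightarrow> 'd \<Rightarrow> nat \<Rightarrow> 'v" where h: "\<And>n m. m \<le> n \<Longrightarrow> eventually (\<lambda>i. \<phi> m i (\<lambda>d. h n d i)) U"
    using assms(2) by metis
  \<comment> \<open>The clause \<open>n \<le> i\<close> makes the maximum below exist whenever some
    \<open>n\<close> qualifies; it holds for almost all \<open>i\<close> because \<open>U\<close>
    refines \<open>sequentially\<close>.\<close>
  define S where "S n i \<longleftrightarrow> n \<le> i \<and> (\<forall>m\<le>n. \<phi> m i (\<lambda>d. h n d i))" for n i
  have "eventually (S n) U" for n
  proof -
    have "eventually (\<lambda>i. \<forall>m\<in>{..n}. \<phi> m i (\<lambda>d. h n d i)) U"
      using h by (intro eventually_ball_finite) auto
    moreover have "eventually (\<lambda>i. n \<le> i) U"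
      using assms(1) eventually_ge_at_top filter_leD by blast
    ultimately show ?thesis unfolding S_def by eventually_elim auto
  qed
  define k where "k i = Max {n. n \<le> i \<and> S n i}" for i
  let ?g = "\<lambda>d i. h (k i) d i"
  have "eventually (\<lambda>i. \<phi> n i (\<lambda>d. ?g d i)) U" for n
    using \<open>eventually (S n) U\<close>
  proof eventually_elim
    case (elim i)
    let ?K = "{n. n \<le> i \<and> S n i}"
    have "n \<in> ?K" using elim unfolding S_def by auto
    moreover have "finite ?K" by simp
    ultimately have "k i \<in> ?K" "n \<le> k i" unfolding k_def using Max_in[of ?K] Max_ge[of ?K n] by fastforce+
    then show ?case unfolding S_def by simp
  qed
  then show ?thesis by (intro exI[of _ ?g]) auto
qed

context bipartite_graph begin

text \<open>
  Satisfaction with points and lines merged into one domain: \<open>Inl i\<close> is the point variable \<open>i\<close>,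
  \<open>Inr j\<close> the line variable \<open>j\<close>, and \<open>s\<close> holds of the points.
\<close>

primrec gsat :: "'v set \<Rightarrow> (nat + nat \<Rightarrow> 'v) \<Rightarrow> form \<Rightarrow> bool" where
  "gsat V \<rho> (EqPoint i j) \<longleftrightarrow> \<rho> (Inl i) = \<rho> (Inl j)"
| "gsat V \<rho> (EqLine i j) \<longleftrightarrow> \<rho> (Inr i) = \<rho> (Inr j)"
| "gsat V \<rho> (Inc i j) \<longleftrightarrow> adj (\<rho> (Inl i)) (\<rho> (Inr j))"
| "gsat V \<rho> (Neg \<phi>) \<longleftrightarrow> \<not> gsat V \<rho> \<phi>"
| "gsat V \<rho> (Conj \<phi> \<psi>) \<longleftrightarrow> gsat V \<rho> \<phi> \<and> gsat V \<rho> \<psi>"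
| "gsat V \<rho> (ExPoint i \<phi>) \<longleftrightarrow> (\<exists>v\<in>V. s v \<and> gsat V (\<rho>(Inl i := v)) \<phi>)"
| "gsat V \<rho> (ExLine j \<phi>) \<longleftrightarrow> (\<exists>v\<in>V. \<not> s v \<and> gsat V (\<rho>(Inr j := v)) \<phi>)"

end

locale ultrapower = bipartite_graph adj s for adj :: "'v \<Rightarrow> 'v \<Rightarrow> bool" and s +
  fixes U :: "nat filter"
  assumes ultra: "ultra U" and U_le: "U \<le> sequentially"
begin

text \<open>
  Instead of equivalence classes, the ultrapower consists of chosen representatives.
\<close>

definition rep :: "(nat \<Rightarrow> 'v) \<Rightarrow> nat \<Rightarrow> 'v" where
  "rep x = (SOME y. eventually (\<lambda>i. y i = x i) U)"

definition uadj :: "(nat \<Rightarrow> 'v) \<Rightarrow> (nat \<Rightarrow> 'v) \<Rightarrow> bool" where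
  "uadj x y \<longleftrightarrow> eventually (\<lambda>i. adj (x i) (y i)) U"

definition us :: "(nat \<Rightarrow> 'v) \<Rightarrow> bool" where
  "us x \<longleftrightarrow> eventually (\<lambda>i. s (x i)) U"

definition pow :: "'v set \<Rightarrow> (nat \<Rightarrow> 'v) set" where
  "pow V = {y. rep y = y \<and> eventually (\<lambda>i. y i \<in> V) U}"

lemmas ev_simps = ultra_not[OF ultra] ultra_disj[OF ultra] ultra_imp[OF ultra] ultra_iff[OF ultra]
  ultra_const[OF ultra] eventually_conj_iff ultra_bex_finite[OF ultra] eventually_ball_finite_distrib

lemma rep_eq: "eventually (\<lambda>i. rep x i = x i) U"
  unfolding rep_def by (rule someI[of _ x]) simp

lemma rep_cong:
  assumes "eventually (\<lambda>i. x i = y i) U"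
  shows "rep x = rep y"
proof -
  have "eventually (\<lambda>i. z i = x i) U \<longleftrightarrow> eventually (\<lambda>i. z i = y i) U" for z
  proof
    assume "eventually (\<lambda>i. z i = x i) U"
    with assms show "eventually (\<lambda>i. z i = y i) U" by eventually_elim simp
  next
    assume "eventually (\<lambda>i. z i = y i) U"
    with assms show "eventually (\<lambda>i. z i = x i) U" by eventually_elim simp
  qed
  then show ?thesis unfolding rep_def by simp
qed

lemma rep_eq_iff: "rep x = rep y \<longleftrightarrow> eventually (\<lambda>i. x i = y i) U"
proof
  assume "rep x = rep y"
  then have "eventually (\<lambda>i. rep x i = y i) U" using rep_eq[of y] by simp
  with rep_eq[of x] show "eventually (\<lambda>i. x i = y i) U" by eventually_elim simp
qed (rule rep_cong)

lemma rep_rep [simp]: "rep (rep x) = rep x"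
  by (rule rep_cong[OF rep_eq])

lemma ev_rep: "eventually (\<lambda>i. P i (rep x i)) U \<longleftrightarrow> eventually (\<lambda>i. P i (x i)) U"
proof
  assume "eventually (\<lambda>i. P i (rep x i)) U"
  with rep_eq[of x] show "eventually (\<lambda>i. P i (x i)) U" by eventually_elim simp
next
  assume "eventually (\<lambda>i. P i (x i)) U"
  with rep_eq[of x] show "eventually (\<lambda>i. P i (rep x i)) U" by eventually_elim simp
qed

lemma us_rep [simp]: "us (rep x) = us x"
  unfolding us_def by (rule ev_rep)

lemma uadj_rep [simp]: "uadj (rep x) y = uadj x y" "uadj x (rep y) = uadj x y"
  unfolding uadj_def using ev_rep[of "\<lambda>i v. adj v (y i)"] ev_rep[of "\<lambda>i v. adj (x i) v"] by auto

lemma rep_in_pow: "rep x \<in> pow V \<longleftrightarrow> eventually (\<lambda>i. x i \<in> V) U"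
  unfolding pow_def using ev_rep[of "\<lambda>i v. v \<in> V"] by simp

lemma pow_rep: "x \<in> pow V \<Longrightarrow> rep x = x"
  unfolding pow_def by simp

lemma pow_mem: "x \<in> pow V \<Longrightarrow> eventually (\<lambda>i. x i \<in> V) U"
  unfolding pow_def by simp

lemma pow_eq_iff: "x \<in> pow V \<Longrightarrow> y \<in> pow W \<Longrightarrow> x = y \<longleftrightarrow> eventually (\<lambda>i. x i = y i) U"
  using rep_eq_iff[of x y] pow_rep by metis

lemma pow_mono: "V \<subseteq> W \<Longrightarrow> pow V \<subseteq> pow W"
  unfolding pow_def by (auto elim: eventually_mono)

sublocale up: bipartite_graph uadj us
proof
  show "uadj x y \<Longrightarrow> uadj y x" for x y
    unfolding uadj_def by (auto elim!: eventually_mono intro: adj_sym)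
  fix x y assume "uadj x y"
  then have "eventually (\<lambda>i. \<not> (s (x i) \<longleftrightarrow> s (y i))) U"
    unfolding uadj_def by (auto elim!: eventually_mono dest: adj_sort)
  then show "us x \<noteq> us y" unfolding us_def ev_simps by simp
qed

text \<open>Connectives commute with an ultrafilter; at quantifiers,
  \<open>eventually_choice\<close> assembles the witnesses of the coordinates into one
  sequence.\<close>

lemma Los: "up.gsat (pow V) (\<lambda>n. rep (\<rho> n)) \<phi> \<longleftrightarrow> eventually (\<lambda>i. gsat V (\<lambda>n. \<rho> n i) \<phi>) U"
proof (induction \<phi> arbitrary: \<rho>)
  case (ExPoint j \<phi>)
  have upd: "(\<lambda>n. rep (\<rho> n))(Inl j := rep y) = (\<lambda>n. rep ((\<rho>(Inl j := y)) n))" for y by auto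
  have "up.gsat (pow V) (\<lambda>n. rep (\<rho> n)) (ExPoint j \<phi>) \<longleftrightarrow>
      (\<exists>y. rep y \<in> pow V \<and> us (rep y) \<and> up.gsat (pow V) ((\<lambda>n. rep (\<rho> n))(Inl j := rep y)) \<phi>)"
    unfolding up.gsat.simps using pow_rep by (metis (no_types, lifting))
  also have "\<dots> \<longleftrightarrow> (\<exists>y. eventually (\<lambda>i. y i \<in> V \<and> s (y i) \<and> gsat V (\<lambda>n. (\<rho>(Inl j := y)) n i) \<phi>) U)"
    unfolding upd ExPoint.IH rep_in_pow us_rep unfolding us_def ev_simps ..
  also have "\<dots> \<longleftrightarrow> (\<exists>y. eventually (\<lambda>i. y i \<in> V \<and> s (y i) \<and> gsat V ((\<lambda>n. \<rho> n i)(Inl j := y i)) \<phi>) U)"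
  proof -
    have "(\<lambda>n. (\<rho>(Inl j := y)) n i) = (\<lambda>n. \<rho> n i)(Inl j := y i)" for y i by auto
    then show ?thesis by simp
  qed
  also have "\<dots> \<longleftrightarrow> eventually (\<lambda>i. gsat V (\<lambda>n. \<rho> n i) (ExPoint j \<phi>)) U"
    unfolding gsat.simps Bex_def eventually_choice ..
  finally show ?case .
next
  case (ExLine j \<phi>)
  have upd: "(\<lambda>n. rep (\<rho> n))(Inr j := rep y) = (\<lambda>n. rep ((\<rho>(Inr j := y)) n))" for y by auto
  have "up.gsat (pow V) (\<lambda>n. rep (\<rho> n)) (ExLine j \<phi>) \<longleftrightarrow>
      (\<exists>y. rep y \<in> pow V \<and> \<not> us (rep y) \<and> up.gsat (pow V) ((\<lambda>n. rep (\<rho> n))(Inr j := rep y)) \<phi>)"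
    unfolding up.gsat.simps using pow_rep by (metis (no_types, lifting))
  also have "\<dots> \<longleftrightarrow> (\<exists>y. eventually (\<lambda>i. y i \<in> V \<and> \<not> s (y i) \<and> gsat V (\<lambda>n. (\<rho>(Inr j := y)) n i) \<phi>) U)"
    unfolding upd ExLine.IH rep_in_pow us_rep unfolding us_def ev_simps ..
  also have "\<dots> \<longleftrightarrow> (\<exists>y. eventually (\<lambda>i. y i \<in> V \<and> \<not> s (y i) \<and> gsat V ((\<lambda>n. \<rho> n i)(Inr j := y i)) \<phi>) U)"
  proof -
    have "(\<lambda>n. (\<rho>(Inr j := y)) n i) = (\<lambda>n. \<rho> n i)(Inr j := y i)" for y i by auto
    then show ?thesis by simp
  qed
  also have "\<dots> \<longleftrightarrow> eventually (\<lambda>i. gsat V (\<lambda>n. \<rho> n i) (ExLine j \<phi>)) U"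
    unfolding gsat.simps Bex_def eventually_choice ..
  finally show ?case .
qed (simp_all add: rep_eq_iff ev_simps uadj_def[symmetric] del: ultra_imp)

section \<open>Transfer of planes and obstructions to the ultrapower\<close>

lemma pow_pplane:
  assumes "pplane V"
  shows "up.pplane (pow V)"
  unfolding up.pplane_def
proof (intro ballI impI)
  fix x y assume xy: "x \<in> pow V" "y \<in> pow V" "x \<noteq> y \<and> us x = us y"
  have "eventually (\<lambda>i. x i \<in> V \<and> y i \<in> V \<and> \<not> x i = y i \<and> (s (x i) \<longleftrightarrow> s (y i))) U"
    unfolding ev_simps using xy pow_mem pow_eq_iff[OF xy(1,2)] by (simp add: us_def)
  then have "eventually (\<lambda>i. \<exists>v. v \<in> V \<and> adj v (x i) \<and> adj v (y i)) U"
    by eventually_elim (use assms in \<open>unfold pplane_def, blast\<close>)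
  then obtain z where "eventually (\<lambda>i. z i \<in> V \<and> adj (z i) (x i) \<and> adj (z i) (y i)) U"
    unfolding eventually_choice by blast
  then have z: "rep z \<in> pow V" "uadj (rep z) x" "uadj (rep z) y"
    unfolding rep_in_pow uadj_rep unfolding uadj_def ev_simps by auto
  moreover have "w = rep z" if w: "w \<in> pow V" "uadj w x" "uadj w y" for w
  proof -
    have "eventually (\<lambda>i. x i \<in> V \<and> y i \<in> V \<and> \<not> x i = y i \<and> w i \<in> V \<and> adj (w i) (x i) \<and> adj (w i) (y i)
        \<and> rep z i \<in> V \<and> adj (rep z i) (x i) \<and> adj (rep z i) (y i)) U"
      unfolding ev_simps using xy pow_mem pow_eq_iff[OF xy(1,2)] w z by (simp add: uadj_def)
    then have "eventually (\<lambda>i. w i = rep z i) U"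
      by eventually_elim (use adj_unique[OF assms] in blast)
    then show ?thesis using pow_eq_iff[OF w(1) z(1)] by simp
  qed
  ultimately show "\<exists>!z. z \<in> pow V \<and> uadj z x \<and> uadj z y" by blast
qed

lemma pow_thick:
  assumes "thick V"
  shows "up.thick (pow V)"
  unfolding up.thick_def
proof (intro conjI ballI)
  obtain v where "v \<in> V" using assms unfolding thick_def by blast
  then have "rep (\<lambda>i. v) \<in> pow V" unfolding rep_in_pow by simp
  then show "pow V \<noteq> {}" by blast
  fix x assume x: "x \<in> pow V"
  have "eventually (\<lambda>i. deg_ge3 V (x i)) U"
    using pow_mem[OF x] by eventually_elim (use assms in \<open>auto simp: thick_def\<close>)
  \<comment> \<open>The three neighbours are packed into one triple, so that a single choice per
    coordinate suffices.\<close>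
  then have "eventually (\<lambda>i. \<exists>t. (fst t \<in> V \<and> fst (snd t) \<in> V \<and> snd (snd t) \<in> V) \<and>
      \<not> fst t = fst (snd t) \<and> \<not> fst t = snd (snd t) \<and> \<not> fst (snd t) = snd (snd t) \<and>
      adj (x i) (fst t) \<and> adj (x i) (fst (snd t)) \<and> adj (x i) (snd (snd t))) U"
  proof eventually_elim
    case (elim i)
    then obtain a b c where "a \<in> V" "b \<in> V" "c \<in> V" "a \<noteq> b" "a \<noteq> c" "b \<noteq> c"
      "adj (x i) a" "adj (x i) b" "adj (x i) c" by (rule deg_ge3E)
    then show ?case by (intro exI[of _ "(a, b, c)"]) simp
  qed
  then obtain t where "eventually (\<lambda>i. (fst (t i) \<in> V \<and> fst (snd (t i)) \<in> V \<and> snd (snd (t i)) \<in> V) \<and>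
      \<not> fst (t i) = fst (snd (t i)) \<and> \<not> fst (t i) = snd (snd (t i)) \<and> \<not> fst (snd (t i)) = snd (snd (t i)) \<and>
      adj (x i) (fst (t i)) \<and> adj (x i) (fst (snd (t i))) \<and> adj (x i) (snd (snd (t i)))) U"
    unfolding eventually_choice by blast
  then have t: "eventually (\<lambda>i. fst (t i) \<in> V) U" "eventually (\<lambda>i. fst (snd (t i)) \<in> V) U"
    "eventually (\<lambda>i. snd (snd (t i)) \<in> V) U" "\<not> eventually (\<lambda>i. fst (t i) = fst (snd (t i))) U"
    "\<not> eventually (\<lambda>i. fst (t i) = snd (snd (t i))) U" "\<not> eventually (\<lambda>i. fst (snd (t i)) = snd (snd (t i))) U"
    "uadj x (\<lambda>i. fst (t i))" "uadj x (\<lambda>i. fst (snd (t i)))" "uadj x (\<lambda>i. snd (snd (t i)))"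
    unfolding ev_simps uadj_def by blast+
  then show "up.deg_ge3 (pow V) x"
    by (intro up.deg_ge3I[of "rep (\<lambda>i. fst (t i))" _ "rep (\<lambda>i. fst (snd (t i)))" "rep (\<lambda>i. snd (snd (t i)))"])
      (simp_all add: rep_in_pow rep_eq_iff)
qed

text \<open>Quantifiers over the finite set \<open>I\<close> are finite disjunctions and commute
  with the ultrafilter. Indexed families are used because different sequences can agree in some
  coordinates, so only the index set is common to all of them.\<close>

lemma deg_ge3_transfer:
  assumes "finite I"
  shows "up.deg_ge3 ((\<lambda>p. rep (v p)) ` I) (rep x) \<longleftrightarrow> eventually (\<lambda>i. deg_ge3 ((\<lambda>p. v p i) ` I) (x i)) U"
proof -
  have "eventually (\<lambda>i. deg_ge3 ((\<lambda>p. v p i) ` I) (x i)) U \<longleftrightarrow> eventually (\<lambda>i. \<exists>a\<in>I. \<exists>b\<in>I. \<exists>c\<in>I.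
      \<not> v a i = v b i \<and> \<not> v a i = v c i \<and> \<not> v b i = v c i \<and>
      adj (x i) (v a i) \<and> adj (x i) (v b i) \<and> adj (x i) (v c i)) U"
    unfolding deg_ge3_def bex_simps(7) ..
  also have "\<dots> \<longleftrightarrow> up.deg_ge3 ((\<lambda>p. rep (v p)) ` I) (rep x)"
    unfolding ev_simps(1-6) ultra_bex_finite[OF ultra assms] up.deg_ge3_def bex_simps(7) uadj_rep rep_eq_iff
    unfolding uadj_def ..
  finally show ?thesis ..
qed

lemma deg_ge2_transfer:
  assumes "finite I"
  shows "up.deg_ge2 ((\<lambda>p. rep (v p)) ` I) (rep x) \<longleftrightarrow> eventually (\<lambda>i. deg_ge2 ((\<lambda>p. v p i) ` I) (x i)) U"
proof -
  have "eventually (\<lambda>i. deg_ge2 ((\<lambda>p. v p i) ` I) (x i)) U \<longleftrightarrow> eventually (\<lambda>i. \<exists>a\<in>I. \<exists>b\<in>I.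
      \<not> v a i = v b i \<and> adj (x i) (v a i) \<and> adj (x i) (v b i)) U"
    unfolding deg_ge2_def bex_simps(7) ..
  also have "\<dots> \<longleftrightarrow> up.deg_ge2 ((\<lambda>p. rep (v p)) ` I) (rep x)"
    unfolding ev_simps(1-6) ultra_bex_finite[OF ultra assms] up.deg_ge2_def bex_simps(7) uadj_rep rep_eq_iff
    unfolding uadj_def ..
  finally show ?thesis ..
qed

lemma obstruction_transfer:
  assumes "finite I" "finite J"
  shows "up.obstruction ((\<lambda>p. rep (v p)) ` I) ((\<lambda>p. rep (v p)) ` J) \<longleftrightarrow>
    eventually (\<lambda>i. obstruction ((\<lambda>p. v p i) ` I) ((\<lambda>p. v p i) ` J)) U"
proof -
  have eq: "f ` J \<inter> f ` I = {} \<longleftrightarrow> (\<forall>p\<in>J. \<forall>q\<in>I. \<not> f p = f q)" for f :: "_ \<Rightarrow> 'v" by auto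
  have eq': "f ` J \<inter> f ` I = {} \<longleftrightarrow> (\<forall>p\<in>J. \<forall>q\<in>I. \<not> f p = f q)" for f :: "_ \<Rightarrow> nat \<Rightarrow> 'v" by auto
  have fin: "finite (J \<union> I)" using assms by simp
  show ?thesis
    unfolding obstruction_def up.obstruction_def eq eq' image_Un[symmetric] ball_simps(9) deg_ge3_transfer[OF fin] image_is_empty
    by (simp add: assms eventually_conj_iff ultra_const[OF ultra] ultra_not[OF ultra]
        eventually_ball_finite_distrib rep_eq_iff)
qed

lemma rep_image: "S \<subseteq> pow V \<Longrightarrow> (\<lambda>x. rep x) ` S = S"
  using pow_rep by force

lemma obstruction_coordinates:
  assumes "up.obstruction F X" "finite F" "F \<subseteq> pow V" "X \<subseteq> pow V"
  shows "eventually (\<lambda>i. obstruction ((\<lambda>x. x i) ` F) ((\<lambda>x. x i) ` X)) U"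
  using obstruction_transfer[of F X "\<lambda>x. x"] assms rep_image[of F V] rep_image[of X V]
  unfolding up.obstruction_def by simp

lemma image_coordinates:
  assumes "finite X" "X \<subseteq> pow V"
  shows "eventually (\<lambda>i. (\<lambda>x. x i) ` X \<subseteq> V) U"
proof -
  have "eventually (\<lambda>i. \<forall>x\<in>X. x i \<in> V) U"
    using assms pow_mem by (intro eventually_ball_finite) auto
  then show ?thesis by eventually_elim blast
qed

text \<open>An obstruction in the ultrapower has finite size and a finite base, so almost every
  coordinate displays an obstruction in \<open>V\<close>; the part outside \<open>A\<close> is one
  over \<open>A\<close>.\<close>

lemma pow_strong:
  assumes "strong A V"
  shows "up.strong (pow A) (pow V)"
  unfolding up.strong_def
proof (intro conjI allI impI notI)
  have "A \<subseteq> V" using assms unfolding strong_def by blast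
  then show sub: "pow A \<subseteq> pow V" by (rule pow_mono)
  fix X assume X: "X \<subseteq> pow V" "up.obstruction (pow A) X"
  obtain F where F: "finite F" "F \<subseteq> pow A" "up.obstruction F X" using up.obstruction_finite_base[OF X(2)] .
  have fX: "finite X" "X \<noteq> {}" using X(2) unfolding up.obstruction_def by auto
  have "eventually (\<lambda>i. \<forall>x\<in>X. \<not> x i \<in> A) U"
  proof (intro eventually_ball_finite[OF fX(1)] ballI)
    fix x assume x: "x \<in> X"
    then have "x \<in> pow V" "x \<notin> pow A" using X unfolding up.obstruction_def by auto
    then show "eventually (\<lambda>i. \<not> x i \<in> A) U" unfolding ev_simps(1) pow_def by auto
  qed
  with image_coordinates[OF fX(1) X(1)] image_coordinates[OF F(1,2)]
    obstruction_coordinates[OF F(3,1) subset_trans[OF F(2) sub] X(1)]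
  have "eventually (\<lambda>i. False) U"
  proof eventually_elim
    case (elim i)
    have "obstruction A ((\<lambda>x. x i) ` X - A)" using elim fX(2) by (intro obstruction_remove[OF elim(3,2)]) auto
    moreover have "(\<lambda>x. x i) ` X - A \<subseteq> V" using elim by blast
    ultimately show ?case using assms unfolding strong_def by blast
  qed
  then show False using ultra unfolding ultra_def trivial_limit_def by simp
qed

lemma pow_empty: "pow {} = {}"
  unfolding pow_def ev_simps by (simp add: ev_simps)

lemma pow_open_pplane: "open_pplane V \<Longrightarrow> up.open_pplane (pow V)"
  using pow_pplane pow_thick pow_strong[of "{}" V] unfolding open_pplane_def up.open_pplane_def pow_empty by blast

end

context bipartite_graph begin

section \<open>Extending isomorphisms of strong subsets\<close>

definition partial_iso :: "('v \<Rightarrow> 'v) \<Rightarrow> 'v set \<Rightarrow> bool" where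
  "partial_iso f D \<longleftrightarrow> inj_on f D \<and> (\<forall>x\<in>D. s (f x) = s x) \<and> (\<forall>x\<in>D. \<forall>y\<in>D. adj (f x) (f y) \<longleftrightarrow> adj x y)"

lemma partial_iso_id: "partial_iso (\<lambda>x. x) D"
  unfolding partial_iso_def by simp

lemma partial_iso_insert:
  assumes "partial_iso f D" "c \<notin> D" "c' \<notin> f ` D" "s c' = s c" "\<And>d. d \<in> D \<Longrightarrow> adj c' (f d) \<longleftrightarrow> adj c d"
  shows "partial_iso (f(c := c')) (insert c D)"
proof -
  have "adj (f d) c' \<longleftrightarrow> adj d c" if "d \<in> D" for d using assms(5)[OF that] adj_sym by blast
  moreover have "d \<noteq> c" if "d \<in> D" for d using that assms(2) by blast
  moreover have "inj_on (f(c := c')) (insert c D)"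
    using assms(1,2,3) unfolding partial_iso_def by (auto simp: inj_on_def)
  ultimately show ?thesis
    using assms(1,4,5) unfolding partial_iso_def by (simp add: adj_irrefl)
qed

lemma partial_iso_inv:
  assumes "partial_iso f D"
  shows "partial_iso (inv_into D f) (f ` D)"
proof -
  have inj: "inj_on f D" using assms unfolding partial_iso_def by blast
  have "inv_into D f (f x) = x" if "x \<in> D" for x using inv_into_f_f[OF inj that] .
  then show ?thesis using assms unfolding partial_iso_def by (auto intro!: inj_onI)
qed

lemma partial_iso_deg_ge3:
  assumes "partial_iso f D" "T \<subseteq> D" "x \<in> D"
  shows "deg_ge3 (f ` T) (f x) \<longleftrightarrow> deg_ge3 T x"
proof -
  have "f a = f b \<longleftrightarrow> a = b" if "a \<in> T" "b \<in> T" for a b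
    using assms that unfolding partial_iso_def inj_on_def by blast
  moreover have "adj (f x) (f a) \<longleftrightarrow> adj x a" if "a \<in> T" for a
    using assms that unfolding partial_iso_def by blast
  ultimately show ?thesis unfolding deg_ge3_def by simp
qed

lemma partial_iso_obstruction:
  assumes "partial_iso f D" "F \<subseteq> D" "X \<subseteq> D"
  shows "obstruction (f ` F) (f ` X) \<longleftrightarrow> obstruction F X"
proof -
  have inj: "inj_on f D" using assms unfolding partial_iso_def by blast
  have "finite (f ` X) \<longleftrightarrow> finite X" using finite_image_iff[OF inj_on_subset[OF inj assms(3)]] .
  moreover have "f ` X \<inter> f ` F = f ` (X \<inter> F)" using inj_on_image_Int[OF inj assms(3,2)] by simp
  moreover have "deg_ge3 (f ` X \<union> f ` F) (f x) \<longleftrightarrow> deg_ge3 (X \<union> F) x" if "x \<in> X" for x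
    using partial_iso_deg_ge3[OF assms(1), of "X \<union> F" x] assms that by (auto simp: image_Un)
  ultimately show ?thesis unfolding obstruction_def by simp
qed

text \<open>An obstruction over \<open>S\<close> would lie in \<open>insert m S\<close>, hence be
  \<open>{m}\<close>, but \<open>m\<close> has too few neighbours. It allows auxiliary elements to
  be dropped again.\<close>

lemma strong_remove:
  assumes "strong (insert m S) V" "\<not> deg_ge3 S m" "S \<subseteq> V"
  shows "strong S V"
  unfolding strong_def
proof (intro conjI allI impI notI)
  fix X assume X: "X \<subseteq> V" "obstruction S X"
  have "X \<subseteq> insert m S" using strong_obstruction_subset[OF assms(1) _ X(2,1)] by blast
  then have "X = {m}" using X(2) unfolding obstruction_def by blast
  then have "deg_ge3 (insert m S) m" using X(2) unfolding obstruction_def by simp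
  then have "deg_ge3 S m" using adj_irrefl unfolding deg_ge3_def by (metis insertE)
  then show False using assms(2) by blast
qed (rule assms(3))

end

section \<open>Generic points and extension of partial isomorphisms\<close>

text \<open>The lower bound \<open>k\<close> lets one index \<open>n\<close> serve both as a stage
  containing \<open>F\<close> and as a size bound.\<close>

lemma finite_subset_enumeration:
  assumes "countable D" "D \<noteq> {}" "finite F" "F \<subseteq> D"
  shows "\<exists>n\<ge>k. F \<subseteq> from_nat_into D ` {..n::nat}"
proof -
  have "\<forall>x\<in>F. \<exists>n. from_nat_into D n = x"
    using assms(1,2,4) range_from_nat_into[OF assms(2,1)] by (metis rangeE subsetD)
  then obtain h where h: "\<forall>x\<in>F. from_nat_into D (h x) = x" by metis
  let ?n = "Max (insert k (h ` F))"
  have "h x \<le> ?n" if "x \<in> F" for x using assms(3) that by (intro Max_ge) auto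
  then have "x \<in> from_nat_into D ` {..?n}" if "x \<in> F" for x
    using h that by (intro image_eqI[of _ _ "h x"]) auto
  moreover have "k \<le> ?n" using assms(3) by (intro Max_ge) auto
  ultimately show ?thesis by blast
qed

context ultrapower begin

lemma bad_coordinates:
  assumes "up.bad (pow B) F k c" "finite F" "F \<subseteq> pow B"
  shows "eventually (\<lambda>i. bad B ((\<lambda>x. x i) ` F) k (c i)) U"
proof -
  obtain W where W: "W \<subseteq> pow B" "finite W" "card W \<le> k" "W \<inter> F = {}" "c \<in> W"
    "\<forall>y\<in>W - {c}. up.deg_ge3 (W \<union> F) y" "up.deg_ge2 (W \<union> F) c" using assms(1) unfolding up.bad_def by blast
  have fin: "finite (W \<union> F)" using W assms by simp
  have WF: "(\<lambda>x. rep x) ` (W \<union> F) = W \<union> F" using rep_image[of "W \<union> F" B] W assms by blast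
  have "eventually (\<lambda>i. \<forall>y\<in>W - {c}. deg_ge3 ((\<lambda>x. x i) ` (W \<union> F)) (y i)) U"
  proof (intro eventually_ball_finite ballI)
    fix y assume y: "y \<in> W - {c}"
    then have "rep y = y" using W pow_rep by blast
    then show "eventually (\<lambda>i. deg_ge3 ((\<lambda>x. x i) ` (W \<union> F)) (y i)) U"
      using deg_ge3_transfer[OF fin, of "\<lambda>x. x" y] W(6) y unfolding WF by simp
  qed (use W in simp)
  moreover have "eventually (\<lambda>i. deg_ge2 ((\<lambda>x. x i) ` (W \<union> F)) (c i)) U"
  proof -
    have "rep c = c" using W pow_rep by blast
    then show ?thesis using deg_ge2_transfer[OF fin, of "\<lambda>x. x" c] W(7) unfolding WF by simp
  qed
  moreover have "eventually (\<lambda>i. \<forall>x\<in>W. \<forall>y\<in>F. \<not> x i = y i) U"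
  proof (intro eventually_ball_finite ballI)
    fix x y assume "x \<in> W" "y \<in> F"
    then have "x \<in> pow B" "y \<in> pow B" "x \<noteq> y" using W assms by auto
    then show "eventually (\<lambda>i. \<not> x i = y i) U" unfolding ev_simps(1) using pow_eq_iff by blast
  qed (use W assms in simp_all)
  ultimately show ?thesis using image_coordinates[OF W(2,1)]
  proof eventually_elim
    case (elim i)
    have "card ((\<lambda>x. x i) ` W) \<le> k" using card_image_le[OF W(2)] W(3) by (rule le_trans)
    moreover have "(\<lambda>x. x i) ` W \<inter> (\<lambda>x. x i) ` F = {}" using elim(3) by blast
    moreover have "\<forall>y\<in>(\<lambda>x. x i) ` W - {c i}. deg_ge3 ((\<lambda>x. x i) ` (W \<union> F)) y" using elim(1) by blast
    ultimately show ?case unfolding bad_def using elim(2,4) W(2,5)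
      by (intro exI[of _ "(\<lambda>x. x i) ` W"]) (simp add: image_Un)
  qed
qed

text \<open>The type states that \<open>c\<close> is adjacent to \<open>l\<close>, outside
  \<open>F n\<close> and not bad over \<open>F n\<close> with bound \<open>n\<close>;
  \<open>generic_neighbour\<close> makes it finitely satisfiable. In its realisation, a second
  neighbour in \<open>E\<close> would make \<open>{c}\<close> a witness of badness. An obstruction
  over \<open>insert c E\<close> is one over \<open>E\<close> if it avoids the neighbours of
  \<open>c\<close>, and together with \<open>c\<close> a witness of badness otherwise.\<close>

lemma generic_point:
  assumes "open_pplane B" "E \<subseteq> pow B" "countable E" "up.strong E (pow B)" "l \<in> E"
  shows "\<exists>c\<in>pow B. c \<notin> E \<and> (\<forall>e\<in>E. uadj c e \<longleftrightarrow> e = l) \<and> up.strong (insert c E) (pow B)"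
proof -
  have Ene: "E \<noteq> {}" using assms(5) by blast
  define F where "F n = insert l (from_nat_into E ` {..n})" for n
  have Ffin: "finite (F n)" and FE: "F n \<subseteq> E" and lF: "l \<in> F n" for n
    using from_nat_into[OF Ene] assms(5) unfolding F_def by auto
  have Fmono: "F m \<subseteq> F n" if "m \<le> n" for m n using that unfolding F_def by auto
  have Fex: "\<exists>n\<ge>k. K \<subseteq> F n" if "finite K" "K \<subseteq> E" for K k
    using finite_subset_enumeration[OF assms(3) Ene that, of k] unfolding F_def by blast
  define \<phi> where "\<phi> n i g \<longleftrightarrow> g () \<in> B \<and> adj (g ()) (l i) \<and> g () \<notin> (\<lambda>x. x i) ` F n \<and>
      \<not> bad B ((\<lambda>x. x i) ` F n) n (g ())" for n i and g :: "unit \<Rightarrow> 'v"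
  have "\<exists>g. \<forall>m\<le>n. eventually (\<lambda>i. \<phi> m i (\<lambda>d. g d i)) U" for n
  proof -
    have "eventually (\<lambda>i. (\<lambda>x. x i) ` F n \<subseteq> B) U"
      using image_coordinates[OF Ffin] FE assms(2) by blast
    then have "eventually (\<lambda>i. \<exists>c. \<forall>m\<le>n. \<phi> m i (\<lambda>d. c)) U"
    proof eventually_elim
      case (elim i)
      obtain c where c: "c \<in> B" "adj c (l i)" "c \<notin> (\<lambda>x. x i) ` F n" "\<not> bad B ((\<lambda>x. x i) ` F n) n c"
        using generic_neighbour[OF assms(1) finite_imageI[OF Ffin] elim, of "l i" n] lF[of n] by auto
      \<comment> \<open>Badness grows with base and bound, so the choice for \<open>n\<close>
        settles all smaller indices.\<close>
      have "\<phi> m i (\<lambda>d. c)" if "m \<le> n" for m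
      proof -
        have sub: "(\<lambda>x. x i) ` F m \<subseteq> (\<lambda>x. x i) ` F n" using Fmono[OF that] by (rule image_mono)
        then have "\<not> bad B ((\<lambda>x. x i) ` F m) m c" using bad_mono[OF _ sub that c(3)] c(4) by blast
        moreover have "c \<notin> (\<lambda>x. x i) ` F m" using sub c(3) by (rule contra_subsetD)
        ultimately show ?thesis using c(1,2) unfolding \<phi>_def by simp
      qed
      then show ?case by blast
    qed
    then obtain c where "eventually (\<lambda>i. \<forall>m\<le>n. \<phi> m i (\<lambda>d. c i)) U" unfolding eventually_choice by blast
    then have "\<forall>m\<le>n. eventually (\<lambda>i. \<phi> m i (\<lambda>d. c i)) U" by (auto elim: eventually_mono)
    then show ?thesis by (intro exI[of _ "\<lambda>d. c"])
  qed
  from countable_saturation[OF U_le this] obtain g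
    where g: "\<And>n. eventually (\<lambda>i. \<phi> n i (\<lambda>d. g d i)) U" by blast
  define c where "c = rep (g ())"
  have c: "eventually (\<lambda>i. c i \<in> B \<and> adj (c i) (l i) \<and> c i \<notin> (\<lambda>x. x i) ` F n \<and>
      \<not> bad B ((\<lambda>x. x i) ` F n) n (c i)) U" for n
    using g[of n] rep_eq[of "g ()"] unfolding \<phi>_def c_def by eventually_elim simp
  have cB: "c \<in> pow B" unfolding c_def rep_in_pow using g[of 0] unfolding \<phi>_def by (rule eventually_mono) simp
  have cl: "uadj c l" unfolding uadj_def using c[of 0] by (rule eventually_mono) simp
  have nbad: "\<not> up.bad (pow B) (F n) n c" for n
  proof
    assume "up.bad (pow B) (F n) n c"
    then have "eventually (\<lambda>i. bad B ((\<lambda>x. x i) ` F n) n (c i)) U"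
      using bad_coordinates Ffin FE assms(2) by blast
    with c[of n] have "eventually (\<lambda>i. False) U" by eventually_elim simp
    then show False using ultra unfolding ultra_def trivial_limit_def by simp
  qed
  have cE: "c \<notin> E"
  proof
    assume "c \<in> E"
    then obtain n where "c \<in> F n" using Fex[of "{c}" 0] by auto
    then have "eventually (\<lambda>i. False) U" using c[of n] by (auto elim: eventually_mono)
    then show False using ultra unfolding ultra_def trivial_limit_def by simp
  qed
  have only: "e = l" if "e \<in> E" "uadj c e" for e
  proof (rule ccontr)
    assume "e \<noteq> l"
    obtain n where n: "1 \<le> n" "e \<in> F n" using Fex[of "{e}" 1] \<open>e \<in> E\<close> by auto
    have "up.deg_ge2 ({c} \<union> F n) c"
      unfolding up.deg_ge2_def using cl that n lF[of n] \<open>e \<noteq> l\<close> by blast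
    then have "up.bad (pow B) (F n) n c"
      unfolding up.bad_def using cB n cE FE[of n] by (intro exI[of _ "{c}"]) auto
    then show False using nbad by blast
  qed
  have "up.strong (insert c E) (pow B)"
    unfolding up.strong_def
  proof (intro conjI allI impI notI)
    show "insert c E \<subseteq> pow B" using cB assms(2) by blast
    fix X assume X: "X \<subseteq> pow B" "up.obstruction (insert c E) X"
    have fX: "finite X" "X \<noteq> {}" "X \<inter> insert c E = {}" using X(2) unfolding up.obstruction_def by auto
    obtain F0 where F0: "finite F0" "F0 \<subseteq> insert c E" "up.obstruction F0 X" using up.obstruction_finite_base[OF X(2)] .
    \<comment> \<open>One more than \<open>card X\<close>, because the witness of badness will be
      \<open>insert c X\<close>.\<close>
    obtain n where n: "card X + 1 \<le> n" "F0 - {c} \<subseteq> F n" using Fex[of "F0 - {c}"] F0 by blast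
    have d: "up.deg_ge3 (X \<union> insert c (F n)) x" if "x \<in> X" for x
    proof (rule up.deg_ge3_mono)
      show "up.deg_ge3 (X \<union> F0) x" using F0(3) that unfolding up.obstruction_def by blast
    qed (use n in blast)
    show False
    proof (cases "\<exists>x\<in>X. uadj c x")
      case True
      then obtain x where x: "x \<in> X" "uadj c x" by blast
      have "x \<noteq> l" using x fX(3) assms(5) by blast
      then have "up.deg_ge2 (insert c X \<union> F n) c" unfolding up.deg_ge2_def using x cl lF by blast
      moreover have "\<forall>y\<in>insert c X - {c}. up.deg_ge3 (insert c X \<union> F n) y" using d by (simp add: insert_commute)
      moreover have "insert c X \<inter> F n = {}" using fX(3) cE FE by blast
      moreover have "card (insert c X) \<le> n" using n card_insert_le_m1[of "Suc n" X c] fX(1) by (simp add: card_insert_if)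
      ultimately have "up.bad (pow B) (F n) n c"
        unfolding up.bad_def using X(1) cB fX(1) by (intro exI[of _ "insert c X"]) simp
      then show False using nbad by blast
    next
      case False
      have "up.deg_ge3 (X \<union> E) x" if "x \<in> X" for x
      proof -
        obtain a b e where abe: "a \<in> X \<union> insert c (F n)" "b \<in> X \<union> insert c (F n)" "e \<in> X \<union> insert c (F n)"
          "a \<noteq> b" "a \<noteq> e" "b \<noteq> e" "uadj x a" "uadj x b" "uadj x e" using d[OF \<open>x \<in> X\<close>] by (rule up.deg_ge3E)
        have "v \<in> X \<union> E" if "v \<in> X \<union> insert c (F n)" "uadj x v" for v
          using that False \<open>x \<in> X\<close> up.adj_sym FE[of n] by blast
        then show ?thesis using abe by (intro up.deg_ge3I[of a _ b e]) simp_all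
      qed
      then have "up.obstruction E X" using fX unfolding up.obstruction_def by blast
      then show False using assms(4) X(1) unfolding up.strong_def by blast
    qed
  qed
  then show ?thesis using cB cE only cl by blast
qed

text \<open>
  A point with two neighbours in \<open>D\<close> is mapped to a join, a point with one neighbour to a generic neighbour,
  and a point without neighbours to a generic neighbour of a generic neighbour.
\<close>

lemma extend_point:
  assumes "up.pplane M" "D \<subseteq> M" "c \<in> M" "c \<notin> D" "\<not> up.deg_ge3 D c" "open_pplane B"
    and "countable D" "up.strong (f ` D) (pow B)" "up.partial_iso f D" "\<exists>d\<in>D. us d = us c"
  shows "\<exists>c'. c' \<notin> f ` D \<and> up.partial_iso (f(c := c')) (insert c D) \<and> up.strong (insert c' (f ` D)) (pow B)"
proof -
  let ?E = "f ` D"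
  have EB: "?E \<subseteq> pow B" using assms(8) unfolding up.strong_def by blast
  have cE: "countable ?E" using assms(7) by simp
  have inj: "f d = f e \<longleftrightarrow> d = e" if "d \<in> D" "e \<in> D" for d e
    using assms(9) that unfolding up.partial_iso_def inj_on_def by blast
  have sf: "us (f d) = us d" if "d \<in> D" for d using assms(9) that unfolding up.partial_iso_def by blast
  have fin: ?thesis if "c' \<notin> ?E" "us c' = us c" "\<And>d. d \<in> D \<Longrightarrow> uadj c' (f d) \<longleftrightarrow> uadj c d"
      "up.strong (insert c' ?E) (pow B)" for c'
    using up.partial_iso_insert[OF assms(9,4) that(1-3)] that by blast
  consider "\<forall>d\<in>D. \<not> uadj c d" | d where "d \<in> D" "uadj c d" "\<forall>e\<in>D. uadj c e \<longrightarrow> e = d"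
    | d e where "d \<in> D" "e \<in> D" "d \<noteq> e" "uadj c d" "uadj c e"
    by blast
  then show ?thesis
  proof cases
    case 1
    obtain d where d: "d \<in> D" "us d = us c" using assms(10) by blast
    obtain m where m: "m \<in> pow B" "m \<notin> ?E" "\<forall>e\<in>?E. uadj m e \<longleftrightarrow> e = f d" "up.strong (insert m ?E) (pow B)"
      using generic_point[OF assms(6) EB cE assms(8), of "f d"] d by blast
    obtain c' where c': "c' \<in> pow B" "c' \<notin> insert m ?E" "\<forall>e\<in>insert m ?E. uadj c' e \<longleftrightarrow> e = m"
      "up.strong (insert c' (insert m ?E)) (pow B)"
      using generic_point[OF assms(6) _ _ m(4), of m] m EB cE by (metis countable_insert insertI1 insert_subset)
    show ?thesis
    proof (rule fin)
      show "c' \<notin> ?E" using c' by blast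
      have "uadj m (f d)" "uadj c' m" using m(3) c'(3) d by auto
      then have "us c' = us (f d)" using up.adj_sort by metis
      then show "us c' = us c" using sf[OF d(1)] d(2) by simp
      show "uadj c' (f e) \<longleftrightarrow> uadj c e" if "e \<in> D" for e
      proof -
        have "f e \<in> ?E" "f e \<noteq> m" using that m(2) by auto
        then show ?thesis using 1 c'(3) that by simp
      qed
      \<comment> \<open>The intermediate \<open>m\<close> belongs to no image and is removed: its
        neighbours in the new set are only \<open>c'\<close> and \<open>f d\<close>.\<close>
      show "up.strong (insert c' ?E) (pow B)"
      proof (rule up.strong_remove[of m])
        show "up.strong (insert m (insert c' ?E)) (pow B)" using c'(4) by (simp add: insert_commute)
        show "insert c' ?E \<subseteq> pow B" using c'(1) EB by blast
        show "\<not> up.deg_ge3 (insert c' ?E) m"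
        proof
          assume "up.deg_ge3 (insert c' ?E) m"
          then obtain x y z where xyz: "x \<in> insert c' ?E" "y \<in> insert c' ?E" "z \<in> insert c' ?E"
            "x \<noteq> y" "x \<noteq> z" "y \<noteq> z" "uadj m x" "uadj m y" "uadj m z" by (rule up.deg_ge3E)
          then have "x \<in> {c', f d}" "y \<in> {c', f d}" "z \<in> {c', f d}" using m(3) by blast+
          then show False using xyz(4-6) by auto
        qed
      qed
    qed
  next
    case (2 d)
    obtain c' where c': "c' \<in> pow B" "c' \<notin> ?E" "\<forall>e\<in>?E. uadj c' e \<longleftrightarrow> e = f d"
      "up.strong (insert c' ?E) (pow B)"
      using generic_point[OF assms(6) EB cE assms(8), of "f d"] 2 by blast
    show ?thesis
    proof (rule fin)
      show "us c' = us c" using up.adj_sort[of c' "f d"] up.adj_sort[OF 2(2)] sf[OF 2(1)] c'(3) 2(1) by auto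
      show "uadj c' (f e) \<longleftrightarrow> uadj c e" if "e \<in> D" for e using 2 c'(3) that inj[OF that 2(1)] by blast
    qed (use c' in auto)
  next
    case (3 d e)
    have pB: "up.pplane (pow B)" using pow_open_pplane[OF assms(6)] unfolding up.open_pplane_def by blast
    have only: "x = d \<or> x = e" if "x \<in> D" "uadj c x" for x
    proof (rule ccontr)
      assume "\<not> (x = d \<or> x = e)"
      then have "up.deg_ge3 D c" using up.deg_ge3I[of x D d e c] that 3 by blast
      then show False using assms(5) by blast
    qed
    have "f d \<noteq> f e" "f d \<in> pow B" "f e \<in> pow B" using inj 3 EB by auto
    moreover have "us (f d) = us (f e)"
      using sf[OF 3(1)] sf[OF 3(2)] up.adj_sort[OF 3(4)] up.adj_sort[OF 3(5)] by auto
    ultimately have J: "up.join (pow B) (f d) (f e) \<in> pow B" "uadj (up.join (pow B) (f d) (f e)) (f d)"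
      "uadj (up.join (pow B) (f d) (f e)) (f e)" using up.join[OF pB, of "f d" "f e"] by auto
    let ?c = "up.join (pow B) (f d) (f e)"
    \<comment> \<open>A preimage of the join would be adjacent to \<open>d\<close> and
      \<open>e\<close>, hence equal to \<open>c\<close> by uniqueness in \<open>M\<close>, although
      \<open>c\<close> is not in \<open>D\<close>.\<close>
    have cnE: "?c \<notin> ?E"
    proof
      assume "?c \<in> ?E"
      then obtain x where x: "x \<in> D" "?c = f x" by auto
      then have "uadj x d" "uadj x e" using J assms(9) 3(1,2) unfolding up.partial_iso_def by auto
      then have "x = c" using up.adj_unique[OF assms(1), of d e x c] 3 x assms(2,3) by blast
      then show False using x assms(4) by blast
    qed
    have nd: "\<not> up.deg_ge3 ?E ?c"
    proof
      assume "up.deg_ge3 ?E ?c"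
      then have "up.deg_ge3 ({?c} \<union> ?E) ?c" by (rule up.deg_ge3_mono) blast
      then have "up.obstruction ?E {?c}" unfolding up.obstruction_def using cnE by simp
      then show False using assms(8) J(1) unfolding up.strong_def by blast
    qed
    have nbrs: "x = d \<or> x = e" if "x \<in> D" "uadj ?c (f x)" for x
    proof (rule ccontr)
      assume "\<not> (x = d \<or> x = e)"
      then have "f x \<noteq> f d" "f x \<noteq> f e" using inj 3 that by auto
      then have "up.deg_ge3 ?E ?c" using up.deg_ge3I[of "f x" ?E "f d" "f e" ?c] that 3 J \<open>f d \<noteq> f e\<close> by blast
      then show False using nd by blast
    qed
    show ?thesis
    proof (rule fin)
      show "?c \<notin> ?E" by (rule cnE)
      show "us ?c = us c" using up.adj_sort[OF J(2)] up.adj_sort[OF 3(4)] sf[OF 3(1)] by auto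
      show "uadj ?c (f x) \<longleftrightarrow> uadj c x" if "x \<in> D" for x using nbrs[OF that] only[OF that] J 3 by blast
      \<comment> \<open>If an obstruction touches \<open>?c\<close>, then \<open>?c\<close> has
        degree three through it, \<open>f d\<close> and \<open>f e\<close>; adding \<open>?c\<close>
        gives an obstruction over \<open>?E\<close>. If it does not, it is already one.\<close>
      show "up.strong (insert ?c ?E) (pow B)"
        unfolding up.strong_def
      proof (intro conjI allI impI notI)
        show "insert ?c ?E \<subseteq> pow B" using J EB by blast
        fix X assume X: "X \<subseteq> pow B" "up.obstruction (insert ?c ?E) X"
        have fX: "finite X" "X \<noteq> {}" "X \<inter> insert ?c ?E = {}" and
          dX: "\<And>x. x \<in> X \<Longrightarrow> up.deg_ge3 (X \<union> insert ?c ?E) x" using X(2) unfolding up.obstruction_def by auto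
        show False
        proof (cases "\<exists>x\<in>X. uadj ?c x")
          case True
          then obtain x where x: "x \<in> X" "uadj ?c x" by blast
          have "x \<noteq> f d" "x \<noteq> f e" using x fX(3) 3(1,2) by auto
          then have "up.deg_ge3 (insert ?c X \<union> ?E) ?c"
            using up.deg_ge3I[of x "insert ?c X \<union> ?E" "f d" "f e" ?c] x J 3(1,2) \<open>f d \<noteq> f e\<close> by blast
          moreover have "insert ?c X \<union> ?E = X \<union> insert ?c ?E" by blast
          moreover have "insert ?c X \<inter> ?E = {}" using fX(3) cnE by blast
          ultimately have "up.obstruction ?E (insert ?c X)" unfolding up.obstruction_def using fX(1) dX by simp
          moreover have "insert ?c X \<subseteq> pow B" using X(1) J(1) by simp
          ultimately show False using assms(8) unfolding up.strong_def by simp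
        next
          case False
          have "up.deg_ge3 (X \<union> ?E) x" if "x \<in> X" for x
          proof -
            obtain u v w where uvw: "u \<in> X \<union> insert ?c ?E" "v \<in> X \<union> insert ?c ?E" "w \<in> X \<union> insert ?c ?E"
              "u \<noteq> v" "u \<noteq> w" "v \<noteq> w" "uadj x u" "uadj x v" "uadj x w" using dX[OF \<open>x \<in> X\<close>] by (rule up.deg_ge3E)
            have "\<not> uadj x ?c" using False that up.adj_sym by blast
            then have "u \<in> X \<union> ?E" "v \<in> X \<union> ?E" "w \<in> X \<union> ?E" using uvw by blast+
            then show ?thesis using uvw by (intro up.deg_ge3I[of u _ v w]) simp_all
          qed
          then have "up.obstruction ?E X" using fX unfolding up.obstruction_def by blast
          then show False using assms(8) X(1) unfolding up.strong_def by blast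
        qed
      qed
    qed
  qed
qed

text \<open>As \<open>C\<close> is no obstruction over \<open>D\<close>, some \<open>c\<close> in it
  has at most two neighbours in \<open>C \<union> D\<close>. Extending to the rest first leaves
  \<open>c\<close> for \<open>extend_point\<close>. Both sorts occur in \<open>D\<close>, so
  isolated elements have a starting point.\<close>

lemma extend_finite:
  assumes "up.pplane M" "up.strong D M" "open_pplane B"
    and "countable D" "up.strong (f ` D) (pow B)" "up.partial_iso f D" "\<exists>d\<in>D. us d" "\<exists>d\<in>D. \<not> us d"
    and "finite C" "C \<subseteq> M" "C \<inter> D = {}"
  shows "\<exists>g. (\<forall>d\<in>D. g d = f d) \<and> up.partial_iso g (D \<union> C) \<and> up.strong (g ` (D \<union> C)) (pow B)"
  using assms(9-11)
proof (induction C rule: finite_psubset_induct)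
  case (psubset C)
  have DM: "D \<subseteq> M" using assms(2) unfolding up.strong_def by blast
  show ?case
  proof (cases "C = {}")
    case True
    then show ?thesis using assms(5,6) by (intro exI[of _ f]) simp
  next
    case False
    have "\<not> up.obstruction D C" using assms(2) psubset.prems(1) unfolding up.strong_def by blast
    then obtain c where c: "c \<in> C" "\<not> up.deg_ge3 (C \<union> D) c"
      using False psubset.hyps psubset.prems unfolding up.obstruction_def by blast
    let ?C = "C - {c}"
    have "?C \<subset> C" using c by blast
    then obtain g where g: "\<forall>d\<in>D. g d = f d" "up.partial_iso g (D \<union> ?C)" "up.strong (g ` (D \<union> ?C)) (pow B)"
      using psubset.IH[of ?C] psubset.prems by blast
    have "\<exists>c'. c' \<notin> g ` (D \<union> ?C) \<and> up.partial_iso (g(c := c')) (insert c (D \<union> ?C)) \<and>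
        up.strong (insert c' (g ` (D \<union> ?C))) (pow B)"
    proof (rule extend_point[OF assms(1) _ _ _ _ assms(3) _ g(3,2)])
      show "D \<union> ?C \<subseteq> M" "c \<in> M" "c \<notin> D \<union> ?C" using DM psubset.prems c by auto
      show "\<not> up.deg_ge3 (D \<union> ?C) c" using c(2) up.deg_ge3_mono[of "D \<union> ?C" c "C \<union> D"] by blast
      show "countable (D \<union> ?C)" using assms(4) psubset.hyps by (simp add: countable_finite)
      show "\<exists>d\<in>D \<union> ?C. us d = us c" using assms(7,8) by (cases "us c") auto
    qed
    then obtain c' where c': "up.partial_iso (g(c := c')) (insert c (D \<union> ?C))"
      "up.strong (insert c' (g ` (D \<union> ?C))) (pow B)" by blast
    have eq: "insert c (D \<union> ?C) = D \<union> C" using c by blast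
    have "c \<notin> D \<union> ?C" using psubset.prems c by blast
    then have "(g(c := c')) ` (D \<union> C) = insert c' (g ` (D \<union> ?C))" unfolding eq[symmetric] by auto
    moreover have "\<forall>d\<in>D. (g(c := c')) d = f d" using g(1) \<open>c \<notin> D \<union> ?C\<close> by auto
    ultimately show ?thesis using c' unfolding eq by metis
  qed
qed

text \<open>
  The coordinatewise approximations to an extension of \<open>f\<close> from \<open>D\<close>: the quantifier-free diagram of \<open>F\<close>,
  and all obstructions of size at most \<open>n\<close> over the image of \<open>F\<close> lying in the image of \<open>G\<close>. The latter, for all
  finite \<open>F\<close> and all \<open>n\<close>, forces the image of the union of the sets \<open>F\<close> to be strong.
\<close>

definition type_cond ::
  "'v set \<Rightarrow> (nat \<Rightarrow> 'v) set \<Rightarrow> ((nat \<Rightarrow> 'v) \<Rightarrow> nat \<Rightarrow> 'v) \<Rightarrow> (nat \<Rightarrow> 'v) set \<Rightarrow> (nat \<Rightarrow> 'v) set \<Rightarrow>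
    nat \<Rightarrow> nat \<Rightarrow> ((nat \<Rightarrow> 'v) \<Rightarrow> 'v) \<Rightarrow> bool" where
  "type_cond B D f F G n i h \<longleftrightarrow>
     (\<forall>d\<in>F. h d \<in> B \<and> (s (h d) \<longleftrightarrow> us d) \<and> (d \<in> D \<longrightarrow> h d = f d i)) \<and>
     (\<forall>d\<in>F. \<forall>e\<in>F. (h d = h e \<longleftrightarrow> d = e) \<and> (adj (h d) (h e) \<longleftrightarrow> uadj d e)) \<and>
     (\<forall>X\<subseteq>B. obstruction (h ` F) X \<and> card X \<le> n \<longrightarrow> X \<subseteq> h ` G)"

lemma type_cond_diagram:
  assumes "finite F"
  shows "eventually (\<lambda>i. (\<forall>d\<in>F. g d i \<in> B \<and> (s (g d i) \<longleftrightarrow> us d) \<and> (d \<in> D \<longrightarrow> g d i = f d i)) \<and>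
      (\<forall>d\<in>F. \<forall>e\<in>F. (g d i = g e i \<longleftrightarrow> d = e) \<and> (adj (g d i) (g e i) \<longleftrightarrow> uadj d e))) U \<longleftrightarrow>
    (\<forall>d\<in>F. rep (g d) \<in> pow B \<and> us (rep (g d)) = us d \<and> (d \<in> D \<longrightarrow> rep (g d) = rep (f d))) \<and>
    (\<forall>d\<in>F. \<forall>e\<in>F. (rep (g d) = rep (g e) \<longleftrightarrow> d = e) \<and> (uadj (rep (g d)) (rep (g e)) \<longleftrightarrow> uadj d e))"
  unfolding rep_in_pow us_rep uadj_rep rep_eq_iff
  by (simp add: assms eventually_conj_iff ultra_const[OF ultra] ultra_iff[OF ultra] ultra_imp[OF ultra]
      eventually_ball_finite_distrib us_def[of "g _"] uadj_def[of "g _" "g _"])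

text \<open>If it failed, almost every coordinate would have a small obstruction not contained in
  the image of \<open>G\<close>. These assemble to an obstruction in the ultrapower, which the
  hypothesis places inside the image of \<open>G\<close>; finiteness of \<open>G\<close> carries
  this back to the coordinates.\<close>

lemma type_cond_obstruction:
  fixes g :: "'k \<Rightarrow> nat \<Rightarrow> 'v"
  assumes "finite F" "finite G"
    and "\<And>X. X \<subseteq> pow B \<Longrightarrow> up.obstruction ((\<lambda>d. rep (g d)) ` F) X \<Longrightarrow> card X \<le> n \<Longrightarrow> X \<subseteq> (\<lambda>d. rep (g d)) ` G"
  shows "eventually (\<lambda>i. \<forall>X\<subseteq>B. obstruction ((\<lambda>d. g d i) ` F) X \<and> card X \<le> n \<longrightarrow> X \<subseteq> (\<lambda>d. g d i) ` G) U"
proof (rule ccontr)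
  let ?P = "\<lambda>i X. X \<subseteq> B \<and> obstruction ((\<lambda>d. g d i) ` F) X \<and> card X \<le> n \<and> \<not> X \<subseteq> (\<lambda>d. g d i) ` G"
  assume "\<not> ?thesis"
  then have "eventually (\<lambda>i. \<not> (\<forall>X\<subseteq>B. obstruction ((\<lambda>d. g d i) ` F) X \<and> card X \<le> n \<longrightarrow> X \<subseteq> (\<lambda>d. g d i) ` G)) U"
    unfolding ev_simps(1) .
  then have "eventually (\<lambda>i. \<exists>t. ?P i (t ` {..<n})) U"
  proof eventually_elim
    case (elim i)
    then obtain X where X: "?P i X" by blast
    have fX: "finite X" "X \<noteq> {}" using X unfolding obstruction_def by auto
    obtain t0 where t0: "bij_betw t0 {..<card X} X" using bij_betw_from_nat_into_finite[OF fX(1)] by blast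
    \<comment> \<open>Padding with a repeated element gives obstructions of varying size the common
      index set \<open>{..<n}\<close>.\<close>
    define t where "t a = (if a < card X then t0 a else t0 0)" for a :: nat
    have "0 < card X" using fX by (simp add: card_gt_0_iff)
    have "t ` {..<n} = X"
    proof
      have "t0 a \<in> X" if "a < card X" for a using t0 that unfolding bij_betw_def by blast
      then show "t ` {..<n} \<subseteq> X" using \<open>0 < card X\<close> unfolding t_def by auto
      show "X \<subseteq> t ` {..<n}"
      proof
        fix x assume "x \<in> X"
        then obtain a where "a < card X" "x = t0 a" using t0 unfolding bij_betw_def by blast
        then show "x \<in> t ` {..<n}" using X unfolding t_def by (intro image_eqI[of _ _ a]) auto
      qed
    qed
    then show ?case using X by blast
  qed
  then obtain t where t: "eventually (\<lambda>i. ?P i (t i ` {..<n})) U" unfolding eventually_choice by blast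
  \<comment> \<open>One family for the obstruction (\<open>Inl\<close>) and its base
    (\<open>Inr\<close>), as \<open>obstruction_transfer\<close> expects.\<close>
  define v where "v p i = (case p of Inl a \<Rightarrow> t i a | Inr d \<Rightarrow> g d i)" for p i
  let ?I = "Inr ` F :: (nat + 'k) set" and ?J = "Inl ` {..<n} :: (nat + 'k) set"
  let ?X = "(\<lambda>p. rep (v p)) ` ?J"
  have vI: "(\<lambda>p. v p i) ` ?I = (\<lambda>d. g d i) ` F" "(\<lambda>p. v p i) ` ?J = t i ` {..<n}" for i
    unfolding v_def by (auto simp: image_image)
  have rI: "(\<lambda>p. rep (v p)) ` Inr ` S = (\<lambda>d. rep (g d)) ` S" for S
    unfolding v_def by (simp add: image_image)
  have "eventually (\<lambda>i. obstruction ((\<lambda>p. v p i) ` ?I) ((\<lambda>p. v p i) ` ?J)) U"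
    unfolding vI using t by (rule eventually_mono) blast
  then have "up.obstruction ((\<lambda>p. rep (v p)) ` ?I) ?X"
    using obstruction_transfer[of ?I ?J v] assms(1) by simp
  then have "up.obstruction ((\<lambda>d. rep (g d)) ` F) ?X" unfolding rI .
  moreover have "?X \<subseteq> pow B"
  proof -
    have "rep (v (Inl a)) \<in> pow B" if "a < n" for a
      unfolding rep_in_pow v_def using t by (rule eventually_mono) (use that in auto)
    then show ?thesis by auto
  qed
  moreover have "card ?X \<le> n"
    using card_image_le[of ?J "\<lambda>p. rep (v p)"] card_image_le[of "{..<n}" "Inl :: _ \<Rightarrow> nat + 'k"] by simp
  ultimately have sub: "?X \<subseteq> (\<lambda>d. rep (g d)) ` G" using assms(3) by blast
  have "eventually (\<lambda>i. \<exists>d\<in>G. t i a = g d i) U" if "a < n" for a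
  proof -
    obtain d where "d \<in> G" "rep (v (Inl a)) = rep (g d)" using sub \<open>a < n\<close> by auto
    then show ?thesis unfolding ultra_bex_finite[OF ultra assms(2)] rep_eq_iff v_def by auto
  qed
  then have "eventually (\<lambda>i. \<forall>a\<in>{..<n}. \<exists>d\<in>G. t i a = g d i) U" by (intro eventually_ball_finite) auto
  with t have "eventually (\<lambda>i. False) U"
    by eventually_elim blast
  then show False using ultra unfolding ultra_def trivial_limit_def by simp
qed

lemma extend_countable:
  assumes "up.open_pplane M" "up.strong D M" "open_pplane B"
    and "countable D" "up.strong (f ` D) (pow B)" "up.partial_iso f D" "\<exists>d\<in>D. us d" "\<exists>d\<in>D. \<not> us d"
    and "D \<subseteq> D'" "countable D'" "up.strong D' M"
  shows "\<exists>g. (\<forall>d\<in>D. g d = f d) \<and> up.partial_iso g D' \<and> up.strong (g ` D') (pow B)"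
proof -
  have ppM: "up.pplane M" and opM: "up.strong {} M" using assms(1) unfolding up.open_pplane_def by auto
  have DM: "D' \<subseteq> M" using assms(11) unfolding up.strong_def by blast
  have fB: "f ` D \<subseteq> pow B" using assms(5) unfolding up.strong_def by blast
  have D'ne: "D' \<noteq> {}" using assms(7,9) by blast
  define F where "F n = from_nat_into D' ` {..n}" for n :: nat
  have Ffin: "finite (F n)" and FD: "F n \<subseteq> D'" for n
    using from_nat_into[OF D'ne] unfolding F_def by auto
  have Fmono: "F m \<subseteq> F n" if "m \<le> n" for m n using that unfolding F_def by auto
  have Fex: "\<exists>n\<ge>k. K \<subseteq> F n" if "finite K" "K \<subseteq> D'" for K k
    using finite_subset_enumeration[OF assms(10) D'ne that, of k] unfolding F_def by blast
  \<comment> \<open>A finite set, by \<open>finite_obstruction\<close>, and part of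
    \<open>D'\<close>, because \<open>D'\<close> is strong.\<close>
  define G where "G n = \<Union>{X. X \<subseteq> M \<and> up.obstruction (F n) X \<and> card X \<le> n}" for n
  have Gfin: "finite (G n)" for n
    unfolding G_def using up.finite_obstruction[OF opM Ffin, of n n] FD DM
    by (intro finite_Union) (auto simp: up.obstruction_def)
  have GD: "G n \<subseteq> D'" for n
    unfolding G_def using up.strong_obstruction_subset[OF assms(11) FD] by blast
  define \<phi> where "\<phi> n = type_cond B D f (F n) (G n) n" for n
  have "\<exists>g. \<forall>m\<le>n. eventually (\<lambda>i. \<phi> m i (\<lambda>d. g d i)) U" for n
  proof -
    let ?C = "(F n \<union> (\<Union>m\<le>n. G m)) - D"
    obtain g where g: "\<forall>d\<in>D. g d = f d" "up.partial_iso g (D \<union> ?C)" "up.strong (g ` (D \<union> ?C)) (pow B)"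
      using extend_finite[OF ppM assms(2-8), of ?C] Ffin Gfin FD GD DM by blast
    let ?E = "D \<union> ?C"
    have EM: "?E \<subseteq> M" using FD GD DM assms(9) by blast
    have gB: "g d \<in> pow B" if "d \<in> ?E" for d using g(3) that unfolding up.strong_def by blast
    have grep: "rep (g d) = g d" if "d \<in> ?E" for d using gB[OF that] by (rule pow_rep)
    have "eventually (\<lambda>i. \<phi> m i (\<lambda>d. g d i)) U" if "m \<le> n" for m
    proof -
      have FE: "F m \<subseteq> ?E" and GE: "G m \<subseteq> ?E" using Fmono[OF that] that by auto
      have 1: "(\<forall>d\<in>F m. rep (g d) \<in> pow B \<and> us (rep (g d)) = us d \<and> (d \<in> D \<longrightarrow> rep (g d) = rep (f d)))"
      proof
        fix d assume "d \<in> F m"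
        then have "d \<in> ?E" using FE by blast
        then have "us (g d) = us d" using g(2) unfolding up.partial_iso_def by blast
        then show "rep (g d) \<in> pow B \<and> us (rep (g d)) = us d \<and> (d \<in> D \<longrightarrow> rep (g d) = rep (f d))"
          using grep[OF \<open>d \<in> ?E\<close>] gB[OF \<open>d \<in> ?E\<close>] g(1) by simp
      qed
      have 2: "(\<forall>d\<in>F m. \<forall>e\<in>F m. (rep (g d) = rep (g e) \<longleftrightarrow> d = e) \<and> (uadj (rep (g d)) (rep (g e)) \<longleftrightarrow> uadj d e))"
      proof (intro ballI)
        fix d e assume "d \<in> F m" "e \<in> F m"
        then have "d \<in> ?E" "e \<in> ?E" using FE by blast+
        then show "(rep (g d) = rep (g e) \<longleftrightarrow> d = e) \<and> (uadj (rep (g d)) (rep (g e)) \<longleftrightarrow> uadj d e)"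
          using g(2) grep[OF \<open>d \<in> ?E\<close>] grep[OF \<open>e \<in> ?E\<close>] unfolding up.partial_iso_def inj_on_def by metis
      qed
      have im: "(\<lambda>d. rep (g d)) ` S = g ` S" if "S \<subseteq> ?E" for S
        by (intro image_cong refl grep) (rule subsetD[OF that])
      \<comment> \<open>The image of \<open>?E\<close> is strong and so contains \<open>X\<close>;
        pulling \<open>X\<close> back along \<open>g\<close> gives an obstruction over
        \<open>F m\<close>, which \<open>G m\<close> collects.\<close>
      have 3: "X \<subseteq> (\<lambda>d. rep (g d)) ` G m"
        if X: "X \<subseteq> pow B" "up.obstruction ((\<lambda>d. rep (g d)) ` F m) X" "card X \<le> m" for X
      proof -
        have o: "up.obstruction (g ` F m) X" using X(2) unfolding im[OF FE] .
        have "X \<subseteq> g ` ?E" using up.strong_obstruction_subset[OF g(3) image_mono[OF FE] o X(1)] .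
        then obtain Y where Y: "Y \<subseteq> ?E" "X = g ` Y" by (meson subset_imageE)
        then have "up.obstruction (F m) Y" using up.partial_iso_obstruction[OF g(2) FE Y(1)] o by simp
        moreover have "card Y \<le> m"
          using X(3) card_image[of g Y] Y g(2) inj_on_subset unfolding up.partial_iso_def by metis
        ultimately have "Y \<subseteq> G m" using Y(1) EM unfolding G_def by blast
        then show ?thesis unfolding im[OF GE] Y(2) by (rule image_mono)
      qed
      show ?thesis
        using type_cond_diagram[OF Ffin[of m], of g B D f] 1 2
          type_cond_obstruction[OF Ffin[of m] Gfin[of m], of B g m] 3
        unfolding \<phi>_def type_cond_def by (simp only: eventually_conj_iff simp_thms conj_assoc)
    qed
    then show ?thesis by blast
  qed
  from countable_saturation[OF U_le this] obtain h
    where h: "\<And>n. eventually (\<lambda>i. \<phi> n i (\<lambda>d. h d i)) U" by blast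
  define g where "g d = rep (h d)" for d
  have dia: "(\<forall>d\<in>F n. g d \<in> pow B \<and> us (g d) = us d \<and> (d \<in> D \<longrightarrow> g d = rep (f d))) \<and>
      (\<forall>d\<in>F n. \<forall>e\<in>F n. (g d = g e \<longleftrightarrow> d = e) \<and> (uadj (g d) (g e) \<longleftrightarrow> uadj d e))" for n
    unfolding g_def type_cond_diagram[OF Ffin, symmetric]
    using h[of n] unfolding \<phi>_def type_cond_def by (rule eventually_mono) blast
  have pt: "g d \<in> pow B \<and> us (g d) = us d \<and> (d \<in> D \<longrightarrow> g d = f d)" if d: "d \<in> D'" for d
  proof -
    obtain n where "d \<in> F n" using Fex[of "{d}" 0] d by auto
    moreover have "rep (f d) = f d" if "d \<in> D" using fB that pow_rep by blast
    ultimately show ?thesis using dia[of n] by auto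
  qed
  have pr: "(g d = g e \<longleftrightarrow> d = e) \<and> (uadj (g d) (g e) \<longleftrightarrow> uadj d e)" if "d \<in> D'" "e \<in> D'" for d e
  proof -
    obtain n where "d \<in> F n" "e \<in> F n" using Fex[of "{d, e}" 0] \<open>d \<in> D'\<close> \<open>e \<in> D'\<close> by auto
    then show ?thesis using dia[of n] by blast
  qed
  have "up.partial_iso g D'" unfolding up.partial_iso_def inj_on_def using pt pr by blast
  moreover have "up.strong (g ` D') (pow B)"
    unfolding up.strong_def
  proof (intro conjI allI impI notI)
    show "g ` D' \<subseteq> pow B" using pt by blast
    fix X assume X: "X \<subseteq> pow B" "up.obstruction (g ` D') X"
    have fX: "finite X" "X \<noteq> {}" "X \<inter> g ` D' = {}" using X(2) unfolding up.obstruction_def by auto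
    obtain F0 where F0: "finite F0" "F0 \<subseteq> g ` D'" "up.obstruction F0 X" using up.obstruction_finite_base[OF X(2)] .
    obtain K where K: "K \<subseteq> D'" "finite K" "F0 = g ` K" using finite_subset_image[OF F0(1,2)] by blast
    obtain n where n: "card X \<le> n" "K \<subseteq> F n" using Fex[OF K(2,1)] by blast
    have "X - g ` F n = X" using fX(3) FD[of n] by blast
    then have o: "up.obstruction (g ` F n) X"
      using up.obstruction_remove[OF F0(3), of "g ` F n"] n(2) K(3) fX(2) by auto
    have gF: "g ` F n \<subseteq> pow B" using pt FD[of n] by blast
    obtain x where x: "x \<in> X" using fX(2) by blast
    have "eventually (\<lambda>i. \<forall>d\<in>F n. g d i = h d i) U"
      unfolding g_def using Ffin by (intro eventually_ball_finite) (auto intro: rep_eq)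
    with h[of n] obstruction_coordinates[OF o finite_imageI[OF Ffin] gF X(1)] image_coordinates[OF fX(1) X(1)]
    have "eventually (\<lambda>i. \<exists>d\<in>G n. x i = h d i) U"
    proof eventually_elim
      case (elim i)
      have "(\<lambda>x. x i) ` g ` F n = (\<lambda>d. h d i) ` F n"
        unfolding image_image using elim(4) by (intro image_cong) auto
      then have "obstruction ((\<lambda>d. h d i) ` F n) ((\<lambda>x. x i) ` X)" using elim(2) by simp
      moreover have "card ((\<lambda>x. x i) ` X) \<le> n" using card_image_le[OF fX(1)] n(1) by (rule le_trans)
      ultimately have "(\<lambda>x. x i) ` X \<subseteq> (\<lambda>d. h d i) ` G n"
        using elim(1,3) unfolding \<phi>_def type_cond_def by blast
      then show ?case using x by blast
    qed
    then obtain d where d: "d \<in> G n" "eventually (\<lambda>i. x i = h d i) U"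
      unfolding ultra_bex_finite[OF ultra Gfin] by blast
    then have "rep x = g d" unfolding g_def rep_eq_iff by simp
    then have "x = g d" using pow_rep x X(1) by auto
    then show False using fX(3) x d(1) GD[of n] by blast
  qed
  ultimately show ?thesis using pt assms(9) by blast
qed

section \<open>Back and forth between the ultrapowers\<close>

lemma forth_step:
  assumes "open_pplane A" "open_pplane B" "countable D" "up.strong D (pow A)" "up.strong (f ` D) (pow B)" "up.partial_iso f D"
    and "\<exists>d\<in>D. us d" "\<exists>d\<in>D. \<not> us d" "v \<in> pow A"
  obtains D' g where "D \<subseteq> D'" "v \<in> D'" "countable D'" "up.strong D' (pow A)" "up.partial_iso g D'"
    "up.strong (g ` D') (pow B)" "\<forall>d\<in>D. g d = f d"
proof -
  have M: "up.open_pplane (pow A)" "up.strong {} (pow A)"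
    using pow_open_pplane[OF assms(1)] unfolding up.open_pplane_def by auto
  have DA: "insert v D \<subseteq> pow A" using assms(4,9) unfolding up.strong_def by blast
  have cD: "countable (insert v D)" using assms(3) by simp
  obtain D' where D': "insert v D \<subseteq> D'" "countable D'" "up.strong D' (pow A)"
    using up.countable_strong_hull[OF M(2) cD DA] by blast
  obtain g where "\<forall>d\<in>D. g d = f d" "up.partial_iso g D'" "up.strong (g ` D') (pow B)"
    using extend_countable[OF M(1) assms(4,2,3,5-8) _ D'(2,3)] D'(1) by blast
  then show thesis using that D' by blast
qed

text \<open>The forth step for the inverse map with the planes exchanged, inverted again.\<close>

lemma back_step:
  assumes "open_pplane A" "open_pplane B" "countable D" "up.strong D (pow A)" "up.strong (f ` D) (pow B)" "up.partial_iso f D"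
    and "\<exists>d\<in>D. us d" "\<exists>d\<in>D. \<not> us d" "w \<in> pow B"
  obtains D' g v where "D \<subseteq> D'" "v \<in> D'" "g v = w" "countable D'" "up.strong D' (pow A)" "up.partial_iso g D'"
    "up.strong (g ` D') (pow B)" "\<forall>d\<in>D. g d = f d"
proof -
  let ?f = "inv_into D f"
  have inj: "inj_on f D" and sf: "\<And>d. d \<in> D \<Longrightarrow> us (f d) = us d" using assms(6) unfolding up.partial_iso_def by auto
  have f1: "?f ` f ` D = D" using inv_into_image_cancel[OF inj] by simp
  have iso: "up.partial_iso ?f (f ` D)" by (rule up.partial_iso_inv[OF assms(6)])
  have "\<exists>e\<in>f ` D. us e" "\<exists>e\<in>f ` D. \<not> us e" using assms(7,8) sf by auto
  then obtain E g where E: "f ` D \<subseteq> E" "w \<in> E" "countable E" "up.strong E (pow B)" "up.partial_iso g E"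
    "up.strong (g ` E) (pow A)" "\<forall>d\<in>f ` D. g d = ?f d"
    using forth_step[OF assms(2,1) _ assms(5) _ iso _ _ assms(9)] assms(3,4) f1
    by (metis countable_image)
  have injg: "inj_on g E" using E(5) unfolding up.partial_iso_def by blast
  have g1: "inv_into E g ` g ` E = E" using inv_into_image_cancel[OF injg] by simp
  have gf: "g (f d) = d" if "d \<in> D" for d using E(7) that inv_into_f_f[OF inj that] by simp
  have "inv_into E g d = f d" if "d \<in> D" for d
    using inv_into_f_f[OF injg, of "f d"] gf[OF that] E(1) that by auto
  moreover have "D \<subseteq> g ` E"
  proof
    fix d assume "d \<in> D"
    then show "d \<in> g ` E" using gf E(1) by (intro image_eqI[of _ _ "f d"]) auto
  qed
  moreover have "inv_into E g (g w) = w" by (rule inv_into_f_f[OF injg E(2)])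
  ultimately show thesis
    using that[of "g ` E" "g w" "inv_into E g"] E(2,3,4,6) up.partial_iso_inv[OF E(5)] g1 by simp
qed

lemma back_and_forth:
  assumes "open_pplane A" "open_pplane B" "countable D" "up.strong D (pow A)" "up.strong (f ` D) (pow B)" "up.partial_iso f D"
    and "\<exists>d\<in>D. us d" "\<exists>d\<in>D. \<not> us d" "range \<rho> \<subseteq> D"
  shows "up.gsat (pow A) \<rho> \<phi> \<longleftrightarrow> up.gsat (pow B) (\<lambda>x. f (\<rho> x)) \<phi>"
  using assms(3-9)
proof (induction \<phi> arbitrary: D f \<rho>)
  case (EqPoint i j)
  have "\<rho> (Inl i) \<in> D" "\<rho> (Inl j) \<in> D" using EqPoint by auto
  then show ?case using EqPoint.prems(4) by (auto simp: up.partial_iso_def inj_on_def)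
next
  case (EqLine i j)
  have "\<rho> (Inr i) \<in> D" "\<rho> (Inr j) \<in> D" using EqLine by auto
  then show ?case using EqLine.prems(4) by (auto simp: up.partial_iso_def inj_on_def)
next
  case (Inc i j)
  have "\<rho> (Inl i) \<in> D" "\<rho> (Inr j) \<in> D" using Inc by auto
  then show ?case using Inc.prems(4) by (auto simp: up.partial_iso_def)
next
  case (Neg \<phi>)
  then show ?case by simp
next
  case (Conj \<phi> \<psi>)
  then show ?case by simp
next
  case (ExPoint j \<phi>)
  have step: "up.gsat (pow A) (\<rho>(Inl j := v)) \<phi> \<longleftrightarrow> up.gsat (pow B) ((\<lambda>x. f (\<rho> x))(Inl j := g v)) \<phi>"
    and srt: "us (g v) = us v"
    if "D \<subseteq> D'" "v \<in> D'" "countable D'" "up.strong D' (pow A)" "up.partial_iso g D'"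
      "up.strong (g ` D') (pow B)" "\<forall>d\<in>D. g d = f d" for D' g v
  proof -
    have "\<exists>d\<in>D'. us d" "\<exists>d\<in>D'. \<not> us d" "range (\<rho>(Inl j := v)) \<subseteq> D'" using ExPoint.prems(5-7) that(1,2) by auto
    moreover have "(\<lambda>x. g ((\<rho>(Inl j := v)) x)) = (\<lambda>x. f (\<rho> x))(Inl j := g v)"
    proof
      fix x
      have "\<rho> x \<in> D" using ExPoint.prems(7) by auto
      then show "g ((\<rho>(Inl j := v)) x) = ((\<lambda>x. f (\<rho> x))(Inl j := g v)) x" using that(7) by simp
    qed
    ultimately show "up.gsat (pow A) (\<rho>(Inl j := v)) \<phi> \<longleftrightarrow> up.gsat (pow B) ((\<lambda>x. f (\<rho> x))(Inl j := g v)) \<phi>"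
      using ExPoint.IH[OF that(3,4,6,5)] by metis
    show "us (g v) = us v" using that unfolding up.partial_iso_def by blast
  qed
  show ?case
  proof
    assume "up.gsat (pow A) \<rho> (ExPoint j \<phi>)"
    then obtain v where v: "v \<in> pow A" "us v" "up.gsat (pow A) (\<rho>(Inl j := v)) \<phi>" by auto
    obtain D' g where D': "D \<subseteq> D'" "v \<in> D'" "countable D'" "up.strong D' (pow A)" "up.partial_iso g D'"
      "up.strong (g ` D') (pow B)" "\<forall>d\<in>D. g d = f d" using forth_step[OF assms(1,2) ExPoint.prems(1-6) v(1)] .
    have "g v \<in> pow B" using D' unfolding up.strong_def by blast
    then show "up.gsat (pow B) (\<lambda>x. f (\<rho> x)) (ExPoint j \<phi>)" using step[OF D'] srt[OF D'] v by auto
  next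
    assume "up.gsat (pow B) (\<lambda>x. f (\<rho> x)) (ExPoint j \<phi>)"
    then obtain w where w: "w \<in> pow B" "us w" "up.gsat (pow B) ((\<lambda>x. f (\<rho> x))(Inl j := w)) \<phi>" by auto
    obtain D' g v where D': "D \<subseteq> D'" "v \<in> D'" "g v = w" "countable D'" "up.strong D' (pow A)" "up.partial_iso g D'"
      "up.strong (g ` D') (pow B)" "\<forall>d\<in>D. g d = f d" using back_step[OF assms(1,2) ExPoint.prems(1-6) w(1)] .
    have "v \<in> pow A" using D' unfolding up.strong_def by blast
    then show "up.gsat (pow A) \<rho> (ExPoint j \<phi>)"
      using step[OF D'(1,2,4-8)] srt[OF D'(1,2,4-8)] w D'(3) by auto
  qed
next
  case (ExLine j \<phi>)
  have step: "up.gsat (pow A) (\<rho>(Inr j := v)) \<phi> \<longleftrightarrow> up.gsat (pow B) ((\<lambda>x. f (\<rho> x))(Inr j := g v)) \<phi>"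
    and srt: "us (g v) = us v"
    if "D \<subseteq> D'" "v \<in> D'" "countable D'" "up.strong D' (pow A)" "up.partial_iso g D'"
      "up.strong (g ` D') (pow B)" "\<forall>d\<in>D. g d = f d" for D' g v
  proof -
    have "\<exists>d\<in>D'. us d" "\<exists>d\<in>D'. \<not> us d" "range (\<rho>(Inr j := v)) \<subseteq> D'" using ExLine.prems(5-7) that(1,2) by auto
    moreover have "(\<lambda>x. g ((\<rho>(Inr j := v)) x)) = (\<lambda>x. f (\<rho> x))(Inr j := g v)"
    proof
      fix x
      have "\<rho> x \<in> D" using ExLine.prems(7) by auto
      then show "g ((\<rho>(Inr j := v)) x) = ((\<lambda>x. f (\<rho> x))(Inr j := g v)) x" using that(7) by simp
    qed
    ultimately show "up.gsat (pow A) (\<rho>(Inr j := v)) \<phi> \<longleftrightarrow> up.gsat (pow B) ((\<lambda>x. f (\<rho> x))(Inr j := g v)) \<phi>"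
      using ExLine.IH[OF that(3,4,6,5)] by metis
    show "us (g v) = us v" using that unfolding up.partial_iso_def by blast
  qed
  show ?case
  proof
    assume "up.gsat (pow A) \<rho> (ExLine j \<phi>)"
    then obtain v where v: "v \<in> pow A" "\<not> us v" "up.gsat (pow A) (\<rho>(Inr j := v)) \<phi>" by auto
    obtain D' g where D': "D \<subseteq> D'" "v \<in> D'" "countable D'" "up.strong D' (pow A)" "up.partial_iso g D'"
      "up.strong (g ` D') (pow B)" "\<forall>d\<in>D. g d = f d" using forth_step[OF assms(1,2) ExLine.prems(1-6) v(1)] .
    have "g v \<in> pow B" using D' unfolding up.strong_def by blast
    then show "up.gsat (pow B) (\<lambda>x. f (\<rho> x)) (ExLine j \<phi>)" using step[OF D'] srt[OF D'] v by auto
  next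
    assume "up.gsat (pow B) (\<lambda>x. f (\<rho> x)) (ExLine j \<phi>)"
    then obtain w where w: "w \<in> pow B" "\<not> us w" "up.gsat (pow B) ((\<lambda>x. f (\<rho> x))(Inr j := w)) \<phi>" by auto
    obtain D' g v where D': "D \<subseteq> D'" "v \<in> D'" "g v = w" "countable D'" "up.strong D' (pow A)" "up.partial_iso g D'"
      "up.strong (g ` D') (pow B)" "\<forall>d\<in>D. g d = f d" using back_step[OF assms(1,2) ExLine.prems(1-6) w(1)] .
    have "v \<in> pow A" using D' unfolding up.strong_def by blast
    then show "up.gsat (pow A) \<rho> (ExLine j \<phi>)"
      using step[OF D'(1,2,4-8)] srt[OF D'(1,2,4-8)] w D'(3) by auto
  qed
qed

text \<open>The range of a constant assignment is countable and has a countable strong hull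
  \<open>D\<close> in \<open>pow A\<close>. By \<open>pow_strong\<close> and transitivity
  \<open>D\<close> is strong in \<open>pow B\<close> as well, so the identity on \<open>D\<close>
  starts the back-and-forth; Los's theorem returns to \<open>A\<close> and \<open>B\<close>.\<close>

lemma strong_imp_gsat_iff:
  assumes "open_pplane A" "open_pplane B" "strong A B" "range \<rho> \<subseteq> A" "\<And>i. s (\<rho> (Inl i))" "\<And>j. \<not> s (\<rho> (Inr j))"
  shows "gsat A \<rho> \<phi> \<longleftrightarrow> gsat B \<rho> \<phi>"
proof -
  define \<sigma> where "\<sigma> n = rep (\<lambda>i. \<rho> n)" for n
  have los: "up.gsat (pow V) \<sigma> \<phi> \<longleftrightarrow> gsat V \<rho> \<phi>" for V
    unfolding \<sigma>_def using Los[of V "\<lambda>n i. \<rho> n" \<phi>] ultra_const[OF ultra] by simp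
  have r: "range \<sigma> \<subseteq> pow A" unfolding \<sigma>_def using assms(4) by (auto simp: rep_in_pow)
  have M: "up.strong {} (pow A)" using pow_open_pplane[OF assms(1)] unfolding up.open_pplane_def by auto
  obtain D where D: "range \<sigma> \<subseteq> D" "countable D" "up.strong D (pow A)"
    using up.countable_strong_hull[OF M _ r] by auto
  have "up.strong ((\<lambda>x. x) ` D) (pow B)" using up.strong_trans[OF D(3) pow_strong[OF assms(3)]] by simp
  moreover have "us (\<sigma> (Inl 0))" "\<not> us (\<sigma> (Inr 0))"
    unfolding \<sigma>_def us_rep unfolding us_def using assms(5,6) ultra_const[OF ultra] by auto
  ultimately have "up.gsat (pow A) \<sigma> \<phi> \<longleftrightarrow> up.gsat (pow B) \<sigma> \<phi>"
    using back_and_forth[OF assms(1,2) D(2,3) _ up.partial_iso_id _ _ D(1)] D(1) by blast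
  then show ?thesis unfolding los .
qed

end

context bipartite_graph begin

section \<open>Thickness of non-degenerate planes\<close>

lemma deg_ge3_nbrs: "deg_ge3 V x \<longleftrightarrow> (\<exists>a\<in>nbrs V x. \<exists>b\<in>nbrs V x. \<exists>c\<in>nbrs V x. a \<noteq> b \<and> a \<noteq> c \<and> b \<noteq> c)"
  unfolding deg_ge3_def nbrs_def by auto

lemma deg_ge3_perspectivity:
  assumes "pplane V" "l \<in> V" "p \<in> V" "s l \<noteq> s p" "\<not> adj l p" "deg_ge3 V p"
  shows "deg_ge3 V l"
proof -
  obtain f where f: "inj_on f (nbrs V p)" "f ` nbrs V p \<subseteq> nbrs V l" using nbrs_injection[OF assms(1-5)] by blast
  obtain a b c where "a \<in> nbrs V p" "b \<in> nbrs V p" "c \<in> nbrs V p" "a \<noteq> b" "a \<noteq> c" "b \<noteq> c"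
    using assms(6) unfolding deg_ge3_nbrs by blast
  then have "f a \<in> nbrs V l" "f b \<in> nbrs V l" "f c \<in> nbrs V l" "f a \<noteq> f b" "f a \<noteq> f c" "f b \<noteq> f c"
    using f unfolding inj_on_def by blast+
  then show ?thesis unfolding deg_ge3_nbrs by blast
qed

text \<open>A vertex of the quadrangle lies on three of its sides. Every line misses some vertex and
  inherits three points by perspectivity from it; every point misses some line and inherits three
  lines likewise.\<close>

lemma quadrangle_imp_thick:
  assumes "pplane V" "T \<subseteq> V" "card T = 4" "\<And>x. x \<in> T \<Longrightarrow> s x" "\<And>l. l \<in> V \<Longrightarrow> \<not> deg_ge3 T l"
  shows "thick V"
proof -
  obtain a b c d where T: "T = {a, b, c, d}" "a \<noteq> b" "a \<noteq> c" "a \<noteq> d" "b \<noteq> c" "b \<noteq> d" "c \<noteq> d"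
    using assms(3) by (auto simp: card_Suc_eq numeral_eq_Suc)
  have J: "join V x y \<in> V \<and> adj (join V x y) x \<and> adj (join V x y) y" if "x \<in> T" "y \<in> T" "x \<noteq> y" for x y
    using join[OF assms(1), of x y] that assms(2,4) by blast
  have no3: "\<not> (adj l x \<and> adj l y \<and> adj l z)" if "l \<in> V" "x \<in> T" "y \<in> T" "z \<in> T" "x \<noteq> y" "x \<noteq> z" "y \<noteq> z" for l x y z
    using assms(5)[OF that(1)] deg_ge3I[OF that(2-7)] by blast
  have quad: "deg_ge3 V x" if "{x, y, z, w} = T" "x \<noteq> y" "x \<noteq> z" "x \<noteq> w" "y \<noteq> z" "y \<noteq> w" "z \<noteq> w" for x y z w
  proof -
    have m: "x \<in> T" "y \<in> T" "z \<in> T" "w \<in> T" using that(1) by auto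
    note jy = J[OF m(1,2) that(2)] and jz = J[OF m(1,3) that(3)] and jw = J[OF m(1,4) that(4)]
    have "join V x y \<noteq> join V x z" using no3[of "join V x y" x y z] jy jz m that by auto
    moreover have "join V x y \<noteq> join V x w" using no3[of "join V x y" x y w] jy jw m that by auto
    moreover have "join V x z \<noteq> join V x w" using no3[of "join V x z" x z w] jz jw m that by auto
    ultimately show ?thesis using jy jz jw adj_sym
      by (intro deg_ge3I[of "join V x y" V "join V x z" "join V x w" x]) blast+
  qed
  have lines: "deg_ge3 V l" if "l \<in> V" "\<not> s l" for l
  proof -
    have "\<not> (adj l a \<and> adj l b \<and> adj l c)" using no3[of l a b c] that T by auto
    then obtain x y z w where x: "{x, y, z, w} = T" "x \<noteq> y" "x \<noteq> z" "x \<noteq> w" "y \<noteq> z" "y \<noteq> w" "z \<noteq> w" "\<not> adj l x"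
    proof -
      assume th: "\<And>x y z w. {x, y, z, w} = T \<Longrightarrow> x \<noteq> y \<Longrightarrow> x \<noteq> z \<Longrightarrow> x \<noteq> w \<Longrightarrow> y \<noteq> z \<Longrightarrow> y \<noteq> w \<Longrightarrow> z \<noteq> w \<Longrightarrow> \<not> adj l x \<Longrightarrow> thesis"
      consider "\<not> adj l a" | "\<not> adj l b" | "\<not> adj l c" using \<open>\<not> (adj l a \<and> adj l b \<and> adj l c)\<close> by blast
      then show thesis
      proof cases
        case 1
        show thesis by (rule th[of a b c d]) (use T 1 in auto)
      next
        case 2
        show thesis by (rule th[of b a c d]) (use T 2 in auto)
      next
        case 3
        show thesis by (rule th[of c a b d]) (use T 3 in auto)
      qed
    qed
    have "x \<in> T" using x(1) by auto
    then show ?thesis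
      using deg_ge3_perspectivity[OF assms(1) that(1), of x] quad[OF x(1-7)] x(8) assms(2,4) that(2) by blast
  qed
  have "deg_ge3 V x" if "x \<in> V" for x
  proof (cases "s x")
    case False
    then show ?thesis using lines that by blast
  next
    case True
    have m: "a \<in> T" "b \<in> T" "c \<in> T" using T by auto
    note ab = J[OF m(1,2) T(2)] and ac = J[OF m(1,3) T(3)] and bc = J[OF m(2,3) T(5)]
    \<comment> \<open>One of the three sides of the triangle \<open>a, b, c\<close> misses
      \<open>x\<close>, for these sides have no common point.\<close>
    have "\<exists>l\<in>V. \<not> s l \<and> \<not> adj l x"
    proof (rule ccontr)
      assume n: "\<not> ?thesis"
      have ns: "\<not> s (join V a b)" "\<not> s (join V a c)" "\<not> s (join V b c)"
        using adj_sort ab ac bc assms(4) m by blast+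
      then have adj: "adj (join V a b) x" "adj (join V a c) x" "adj (join V b c) x" using n ab ac bc by blast+
      show False
      proof (cases "x = a")
        case True
        then show ?thesis using no3[of "join V b c" a b c] adj(3) bc m T by blast
      next
        case False
        then have "join V a b = join V a c"
          using adj_unique[OF assms(1), of x a "join V a b" "join V a c"] adj ab ac that m assms(2) by blast
        then show ?thesis using no3[of "join V a b" a b c] ab ac m T by metis
      qed
    qed
    then obtain l where l: "l \<in> V" "\<not> s l" "\<not> adj l x" by blast
    then show ?thesis
      using deg_ge3_perspectivity[OF assms(1) that l(1)] lines[OF l(1,2)] True adj_sym by blast
  qed
  moreover have "V \<noteq> {}" using T assms(2) by blast
  ultimately show ?thesis unfolding thick_def by blast
qed

section \<open>Elementary substructures are strong\<close>

lemma gsat_conj: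
  assumes "finite \<Phi>"
  shows "\<exists>\<psi>. \<forall>V \<rho>. gsat V \<rho> \<psi> \<longleftrightarrow> (\<forall>\<phi>\<in>\<Phi>. gsat V \<rho> \<phi>)"
  using assms
proof (induction \<Phi>)
  case empty
  show ?case by (intro exI[of _ "EqPoint 0 0"]) simp
next
  case (insert \<phi> \<Phi>)
  then obtain \<psi> where "\<forall>V \<rho>. gsat V \<rho> \<psi> \<longleftrightarrow> (\<forall>\<phi>\<in>\<Phi>. gsat V \<rho> \<phi>)" by blast
  then show ?case by (intro exI[of _ "Conj \<phi> \<psi>"]) simp
qed

lemma gsat_ex:
  assumes "finite I"
  shows "\<exists>\<psi>. \<forall>V \<rho>. gsat V \<rho> \<psi> \<longleftrightarrow>
    (\<exists>\<rho>'. (\<forall>n. n \<notin> I \<longrightarrow> \<rho>' n = \<rho> n) \<and> (\<forall>n\<in>I. \<rho>' n \<in> V \<and> (s (\<rho>' n) \<longleftrightarrow> isl n)) \<and> gsat V \<rho>' \<phi>)"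
  using assms
proof (induction I)
  case empty
  have "\<rho>' = \<rho>" if "\<forall>n. n \<notin> {} \<longrightarrow> \<rho>' n = \<rho> n" for \<rho>' \<rho> :: "nat + nat \<Rightarrow> 'v" using that by auto
  then show ?case by (intro exI[of _ \<phi>]) auto
next
  case (insert n I)
  then obtain \<psi> where \<psi>: "\<And>V \<rho>. gsat V \<rho> \<psi> \<longleftrightarrow>
    (\<exists>\<rho>'. (\<forall>n. n \<notin> I \<longrightarrow> \<rho>' n = \<rho> n) \<and> (\<forall>n\<in>I. \<rho>' n \<in> V \<and> (s (\<rho>' n) \<longleftrightarrow> isl n)) \<and> gsat V \<rho>' \<phi>)" by blast
  define \<chi> where "\<chi> = (case n of Inl i \<Rightarrow> ExPoint i \<psi> | Inr j \<Rightarrow> ExLine j \<psi>)"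
  have \<chi>: "gsat V \<rho> \<chi> \<longleftrightarrow> (\<exists>v\<in>V. (s v \<longleftrightarrow> isl n) \<and> gsat V (\<rho>(n := v)) \<psi>)" for V \<rho>
    unfolding \<chi>_def by (cases n) auto
  have "gsat V \<rho> \<chi> \<longleftrightarrow> (\<exists>\<rho>'. (\<forall>m. m \<notin> insert n I \<longrightarrow> \<rho>' m = \<rho> m) \<and>
      (\<forall>n\<in>insert n I. \<rho>' n \<in> V \<and> (s (\<rho>' n) \<longleftrightarrow> isl n)) \<and> gsat V \<rho>' \<phi>)" (is "?L \<longleftrightarrow> ?R") for V \<rho>
  proof
    assume ?L
    then obtain v \<rho>' where v: "v \<in> V" "s v \<longleftrightarrow> isl n" "\<forall>m. m \<notin> I \<longrightarrow> \<rho>' m = (\<rho>(n := v)) m"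
      "\<forall>n\<in>I. \<rho>' n \<in> V \<and> (s (\<rho>' n) \<longleftrightarrow> isl n)" "gsat V \<rho>' \<phi>" unfolding \<chi> \<psi> by blast
    have "\<rho>' n = v" using v(3) insert.hyps by simp
    then show ?R using v by (intro exI[of _ \<rho>']) auto
  next
    assume ?R
    then obtain \<rho>' where r: "\<forall>m. m \<notin> insert n I \<longrightarrow> \<rho>' m = \<rho> m"
      "\<forall>n\<in>insert n I. \<rho>' n \<in> V \<and> (s (\<rho>' n) \<longleftrightarrow> isl n)" "gsat V \<rho>' \<phi>" by blast
    then have "gsat V (\<rho>(n := \<rho>' n)) \<psi>" unfolding \<psi> by (intro exI[of _ \<rho>']) auto
    then show ?L unfolding \<chi> using r(2) by blast
  qed
  then show ?case by blast
qed

text \<open>An existential formula with parameters from \<open>S\<close> describes the distinctness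
  and adjacencies of \<open>X \<union> S\<close>; it holds in \<open>B\<close>, hence in
  \<open>A\<close>. Preserving adjacency is all that is asked of the copy, because lower bounds on
  degrees are positive conditions.\<close>

lemma elementary_copy:
  assumes elem: "\<And>\<phi> \<rho>. range \<rho> \<subseteq> A \<Longrightarrow> (\<And>n. s (\<rho> n) \<longleftrightarrow> isl n) \<Longrightarrow> gsat B \<rho> \<phi> \<Longrightarrow> gsat A \<rho> \<phi>"
    and "p0 \<in> A" "s p0" "l0 \<in> A" "\<not> s l0"
    and "finite X" "X \<subseteq> B" "X \<inter> A = {}" "finite S" "S \<subseteq> A"
  obtains h where "\<forall>y\<in>S. h y = y" "h ` X \<subseteq> A" "inj_on h (X \<union> S)"
    "\<forall>x\<in>X \<union> S. \<forall>y\<in>X \<union> S. adj x y \<longrightarrow> adj (h x) (h y)"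
proof -
  let ?K = "X \<union> S"
  have fK: "finite ?K" using assms by simp
  obtain idx :: "'v \<Rightarrow> nat" where idx: "inj_on idx ?K" using finite_imp_inj_to_nat_seg[OF fK] by blast
  define var where "var x = (if s x then Inl (idx x) else Inr (idx x))" for x
  have isl_var: "isl (var x) \<longleftrightarrow> s x" for x unfolding var_def by simp
  have inj: "inj_on var ?K" using idx unfolding inj_on_def var_def by (metis Inl_inject Inr_inject Inl_Inr_False)
  define lit where "lit x y = (if s x = s y then Neg (if s x then EqPoint (idx x) (idx y) else EqLine (idx x) (idx y))
      else if s x then Inc (idx x) (idx y) else Inc (idx y) (idx x))" for x y
  have lit: "gsat V \<rho> (lit x y) \<longleftrightarrow> (if s x = s y then \<rho> (var x) \<noteq> \<rho> (var y) else adj (\<rho> (var x)) (\<rho> (var y)))"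
    for V \<rho> x y unfolding lit_def var_def using adj_sym by auto
  define L where "L = {(x, y). x \<in> ?K \<and> y \<in> ?K \<and> (s x = s y \<and> x \<noteq> y \<or> adj x y)}"
  have "L \<subseteq> ?K \<times> ?K" unfolding L_def by auto
  then have fL: "finite ((\<lambda>(x, y). lit x y) ` L)" using fK by (meson finite_SigmaI finite_imageI finite_subset)
  obtain \<psi> where \<psi>: "\<And>V \<rho>. gsat V \<rho> \<psi> \<longleftrightarrow> (\<forall>\<phi>\<in>(\<lambda>(x, y). lit x y) ` L. gsat V \<rho> \<phi>)"
    using gsat_conj[OF fL] by blast
  obtain \<chi> where \<chi>0: "\<forall>V \<rho>. gsat V \<rho> \<chi> \<longleftrightarrow> (\<exists>\<rho>'. (\<forall>n. n \<notin> var ` X \<longrightarrow> \<rho>' n = \<rho> n) \<and>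
      (\<forall>n\<in>var ` X. \<rho>' n \<in> V \<and> (s (\<rho>' n) \<longleftrightarrow> isl n)) \<and> gsat V \<rho>' \<psi>)"
    using gsat_ex[OF finite_imageI[OF assms(6)], of var \<psi>] by (rule exE)
  note \<chi> = spec[OF spec[OF \<chi>0]]
  let ?i = "inv_into ?K var"
  have ivar: "?i (var x) = x" if "x \<in> ?K" for x using inv_into_f_f[OF inj that] .
  have disj: "var y \<notin> var ` X" if "y \<in> S" for y
  proof
    assume "var y \<in> var ` X"
    then obtain x where "x \<in> X" "var x = var y" by auto
    then have "x = y" using inj that unfolding inj_on_def by blast
    then show False using \<open>x \<in> X\<close> that assms(8,10) by blast
  qed
  \<comment> \<open>Assignments are total, so the remaining variables need values in
    \<open>A\<close> of the right sort.\<close>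
  define dflt where "dflt n = (if isl n then p0 else l0)" for n :: "nat + nat"
  define \<rho> where "\<rho> n = (if n \<in> var ` S then ?i n else dflt n)" for n
  define \<tau> where "\<tau> n = (if n \<in> var ` ?K then ?i n else dflt n)" for n
  have \<rho>: "\<rho> n \<in> A \<and> (s (\<rho> n) \<longleftrightarrow> isl n)" for n
  proof (cases "n \<in> var ` S")
    case True
    then obtain y where "y \<in> S" "n = var y" by auto
    then show ?thesis using ivar[of y] isl_var assms(10) unfolding \<rho>_def by auto
  qed (use assms in \<open>auto simp: \<rho>_def dflt_def\<close>)
  have \<rho>S: "\<rho> (var y) = y" if "y \<in> S" for y using that ivar[of y] unfolding \<rho>_def by simp
  have \<tau>K: "\<tau> (var y) = y" if "y \<in> ?K" for y using that ivar[of y] unfolding \<tau>_def by simp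
  have "gsat B \<rho> \<chi>"
    unfolding \<chi>
  proof (intro exI[of _ \<tau>] conjI allI impI ballI)
    fix n
    show "\<tau> n = \<rho> n" if "n \<notin> var ` X" using that unfolding \<tau>_def \<rho>_def by auto
    show "\<tau> n \<in> B" "s (\<tau> n) \<longleftrightarrow> isl n" if "n \<in> var ` X"
      using that \<tau>K isl_var assms(7) by auto
  next
    show "gsat B \<tau> \<psi>" unfolding \<psi>
    proof (intro ballI)
      fix \<phi> assume "\<phi> \<in> (\<lambda>(x, y). lit x y) ` L"
      then obtain x y where xy: "\<phi> = lit x y" "x \<in> ?K" "y \<in> ?K" "s x = s y \<and> x \<noteq> y \<or> adj x y"
        unfolding L_def by auto
      then show "gsat B \<tau> \<phi>"
        using \<tau>K[OF xy(2)] \<tau>K[OF xy(3)] adj_sort[of x y] unfolding xy(1) lit by auto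
    qed
  qed
  then have "gsat A \<rho> \<chi>" using elem[of \<rho>] \<rho> by blast
  then obtain \<sigma> where \<sigma>: "\<forall>n. n \<notin> var ` X \<longrightarrow> \<sigma> n = \<rho> n" "\<forall>n\<in>var ` X. \<sigma> n \<in> A \<and> (s (\<sigma> n) \<longleftrightarrow> isl n)"
    "gsat A \<sigma> \<psi>" unfolding \<chi> by blast
  have lits: "gsat A \<sigma> (lit x y)" if "x \<in> ?K" "y \<in> ?K" "s x = s y \<and> x \<noteq> y \<or> adj x y" for x y
  proof -
    have "(x, y) \<in> L" using that unfolding L_def by simp
    then have "lit x y \<in> (\<lambda>(x, y). lit x y) ` L" by force
    then show ?thesis using \<sigma>(3) unfolding \<psi> by blast
  qed
  define h where "h x = \<sigma> (var x)" for x
  have hS: "\<forall>y\<in>S. h y = y" using \<sigma>(1) disj \<rho>S unfolding h_def by simp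
  have sh: "s (h x) = s x" if "x \<in> ?K" for x
  proof (cases "x \<in> S")
    case False
    then have "var x \<in> var ` X" using that by blast
    then have "s (\<sigma> (var x)) \<longleftrightarrow> isl (var x)" using \<sigma>(2) by blast
    then show ?thesis unfolding h_def isl_var .
  qed (use hS in simp)
  show thesis
  proof (rule that[of h])
    show "h ` X \<subseteq> A" using \<sigma>(2) unfolding h_def by blast
    show "inj_on h ?K"
    proof (rule inj_onI, rule ccontr)
      fix x y assume xy: "x \<in> ?K" "y \<in> ?K" "h x = h y" "x \<noteq> y"
      then have "s x = s y" using sh by metis
      then have "h x \<noteq> h y" using lits[OF xy(1,2)] xy(4) unfolding lit h_def by simp
      then show False using xy(3) by simp
    qed
    show "\<forall>x\<in>?K. \<forall>y\<in>?K. adj x y \<longrightarrow> adj (h x) (h y)"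
    proof (intro ballI impI)
      fix x y assume "x \<in> ?K" "y \<in> ?K" "adj x y"
      then show "adj (h x) (h y)" using lits[of x y] adj_sort[of x y] unfolding lit h_def by simp
    qed
  qed (rule hS)
qed

lemma elementary_imp_strong:
  assumes elem: "\<And>\<phi> \<rho>. range \<rho> \<subseteq> A \<Longrightarrow> (\<And>n. s (\<rho> n) \<longleftrightarrow> isl n) \<Longrightarrow> gsat B \<rho> \<phi> \<Longrightarrow> gsat A \<rho> \<phi>"
    and "p0 \<in> A" "s p0" "l0 \<in> A" "\<not> s l0" "A \<subseteq> B" "strong {} A"
  shows "strong A B"
  unfolding strong_def
proof (intro conjI allI impI notI)
  show "A \<subseteq> B" by fact
  fix X assume X: "X \<subseteq> B" "obstruction A X"
  obtain F where F: "finite F" "F \<subseteq> A" "obstruction F X" using obstruction_finite_base[OF X(2)] .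
  define T where "T = {t\<in>F. \<exists>x\<in>X. adj t x}"
  have T: "finite T" "T \<subseteq> A" "obstruction T X" using F obstruction_attachment[OF F(3)] unfolding T_def by auto
  have fX: "finite X" "X \<noteq> {}" "X \<inter> A = {}" using X(2) unfolding obstruction_def by auto
  \<comment> \<open>The parameters \<open>S\<close> will include the earlier copies, so that the new
    copy is disjoint from them.\<close>
  have copy: "\<exists>Y\<subseteq>A. obstruction T Y \<and> Y \<inter> S = {} \<and> (\<forall>t\<in>T. \<exists>y\<in>Y. adj t y)" if S: "finite S" "S \<subseteq> A" "T \<subseteq> S" for S
  proof -
    obtain h where h: "\<forall>y\<in>S. h y = y" "h ` X \<subseteq> A" "inj_on h (X \<union> S)"
      "\<forall>x\<in>X \<union> S. \<forall>y\<in>X \<union> S. adj x y \<longrightarrow> adj (h x) (h y)"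
      using elementary_copy[OF elem assms(2-5) fX(1) X(1) fX(3) S(1,2)] by blast
    have hT: "h t = t" if "t \<in> T" for t using h(1) S(3) that by blast
    \<comment> \<open>Since \<open>h\<close> fixes \<open>S\<close> and is injective on
      \<open>X \<union> S\<close>, an element of \<open>X\<close> sent into \<open>S\<close> would
      already lie in \<open>S\<close>.\<close>
    have dis: "h ` X \<inter> S = {}"
    proof (rule ccontr)
      assume "h ` X \<inter> S \<noteq> {}"
      then obtain x where x: "x \<in> X" "h x \<in> S" by blast
      then have "h (h x) = h x" using h(1) by blast
      then have "h x = x" using inj_onD[OF h(3)] x by blast
      then show False using x S(2) fX(3) by auto
    qed
    have "deg_ge3 (h ` X \<union> T) (h x)" if x: "x \<in> X" for x
    proof -
      have "deg_ge3 (X \<union> T) x" using T(3) x unfolding obstruction_def by blast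
      then obtain a b c where abc: "a \<in> X \<union> T" "b \<in> X \<union> T" "c \<in> X \<union> T" "a \<noteq> b" "a \<noteq> c" "b \<noteq> c"
        "adj x a" "adj x b" "adj x c" by (rule deg_ge3E)
      have K: "X \<union> T \<subseteq> X \<union> S" using S(3) by blast
      have im: "h v \<in> h ` X \<union> T" if "v \<in> X \<union> T" for v using that hT by auto
      have ad: "adj (h x) (h v)" if "v \<in> X \<union> T" "adj x v" for v using h(4) x that K by blast
      have ne: "h u \<noteq> h v" if "u \<in> X \<union> T" "v \<in> X \<union> T" "u \<noteq> v" for u v
        using inj_onD[OF h(3)] that K by blast
      show ?thesis
        using im[OF abc(1)] im[OF abc(2)] im[OF abc(3)] ne[OF abc(1,2,4)] ne[OF abc(1,3,5)] ne[OF abc(2,3,6)]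
          ad[OF abc(1,7)] ad[OF abc(2,8)] ad[OF abc(3,9)] by (rule deg_ge3I)
    qed
    then have "obstruction T (h ` X)" using fX(1,2) dis S(3) unfolding obstruction_def by auto
    moreover have "\<exists>y\<in>h ` X. adj t y" if "t \<in> T" for t
    proof -
      obtain x where x: "x \<in> X" "adj t x" using \<open>t \<in> T\<close> unfolding T_def by blast
      then have "adj (h t) (h x)" using h(4) that S(3) by blast
      then show ?thesis using hT[OF that] x(1) by auto
    qed
    ultimately show ?thesis using h(2) dis by blast
  qed
  obtain Y1 where Y1: "Y1 \<subseteq> A" "obstruction T Y1" "\<forall>t\<in>T. \<exists>y\<in>Y1. adj t y" using copy[OF T(1,2)] by blast
  have f1: "finite (T \<union> Y1)" "T \<union> Y1 \<subseteq> A" using T Y1 unfolding obstruction_def by auto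
  obtain Y2 where Y2: "Y2 \<subseteq> A" "obstruction T Y2" "Y2 \<inter> (T \<union> Y1) = {}" "\<forall>t\<in>T. \<exists>y\<in>Y2. adj t y"
    using copy[OF f1] by blast
  have f2: "finite (T \<union> Y1 \<union> Y2)" "T \<union> Y1 \<union> Y2 \<subseteq> A" using f1 Y2 unfolding obstruction_def by auto
  obtain Y3 where Y3: "Y3 \<subseteq> A" "obstruction T Y3" "Y3 \<inter> (T \<union> Y1 \<union> Y2) = {}" "\<forall>t\<in>T. \<exists>y\<in>Y3. adj t y"
    using copy[OF f2] by blast
  have "obstruction {} (T \<union> Y1 \<union> Y2 \<union> Y3)"
    using Y1(3) Y2(3,4) Y3(3,4) by (intro three_copies[OF T(1) Y1(2) Y2(2) Y3(2)]) blast+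
  moreover have "T \<union> Y1 \<union> Y2 \<union> Y3 \<subseteq> A" using f2 Y3 by blast
  ultimately show False using assms(7) unfolding strong_def by blast
qed

section \<open>Strongness and HF-orders\<close>

text \<open>No finite \<open>C\<close> is an obstruction, so it has an element with at most two
  neighbours in \<open>C \<union> A\<close>; this one is ranked last and the rest
  recursively.\<close>

lemma finite_ranking:
  assumes "strong A B" "finite C" "C \<subseteq> B - A"
  shows "\<exists>h :: 'v \<Rightarrow> nat. inj_on h C \<and> (\<forall>c\<in>C. \<not> deg_ge3 (A \<union> {y\<in>C. h y < h c}) c)"
  using assms(2,3)
proof (induction C rule: finite_psubset_induct)
  case (psubset C)
  show ?case
  proof (cases "C = {}")
    case False
    have "\<not> obstruction A C" using assms(1) psubset.prems unfolding strong_def by blast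
    then obtain c where c: "c \<in> C" "\<not> deg_ge3 (C \<union> A) c"
      using False psubset.hyps psubset.prems unfolding obstruction_def by blast
    let ?C = "C - {c}"
    have "?C \<subset> C" using c by blast
    then obtain h :: "'v \<Rightarrow> nat" where h: "inj_on h ?C" "\<forall>x\<in>?C. \<not> deg_ge3 (A \<union> {y\<in>?C. h y < h x}) x"
      using psubset.IH[OF \<open>?C \<subset> C\<close> order_trans[OF Diff_subset psubset.prems]] by (elim exE conjE) (rule that)
    \<comment> \<open>The sum serves as an upper bound of all earlier ranks.\<close>
    define N where "N = Suc (\<Sum>y\<in>?C. h y)"
    have N: "h y < N" if "y \<in> ?C" for y
      unfolding N_def using member_le_sum[of y ?C h] that psubset.hyps by simp
    let ?h = "h(c := N)"
    have "inj_on ?h C" using h(1) N unfolding inj_on_def by (auto simp: less_irrefl)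
    moreover have "\<not> deg_ge3 (A \<union> {y\<in>C. ?h y < ?h x}) x" if "x \<in> C" for x
    proof (cases "x = c")
      case True
      then show ?thesis using c(2) deg_ge3_mono[of "A \<union> {y\<in>C. ?h y < ?h x}" x "C \<union> A"] by blast
    next
      case False
      then have "x \<in> ?C" using that by blast
      then have "{y\<in>C. ?h y < ?h x} = {y\<in>?C. h y < h x}" using N[of x] False by auto
      then show ?thesis using h(2) \<open>x \<in> ?C\<close> by simp
    qed
    ultimately show ?thesis by blast
  qed simp
qed

text \<open>Compactness by an ultrafilter on the finite subsets of \<open>B - A\<close>:
  \<open>x\<close> precedes \<open>y\<close> if it has the smaller rank in almost all of them. Three
  predecessors of \<open>b\<close> would show up together in a single finite ranking. The limit need
  not be well-founded.\<close>

lemma strong_imp_order: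
  assumes "strong A B"
  obtains r where "strict_linear_order_on (B - A) r"
    "\<And>b. b \<in> B - A \<Longrightarrow> \<not> deg_ge3 (A \<union> {y\<in>B - A. (y, b) \<in> r}) b"
proof -
  let ?Z = "B - A"
  obtain H :: "'v set \<Rightarrow> 'v \<Rightarrow> nat" where H: "\<And>C. finite C \<Longrightarrow> C \<subseteq> ?Z \<Longrightarrow>
      inj_on (H C) C \<and> (\<forall>c\<in>C. \<not> deg_ge3 (A \<union> {y\<in>C. H C y < H C c}) c)"
    using finite_ranking[OF assms] by metis
  \<comment> \<open>This refinement puts each given element of \<open>?Z\<close> into almost every
    finite set.\<close>
  obtain U where U: "U \<le> finite_subsets_at_top ?Z" "ultra U"
    using ultra_exists[OF finite_subsets_at_top_neq_bot] by blast
  have ev: "eventually (\<lambda>C. finite C \<and> C \<subseteq> ?Z \<and> x \<in> C) U" if "x \<in> ?Z" for x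
  proof (rule filter_leD[OF U(1)])
    show "eventually (\<lambda>C. finite C \<and> C \<subseteq> ?Z \<and> x \<in> C) (finite_subsets_at_top ?Z)"
      unfolding eventually_finite_subsets_at_top using that by (intro exI[of _ "{x}"]) auto
  qed
  define r where "r = {(x, y). x \<in> ?Z \<and> y \<in> ?Z \<and> eventually (\<lambda>C. H C x < H C y) U}"
  have "trans r"
  proof (rule transI)
    fix x y z assume "(x, y) \<in> r" "(y, z) \<in> r"
    then have "x \<in> ?Z" "z \<in> ?Z" and e: "eventually (\<lambda>C. H C x < H C y) U" "eventually (\<lambda>C. H C y < H C z) U"
      unfolding r_def by auto
    moreover from e have "eventually (\<lambda>C. H C x < H C z) U" by eventually_elim simp
    ultimately show "(x, z) \<in> r" unfolding r_def by blast
  qed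
  moreover have "irrefl r" unfolding irrefl_def r_def using ultra_const[OF U(2), of False] by simp
  moreover have "total_on ?Z r"
  proof (rule total_onI)
    fix x y assume xy: "x \<in> ?Z" "y \<in> ?Z" "x \<noteq> y"
    have "eventually (\<lambda>C. H C x < H C y \<or> H C y < H C x) U"
      using ev[OF xy(1)] ev[OF xy(2)]
    proof eventually_elim
      case (elim C)
      then have "H C x \<noteq> H C y" using H[of C] xy(3) unfolding inj_on_def by blast
      then show ?case by linarith
    qed
    then show "(x, y) \<in> r \<or> (y, x) \<in> r" using ultra_disj[OF U(2)] xy unfolding r_def by blast
  qed
  ultimately have "strict_linear_order_on ?Z r" unfolding strict_linear_order_on_def by blast
  moreover have "\<not> deg_ge3 (A \<union> {y\<in>?Z. (y, b) \<in> r}) b" if b: "b \<in> ?Z" for b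
  proof
    assume "deg_ge3 (A \<union> {y\<in>?Z. (y, b) \<in> r}) b"
    then obtain x y z where xyz: "x \<in> A \<union> {y\<in>?Z. (y, b) \<in> r}" "y \<in> A \<union> {y\<in>?Z. (y, b) \<in> r}"
      "z \<in> A \<union> {y\<in>?Z. (y, b) \<in> r}" "x \<noteq> y" "x \<noteq> z" "y \<noteq> z" "adj b x" "adj b y" "adj b z" by (rule deg_ge3E)
    have m: "eventually (\<lambda>C. v \<in> A \<union> {y\<in>C. H C y < H C b}) U" if v: "v \<in> A \<union> {y\<in>?Z. (y, b) \<in> r}" for v
    proof (cases "v \<in> A")
      case False
      then have "v \<in> ?Z" "eventually (\<lambda>C. H C v < H C b) U" using v unfolding r_def by auto
      from ev[OF this(1)] this(2) show ?thesis by eventually_elim simp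
    qed simp
    have "eventually (\<lambda>C. False) U"
      using ev[OF b] m[OF xyz(1)] m[OF xyz(2)] m[OF xyz(3)]
    proof eventually_elim
      case (elim C)
      have "deg_ge3 (A \<union> {y\<in>C. H C y < H C b}) b" using elim(2-4) xyz(4-9) by (rule deg_ge3I)
      then show ?case using H[of C] elim(1) by blast
    qed
    then show False using ultra_const[OF U(2), of False] by simp
  qed
  ultimately show thesis using that by blast
qed

text \<open>A finite obstruction has a greatest element, whose three neighbours in
  \<open>X \<union> A\<close> all lie in \<open>A\<close> or below it.\<close>

lemma order_imp_strong:
  assumes "strict_linear_order_on (B - A) r" "A \<subseteq> B"
    "\<And>b. b \<in> B - A \<Longrightarrow> \<not> deg_ge3 (A \<union> {y\<in>B - A. (y, b) \<in> r}) b"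
  shows "strong A B"
  unfolding strong_def
proof (intro conjI allI impI notI)
  show "A \<subseteq> B" by fact
  have r: "trans r" "total_on (B - A) r" using assms(1) unfolding strict_linear_order_on_def by auto
  have mx: "\<exists>b\<in>X. \<forall>x\<in>X. x \<noteq> b \<longrightarrow> (x, b) \<in> r" if "finite X" "X \<noteq> {}" "X \<subseteq> B - A" for X
    using that
  proof (induction X rule: finite_ne_induct)
    case (insert x X)
    then obtain b where b: "b \<in> X" "\<forall>x\<in>X. x \<noteq> b \<longrightarrow> (x, b) \<in> r" by blast
    have "x \<noteq> b" using b insert.hyps by blast
    then have "(x, b) \<in> r \<or> (b, x) \<in> r" using r(2) insert.prems b(1) unfolding total_on_def by blast
    then show ?case
    proof
      assume "(x, b) \<in> r"
      then show ?thesis using b by blast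
    next
      assume bx: "(b, x) \<in> r"
      have "(y, x) \<in> r" if "y \<in> X" for y using b(2) that bx transD[OF r(1)] by (cases "y = b") blast+
      then show ?thesis by blast
    qed
  qed simp
  fix X assume X: "X \<subseteq> B" "obstruction A X"
  then have XZ: "finite X" "X \<noteq> {}" "X \<subseteq> B - A" unfolding obstruction_def by auto
  obtain b where b: "b \<in> X" "\<forall>x\<in>X. x \<noteq> b \<longrightarrow> (x, b) \<in> r" using mx[OF XZ] by blast
  have "deg_ge3 (X \<union> A) b" using X(2) b(1) unfolding obstruction_def by blast
  then obtain x y z where xyz: "x \<in> X \<union> A" "y \<in> X \<union> A" "z \<in> X \<union> A" "x \<noteq> y" "x \<noteq> z" "y \<noteq> z"
    "adj b x" "adj b y" "adj b z" by (rule deg_ge3E)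
  have m: "v \<in> A \<union> {y\<in>B - A. (y, b) \<in> r}" if "v \<in> X \<union> A" "adj b v" for v
  proof -
    have "v \<noteq> b" using that(2) adj_irrefl by blast
    then show ?thesis using that(1) b(2) XZ(3) by blast
  qed
  have "deg_ge3 (A \<union> {y\<in>B - A. (y, b) \<in> r}) b"
    using m[OF xyz(1,7)] m[OF xyz(2,8)] m[OF xyz(3,9)] xyz(4-9) by (rule deg_ge3I)
  then show False using assms(3) b(1) XZ(3) by blast
qed

end

section \<open>The incidence graph of a projective plane\<close>

locale plane_graph = fixes B :: "('p, 'l) plane"

sublocale plane_graph \<subseteq> bipartite_graph "incident B" isl
proof
  show "incident B x y \<Longrightarrow> incident B y x" for x y by (cases x; cases y) auto
  show "incident B x y \<Longrightarrow> isl x \<noteq> isl y" for x y by (cases x; cases y) auto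
qed

context plane_graph begin

lemma elements_iff [simp]: "Inl p \<in> elements P \<longleftrightarrow> p \<in> points P" "Inr l \<in> elements P \<longleftrightarrow> l \<in> lines P"
  unfolding elements_def by auto

lemma incident_substructure:
  assumes "substructure A B" "x \<in> elements A" "y \<in> elements A"
  shows "incident A x y \<longleftrightarrow> incident B x y"
  using assms unfolding substructure_def by (cases x; cases y) auto

lemma hf_constructible_iff_strong:
  assumes "substructure A B"
  shows "hf_constructible A B \<longleftrightarrow> strong (elements A) (elements B)"
proof -
  let ?A = "elements A" and ?B = "elements B"
  have sub: "?A \<subseteq> ?B" using assms unfolding substructure_def elements_def by auto
  have eq: "{x\<in>?B. incident B b x \<and> (x \<in> ?A \<or> x \<notin> ?A \<and> (x, b) \<in> r)} =
      {y\<in>?A \<union> {y\<in>?B - ?A. (y, b) \<in> r}. incident B b y}" for b r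
    using sub by blast
  have "hf_constructible A B \<longleftrightarrow> (\<exists>r. strict_linear_order_on (?B - ?A) r \<and>
      (\<forall>b\<in>?B - ?A. \<not> deg_ge3 (?A \<union> {y\<in>?B - ?A. (y, b) \<in> r}) b))"
    unfolding hf_constructible_def Let_def eq deg_ge3_iff_card by simp
  also have "\<dots> \<longleftrightarrow> strong ?A ?B"
  proof
    assume "strong ?A ?B"
    then obtain r where "strict_linear_order_on (?B - ?A) r"
      "\<And>b. b \<in> ?B - ?A \<Longrightarrow> \<not> deg_ge3 (?A \<union> {y\<in>?B - ?A. (y, b) \<in> r}) b" by (rule strong_imp_order) (rule that)
    then show "\<exists>r. strict_linear_order_on (?B - ?A) r \<and>
      (\<forall>b\<in>?B - ?A. \<not> deg_ge3 (?A \<union> {y\<in>?B - ?A. (y, b) \<in> r}) b)" by (intro exI[of _ r] conjI ballI)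
  qed (use order_imp_strong sub in blast)
  finally show ?thesis .
qed

text \<open>Adjacency is that of \<open>B\<close>, which agrees with that of \<open>A\<close> on the
  elements of \<open>A\<close>. With \<open>A\<close> taken to be \<open>B\<close> it also covers
  the larger plane.\<close>

lemma open_pplane_elements:
  assumes "substructure A B" "projective_plane A" "nondegenerate A" "open_plane A"
  shows "open_pplane (elements A)"
proof -
  let ?A = "elements A"
  have inc: "inc B p l \<longleftrightarrow> inc A p l" if "p \<in> points A" "l \<in> lines A" for p l
    using assms(1) that unfolding substructure_def by blast
  have op: "strong {} ?A"
    unfolding strong_def
  proof (intro conjI allI impI notI)
    fix C assume C: "C \<subseteq> ?A" "obstruction {} C"
    then have fC: "finite C" "C \<noteq> {}" "\<forall>x\<in>C. deg_ge3 C x" unfolding obstruction_def by auto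
    have "3 \<le> card {y\<in>C. incident A x y}" if "x \<in> C" for x
    proof -
      have "{y\<in>C. incident A x y} = {y\<in>C. incident B x y}"
        using incident_substructure[OF assms(1)] C(1) that by blast
      moreover have "\<not> card {y\<in>C. incident B x y} \<le> 2"
        using fC that unfolding deg_ge3_iff_card by auto
      ultimately show ?thesis by simp
    qed
    then show False using assms(4) C(1) fC(1,2) unfolding open_plane_def by blast
  qed simp
  have pp: "pplane ?A"
    unfolding pplane_def
  proof (intro ballI impI)
    fix x y assume xy: "x \<in> ?A" "y \<in> ?A" "x \<noteq> y \<and> isl x = isl y"
    show "\<exists>!z. z \<in> ?A \<and> incident B z x \<and> incident B z y"
    proof (cases x)
      case (Inl p)
      then obtain q where q: "y = Inl q" using xy by (cases y) auto
      have "\<exists>!l. l \<in> lines A \<and> inc A p l \<and> inc A q l"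
        using assms(2) xy Inl q unfolding projective_plane_def by auto
      then obtain l where l: "l \<in> lines A" "inc A p l" "inc A q l"
        "\<And>m. m \<in> lines A \<Longrightarrow> inc A p m \<Longrightarrow> inc A q m \<Longrightarrow> m = l" by blast
      show ?thesis
      proof (rule ex1I[of _ "Inr l"])
        show "Inr l \<in> ?A \<and> incident B (Inr l) x \<and> incident B (Inr l) y" using l(1-3) Inl q xy inc by simp
        show "z = Inr l" if "z \<in> ?A \<and> incident B z x \<and> incident B z y" for z
          using that l(4) Inl q xy inc by (cases z) auto
      qed
    next
      case (Inr k)
      then obtain m where m: "y = Inr m" using xy by (cases y) auto
      have "\<exists>!p. p \<in> points A \<and> inc A p k \<and> inc A p m"
        using assms(2) xy Inr m unfolding projective_plane_def by auto
      then obtain p where p: "p \<in> points A" "inc A p k" "inc A p m"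
        "\<And>q. q \<in> points A \<Longrightarrow> inc A q k \<Longrightarrow> inc A q m \<Longrightarrow> q = p" by blast
      show ?thesis
      proof (rule ex1I[of _ "Inl p"])
        show "Inl p \<in> ?A \<and> incident B (Inl p) x \<and> incident B (Inl p) y" using p(1-3) Inr m xy inc by simp
        show "z = Inl p" if "z \<in> ?A \<and> incident B z x \<and> incident B z y" for z
          using that p(4) Inr m xy inc by (cases z) auto
      qed
    qed
  qed
  obtain Q where Q: "Q \<subseteq> points A" "card Q = 4" "\<And>T. T \<subseteq> Q \<Longrightarrow> card T = 3 \<Longrightarrow> \<not> collinear A T"
    using assms(3) unfolding nondegenerate_def by blast
  have "thick ?A"
  proof (rule quadrangle_imp_thick[OF pp])
    show "Inl ` Q \<subseteq> ?A" using Q(1) by auto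
    show "card (Inl ` Q :: ('p + 'l) set) = 4" using Q(2) by (simp add: card_image)
    show "isl x" if "x \<in> Inl ` Q" for x :: "'p + 'l" using that by auto
    show "\<not> deg_ge3 (Inl ` Q) l" if "l \<in> ?A" for l
    proof
      assume "deg_ge3 (Inl ` Q) l"
      then obtain x y z where xyz: "x \<in> Inl ` Q" "y \<in> Inl ` Q" "z \<in> Inl ` Q" "x \<noteq> y" "x \<noteq> z" "y \<noteq> z"
        "incident B l x" "incident B l y" "incident B l z" by (rule deg_ge3E)
      then obtain a b c where abc: "x = Inl a" "y = Inl b" "z = Inl c" "a \<in> Q" "b \<in> Q" "c \<in> Q" by blast
      then obtain m where m: "l = Inr m" "m \<in> lines A" using xyz(7) \<open>l \<in> ?A\<close> by (cases l) auto
      have "inc A a m" "inc A b m" "inc A c m" using xyz(7-9) abc m inc Q(1) by auto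
      then have "collinear A {a, b, c}" using m(2) unfolding collinear_def by auto
      moreover have "card {a, b, c} = 3" using xyz(4-6) abc by auto
      ultimately show False using Q(3)[of "{a, b, c}"] abc by auto
    qed
  qed
  then show ?thesis using op pp unfolding open_pplane_def by blast
qed

definition merge :: "(nat \<Rightarrow> 'p) \<Rightarrow> (nat \<Rightarrow> 'l) \<Rightarrow> nat + nat \<Rightarrow> 'p + 'l" where
  "merge e f = case_sum (\<lambda>i. Inl (e i)) (\<lambda>j. Inr (f j))"

lemma merge_simps [simp]: "merge e f (Inl i) = Inl (e i)" "merge e f (Inr j) = Inr (f j)"
  unfolding merge_def by simp_all

lemma merge_upd: "(merge e f)(Inl i := Inl p) = merge (e(i := p)) f" "(merge e f)(Inr j := Inr l) = merge e (f(j := l))"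
  unfolding merge_def by (auto simp: fun_eq_iff split: sum.splits)

lemma sat_iff_gsat:
  assumes "substructure A B" "range e \<subseteq> points A" "range f \<subseteq> lines A"
  shows "sat A e f \<phi> \<longleftrightarrow> gsat (elements A) (merge e f) \<phi>"
  using assms(2,3)
proof (induction \<phi> arbitrary: e f)
  case (Inc i j)
  have "e i \<in> points A" "f j \<in> lines A" using Inc by auto
  then show ?case using assms(1) unfolding substructure_def by simp
next
  case (ExPoint i \<phi>)
  have "sat A e f (ExPoint i \<phi>) \<longleftrightarrow> (\<exists>p\<in>points A. gsat (elements A) ((merge e f)(Inl i := Inl p)) \<phi>)"
  proof -
    have "sat A (e(i := p)) f \<phi> \<longleftrightarrow> gsat (elements A) (merge (e(i := p)) f) \<phi>" if "p \<in> points A" for p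
      using ExPoint.prems that by (intro ExPoint.IH) auto
    then show ?thesis by (simp add: merge_upd)
  qed
  also have "\<dots> \<longleftrightarrow> gsat (elements A) (merge e f) (ExPoint i \<phi>)"
    unfolding gsat.simps by (metis elements_iff(1) isl_def)
  finally show ?case .
next
  case (ExLine j \<phi>)
  have "sat A e f (ExLine j \<phi>) \<longleftrightarrow> (\<exists>l\<in>lines A. gsat (elements A) ((merge e f)(Inr j := Inr l)) \<phi>)"
  proof -
    have "sat A e (f(j := l)) \<phi> \<longleftrightarrow> gsat (elements A) (merge e (f(j := l))) \<phi>" if "l \<in> lines A" for l
      using ExLine.prems that by (intro ExLine.IH) auto
    then show ?thesis by (simp add: merge_upd)
  qed
  also have "\<dots> \<longleftrightarrow> gsat (elements A) (merge e f) (ExLine j \<phi>)"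
    unfolding gsat.simps by (metis elements_iff(2) isl_def obj_sumE sum.disc(2))
  finally show ?case .
qed simp_all

end

theorem theorem1p3:
  fixes A B :: "('p, 'l) plane"
  assumes "projective_plane A" and "nondegenerate A" and "open_plane A"
    and "projective_plane B" and "nondegenerate B" and "open_plane B"
    and "substructure A B"
  shows "elementary_substructure A B \<longleftrightarrow> hf_constructible A B"
proof -
  interpret plane_graph B .
  let ?A = "elements A" and ?B = "elements B"
  have BB: "substructure B B" unfolding substructure_def by simp
  have oA: "open_pplane ?A" using open_pplane_elements[OF assms(7,1,2,3)] .
  have oB: "open_pplane ?B" using open_pplane_elements[OF BB assms(4,5,6)] .
  have sub: "?A \<subseteq> ?B" "points A \<subseteq> points B" "lines A \<subseteq> lines B"
    using assms(7) unfolding substructure_def elements_def by auto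
  have "elementary_substructure A B \<longleftrightarrow> strong ?A ?B"
  proof
    assume el: "elementary_substructure A B"
    obtain x where x: "x \<in> ?A" using oA unfolding open_pplane_def thick_def by blast
    obtain y where y: "y \<in> ?A" "incident B x y" using obtain_nbrs[OF oA x, of "{}"] by auto
    obtain p0 l0 where pl: "p0 \<in> ?A" "isl p0" "l0 \<in> ?A" "\<not> isl l0"
      using adj_sort[OF y(2)] x y(1) by (cases "isl x") auto
    show "strong ?A ?B"
    proof (rule elementary_imp_strong[OF _ pl sub(1)])
      show "strong {} ?A" using oA unfolding open_pplane_def by blast
      fix \<phi> and \<rho> :: "nat + nat \<Rightarrow> 'p + 'l"
      assume r: "range \<rho> \<subseteq> ?A" "\<And>n. isl (\<rho> n) \<longleftrightarrow> isl n" and g: "gsat ?B \<rho> \<phi>"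
      \<comment> \<open>A sorted assignment of the merged domain splits into a point part and a line
        part, which \<open>merge\<close> puts together again.\<close>
      define e where "e i = projl (\<rho> (Inl i))" for i
      define f where "f j = projr (\<rho> (Inr j))" for j
      have ei: "Inl (e i) = \<rho> (Inl i)" for i unfolding e_def using r(2)[of "Inl i"] by simp
      have fj: "Inr (f j) = \<rho> (Inr j)" for j unfolding f_def using r(2)[of "Inr j"] by simp
      have \<rho>: "\<rho> = merge e f"
      proof
        show "\<rho> n = merge e f n" for n using ei fj by (cases n) auto
      qed
      have "Inl (e i) \<in> ?A" for i using r(1) unfolding ei by blast
      then have ee: "range e \<subseteq> points A" by auto
      have "Inr (f j) \<in> ?A" for j using r(1) unfolding fj by blast
      then have ff: "range f \<subseteq> lines A" by auto
      have "sat B e f \<phi>" using g sat_iff_gsat[OF BB] ee ff sub(2,3) unfolding \<rho> by blast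
      then have "sat A e f \<phi>" using el ee ff unfolding elementary_substructure_def by blast
      then show "gsat ?A \<rho> \<phi>" using sat_iff_gsat[OF assms(7) ee ff] unfolding \<rho> by blast
    qed
  next
    assume st: "strong ?A ?B"
    obtain U :: "nat filter" where U: "U \<le> sequentially" "ultra U"
      using ultra_exists[of sequentially] by auto
    interpret ultrapower "incident B" isl U by unfold_locales (use U in auto)
    show "elementary_substructure A B"
      unfolding elementary_substructure_def
    proof (intro conjI allI impI)
      fix \<phi> :: form and e :: "nat \<Rightarrow> 'p" and f :: "nat \<Rightarrow> 'l"
      assume "range e \<subseteq> points A \<and> range f \<subseteq> lines A"
      then have ef: "range e \<subseteq> points A" "range f \<subseteq> lines A" by auto
      have "merge e f n \<in> ?A" for n using ef by (cases n) auto
      then have "range (merge e f) \<subseteq> ?A" by blast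
      then have "gsat ?A (merge e f) \<phi> \<longleftrightarrow> gsat ?B (merge e f) \<phi>"
        using strong_imp_gsat_iff[OF oA oB st, of "merge e f"] by simp
      then show "sat A e f \<phi> \<longleftrightarrow> sat B e f \<phi>"
        using sat_iff_gsat[OF assms(7) ef] sat_iff_gsat[OF BB, of e f] ef sub(2,3) by blast
    qed (rule assms(7))
  qed
  then show ?thesis using hf_constructible_iff_strong[OF assms(7)] by simp
qed

end
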